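(* Let $\Gamma=(X,F,r)$ be a gambling house such that: - $(X,d)$ is a compact metric space, - $r:X\to[0,1]$ is continuous, and - $F$ is non expansive for the Kantorovich–Rubinstein distance: for all $x,x'\in X$ and $u\in F(x)$ there exists $u'\in F(x')$ with $d_{KR}(u,u')\le d(x,x')$. Then $\Gamma$ has a general uniform value $v^*$, given for every $x\in X$ by $$v^*(x)=\inf\Big\{w(\delta_x):\ w:\Delta(X)\to[0,1]\text{ affine and weak-* continuous, such that (1) and (2) hold}\Big\},$$ where the two conditions on $w$ are: - (1) $w(\delta_y)\ge\sup_{u\in F(y)}w(u)$ for all $y\in X$; - (2) $w(u)\ge r(u)$ for all $u\in R$.
   Context: **Gambling house.** A gambling house $\Gamma=(X,F,r)$ consists of: - a nonempty set $X$, - a correspondence $F:X\rightrightarrows Z:=\Delta_f(X)$ (finitely supported probabilities) with nonempty values, and - $r:X\to[0,1]$. The payoff $r$ is extended linearly (and, when $X$ is compact metric and $r$ continuous, to all Borel probabilities by $r(u)=\int r\,du$). The mixed extension of $F$ is $$\hat F(u)=\Big\{\sum_xu(x)f(x):\ f:X\to Z,\ f(x)\in\mathrm{conv}\,F(x)\ \forall x\Big\}\quad\text{for } u\in Z.$$ **Plays and values.** A (mixed) play at $x_0\in X$ is a sequence $(u_1,u_2,\dots)\in Z^{\infty}$ with $u_1\in\mathrm{conv}\,F(x_0)$ and $u_{t+1}\in\hat F(u_t)$ for all $t\ge1$. - An evaluation is $\theta=(\theta_t)_{t\ge1}\in\Delta(\mathbb N^* )$, with impatience $I(\theta)=\sum_{t\ge1}|\theta_{t+1}-\theta_t|$.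 - The $\theta$-payoff of a play $\sigma=(u_t)_t$ is $\gamma_\theta(\sigma)=\sum_t\theta_tr(u_t)$. - The $\theta$-value at $x_0$ is $v_\theta(x_0)=\sup_\sigma\gamma_\theta(\sigma)$ over mixed plays $\sigma$ at $x_0$. **General values.** $\Gamma$ has a general limit value $v^*$ if for every $\varepsilon>0$ there is $\alpha>0$ such that $I(\theta)\le\alpha$ implies $|v_\theta(x)-v^*(x)|\le\varepsilon$ for all $x\in X$. It has a general uniform value if moreover, for every $\varepsilon>0$, there exist $\alpha>0$ and for each $x$ a mixed play $\sigma(x)$ at $x$ such that $I(\theta)\le\alpha$ implies $\gamma_\theta(\sigma(x))\ge v^*(x)-\varepsilon$ for all $x$. **Invariant measures.** $d_{KR}$ is the Kantorovich–Rubinstein distance on $\Delta(X)$ (Borel probabilities with the weak-* topology). The set of invariant measures is $R=\{u\in\Delta(X):(u,u)\in\mathrm{cl}(\mathrm{Graph}\,\hat F)\}$, where the closure is taken in $\Delta(X)\times\Delta(X)$. *)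

theory Defs
  imports "HOL-Probability.Probability"
begin

definition Zf :: "'a set \<Rightarrow> 'a pmf set" where
  "Zf S = {p. finite (set_pmf p) \<and> set_pmf p \<subseteq> S}"

definition Delta :: "'a::metric_space set \<Rightarrow> 'a measure set" where
  "Delta S = {M. sets M = sets borel \<and> prob_space M \<and> emeasure M S = 1}"

definition to_meas :: "'a::metric_space pmf \<Rightarrow> 'a measure" where
  "to_meas p = distr (measure_pmf p) borel (\<lambda>x. x)"

definition mix_meas :: "real \<Rightarrow> 'a::metric_space measure \<Rightarrow> 'a measure \<Rightarrow> 'a measure" where
  "mix_meas l M N = measure_of UNIV (sets borel)
     (\<lambda>A. ennreal l * emeasure M A + ennreal (1 - l) * emeasure N A)"

definition weak_conv :: "'a::metric_space set \<Rightarrow> (nat \<Rightarrow> 'a measure) \<Rightarrow> 'a measure \<Rightarrow> bool" where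
  "weak_conv S Ms M \<longleftrightarrow>
     (\<forall>f::'a \<Rightarrow> real. continuous_on S f \<longrightarrow>
        (\<lambda>n. (LINT x:S|Ms n. f x)) \<longlonglongrightarrow> (LINT x:S|M. f x))"

definition dKR :: "'a::metric_space set \<Rightarrow> 'a measure \<Rightarrow> 'a measure \<Rightarrow> real" where
  "dKR S M N = (SUP f \<in> {f::'a \<Rightarrow> real. 1-lipschitz_on S f}.
                  (LINT x:S|M. f x) - (LINT x:S|N. f x))"

definition convF :: "('a \<Rightarrow> 'a pmf set) \<Rightarrow> 'a \<Rightarrow> 'a pmf set" where
  "convF F x = {join_pmf Q | Q. finite (set_pmf Q) \<and> set_pmf Q \<subseteq> F x}"

definition hatF :: "('a \<Rightarrow> 'a pmf set) \<Rightarrow> 'a pmf \<Rightarrow> 'a pmf set" where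
  "hatF F u = {bind_pmf u f | f. \<forall>y\<in>set_pmf u. f y \<in> convF F y}"

definition rZ :: "('a \<Rightarrow> real) \<Rightarrow> 'a pmf \<Rightarrow> real" where
  "rZ r u = measure_pmf.expectation u r"

text \<open>Mixed plays at x0; index 0 stands for stage 1.\<close>
definition is_play :: "('a \<Rightarrow> 'a pmf set) \<Rightarrow> 'a \<Rightarrow> (nat \<Rightarrow> 'a pmf) \<Rightarrow> bool" where
  "is_play F x0 \<sigma> \<longleftrightarrow> \<sigma> 0 \<in> convF F x0 \<and> (\<forall>t. \<sigma> (Suc t) \<in> hatF F (\<sigma> t))"

text \<open>Evaluations (probabilities on the stages; index 0 stands for stage 1) and impatience.\<close>
definition evaluation :: "(nat \<Rightarrow> real) \<Rightarrow> bool" where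
  "evaluation \<theta> \<longleftrightarrow> (\<forall>t. 0 \<le> \<theta> t) \<and> \<theta> sums 1"

definition impatience :: "(nat \<Rightarrow> real) \<Rightarrow> real" where
  "impatience \<theta> = (\<Sum>t. \<bar>\<theta> (Suc t) - \<theta> t\<bar>)"

definition gamma :: "('a \<Rightarrow> real) \<Rightarrow> (nat \<Rightarrow> real) \<Rightarrow> (nat \<Rightarrow> 'a pmf) \<Rightarrow> real" where
  "gamma r \<theta> \<sigma> = (\<Sum>t. \<theta> t * rZ r (\<sigma> t))"

definition val :: "('a \<Rightarrow> 'a pmf set) \<Rightarrow> ('a \<Rightarrow> real) \<Rightarrow> (nat \<Rightarrow> real) \<Rightarrow> 'a \<Rightarrow> real" where
  "val F r \<theta> x0 = (SUP \<sigma> \<in> {\<sigma>. is_play F x0 \<sigma>}. gamma r \<theta> \<sigma>)"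

definition has_general_limit_value ::
  "'a set \<Rightarrow> ('a \<Rightarrow> 'a pmf set) \<Rightarrow> ('a \<Rightarrow> real) \<Rightarrow> ('a \<Rightarrow> real) \<Rightarrow> bool" where
  "has_general_limit_value S F r v \<longleftrightarrow>
     (\<forall>\<epsilon>>0. \<exists>\<alpha>>0. \<forall>\<theta>. evaluation \<theta> \<and> impatience \<theta> \<le> \<alpha> \<longrightarrow>
        (\<forall>x\<in>S. \<bar>val F r \<theta> x - v x\<bar> \<le> \<epsilon>))"

definition has_general_uniform_value ::
  "'a set \<Rightarrow> ('a \<Rightarrow> 'a pmf set) \<Rightarrow> ('a \<Rightarrow> real) \<Rightarrow> ('a \<Rightarrow> real) \<Rightarrow> bool" where
  "has_general_uniform_value S F r v \<longleftrightarrow> has_general_limit_value S F r v \<and>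
     (\<forall>\<epsilon>>0. \<exists>\<alpha>>0. \<exists>\<sigma>. (\<forall>x\<in>S. is_play F x (\<sigma> x)) \<and>
        (\<forall>\<theta>. evaluation \<theta> \<and> impatience \<theta> \<le> \<alpha> \<longrightarrow>
           (\<forall>x\<in>S. gamma r \<theta> (\<sigma> x) \<ge> v x - \<epsilon>)))"

text \<open>Invariant measures: u with (u,u) in the weak-* closure of Graph(hatF)
  (sequential closure; Delta S x Delta S is compact metrizable).\<close>
definition invariant_measures ::
  "'a::metric_space set \<Rightarrow> ('a \<Rightarrow> 'a pmf set) \<Rightarrow> 'a measure set" where
  "invariant_measures S F = {u \<in> Delta S. \<exists>p q. (\<forall>n. p n \<in> Zf S \<and> q n \<in> hatF F (p n)) \<and>
      weak_conv S (\<lambda>n. to_meas (p n)) u \<and> weak_conv S (\<lambda>n. to_meas (q n)) u}"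

definition affine_cont :: "'a::metric_space set \<Rightarrow> ('a measure \<Rightarrow> real) \<Rightarrow> bool" where
  "affine_cont S w \<longleftrightarrow>
     (\<forall>M\<in>Delta S. 0 \<le> w M \<and> w M \<le> 1) \<and>
     (\<forall>M\<in>Delta S. \<forall>N\<in>Delta S. \<forall>l\<in>{0..1}. w (mix_meas l M N) = l * w M + (1 - l) * w N) \<and>
     (\<forall>Ms M. (\<forall>n. Ms n \<in> Delta S) \<longrightarrow> M \<in> Delta S \<longrightarrow> weak_conv S Ms M \<longrightarrow>
        (\<lambda>n. w (Ms n)) \<longlonglongrightarrow> w M)"

definition Wset :: "'a::metric_space set \<Rightarrow> ('a \<Rightarrow> 'a pmf set) \<Rightarrow> ('a \<Rightarrow> real)
    \<Rightarrow> ('a measure \<Rightarrow> real) set" where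
  "Wset S F r = {w. affine_cont S w \<and>
      (\<forall>y\<in>S. w (return borel y) \<ge> (SUP u \<in> F y. w (to_meas u))) \<and>
      (\<forall>u\<in>invariant_measures S F. w u \<ge> (LINT x:S|u. r x))}"

definition vstar :: "'a::metric_space set \<Rightarrow> ('a \<Rightarrow> 'a pmf set) \<Rightarrow> ('a \<Rightarrow> real) \<Rightarrow> 'a \<Rightarrow> real" where
  "vstar S F r x = Inf {w (return borel x) | w. w \<in> Wset S F r}"

end

theory Submission
  imports Defs
begin

text \<open>
  Let \<open>T f x\<close> be the supremum of \<open>u(f)\<close> over \<open>u \<in> F x\<close>. An admissible \<open>w\<close> is the integral of a
  continuous \<open>f\<close> with \<open>T f \<le> f\<close> and \<open>u(r) \<le> u(f)\<close> for every invariant \<open>u\<close>.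

  Upper bound: along a play the mean of such an \<open>f\<close> does not increase. The occupation measures
  \<open>\<Sum>t. \<theta> t * u t\<close> and \<open>\<Sum>t. \<theta> t * u (t + 1)\<close> form a point of the graph of the mixed extension and
  differ by at most a multiple of the impatience, so their weak limits are invariant; hence payoffs
  asymptotically do not exceed \<open>f x\<close>.

  Lower bound: let \<open>C\<close> be the set of equicontinuous \<open>f\<close> that satisfy \<open>T f \<le> f + 1/n\<close> and dominate \<open>r\<close> on
  invariant measures. It is convex and stable under the operators
  \<open>f \<mapsto>\<close> value of (\<open>b\<close> times the average payoff over \<open>n\<close> stages plus \<open>1 - b\<close> times the final mean of \<open>f\<close>).
  Since \<open>C\<close> is totally bounded, a finite minimax argument turns \<open>u(f) \<ge> c\<close> for all \<open>f\<close> in \<open>C\<close> into a block of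
  \<open>n\<close> stages with average at least \<open>c - \<delta>\<close> at whose end the same bound holds with \<open>c - \<delta>\<close>. Concatenating
  blocks with summable errors gives a play good for all patient evaluations at once. As \<open>n\<close>
  grows, \<open>C\<close> shrinks to the equicontinuous admissible functions, by compactness.
\<close>

text \<open>The infimum defining \<open>vstar\<close> runs over all admissible functions, a family
  without a common modulus of continuity, whereas minimax needs a finite net and the limit in
  \<open>n\<close> needs compactness. So plays are built against the equicontinuous class only, and
  a priori they reach the possibly larger infimum over that class. The two infima agree because of
  the bounds themselves: a play securing more than \<open>vstar\<close> at all patient evaluations
  would contradict the upper bound given by some dominating function. The relaxation by
  \<open>1/n\<close> is forced by the payoff: a block adds \<open>b/n\<close> at each stage, and
  this amount may be lost in excessivity. Domination on invariant measures is stable because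
  \<open>M(f) \<le> M(T f)\<close> for invariant \<open>M\<close>, the weak limit of an inequality
  valid on the graph of \<open>hatF\<close>. The upper bound at first depends on the chosen
  function; its uniformity in the starting point comes from a finite net of equicontinuous
  admissible functions.\<close>

abbreviation mean :: "'a pmf \<Rightarrow> ('a \<Rightarrow> real) \<Rightarrow> real" where
  "mean p f \<equiv> measure_pmf.expectation p f"

section \<open>Finitely supported laws as Borel measures\<close>

lemma set_lint_eq_pmf_expectation:
  fixes f :: "'a::metric_space \<Rightarrow> real"
  assumes "compact S" and "continuous_on S f" and p: "p \<in> Zf S"
  shows "(LINT x:S|to_meas p. f x) = mean p f"
proof -
  have S: "S \<in> sets borel"
    using assms(1) by (intro borel_closed compact_imp_closed)
  have m: "(\<lambda>x. indicator S x *\<^sub>R f x) \<in> borel_measurable borel"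
    using borel_measurable_continuous_on_indicator[OF S assms(2)] .
  have "(LINT x:S|to_meas p. f x) = (\<integral>x. indicator S x *\<^sub>R f x \<partial>measure_pmf p)"
    unfolding set_lebesgue_integral_def to_meas_def
    by (subst integral_distr[OF _ m]) auto
  also have "\<dots> = mean p f"
    using p by (intro integral_cong_AE) (auto simp: AE_measure_pmf_iff Zf_def)
  finally show ?thesis .
qed

lemma to_meas_in_Delta:
  assumes "compact S" "p \<in> Zf S"
  shows "to_meas p \<in> Delta S"
proof -
  interpret prob_space "to_meas p"
    unfolding to_meas_def by (intro prob_space.prob_space_distr prob_space_measure_pmf) auto
  have S: "S \<in> sets borel"
    using assms(1) by (intro borel_closed compact_imp_closed)
  have "emeasure (to_meas p) S = emeasure (measure_pmf p) S"
    using S by (simp add: to_meas_def emeasure_distr)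
  also have "\<dots> = 1"
    using assms(2) by (subst measure_pmf.emeasure_eq_1_AE) (auto simp: AE_measure_pmf_iff Zf_def)
  finally show ?thesis
    using prob_space_axioms by (simp add: Delta_def to_meas_def)
qed

section \<open>Weak compactness of finitely supported laws\<close>

text \<open>At the first differing digit \<open>k\<close> the codes differ by \<open>1/3^k\<close>,
  while all later digits together contribute at most half of that. In base 2 the tail could cancel
  the digit completely.\<close>

lemma ternary_code_separates:
  fixes b b' :: "nat \<Rightarrow> bool"
  defines "c \<equiv> \<lambda>b. \<Sum>j. of_bool (b j) / (3::real) ^ j"
  assumes close: "\<bar>c b - c b'\<bar> < 1 / (2 * 3 ^ m)" and "j \<le> m"
  shows "b j = b' j"
proof (rule ccontr)
  assume "b j \<noteq> b' j"
  define k where "k = (LEAST j. b j \<noteq> b' j)"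
  have k1: "b k \<noteq> b' k"
    unfolding k_def by (rule LeastI[of "\<lambda>j. b j \<noteq> b' j"]) fact
  have k2: "b i = b' i" if "i < k" for i
    using not_less_Least[of i "\<lambda>j. b j \<noteq> b' j"] that unfolding k_def by simp
  have "k \<le> m"
    using Least_le[of "\<lambda>j. b j \<noteq> b' j", OF \<open>b j \<noteq> b' j\<close>] \<open>j \<le> m\<close> unfolding k_def by simp
  have g: "summable (\<lambda>j. 1 / (3::real) ^ j)"
    using summable_geometric[of "1/3::real"] by (simp add: power_one_over)
  have s: "summable (\<lambda>j. of_bool (a j) / (3::real) ^ j)" for a
    by (rule summable_comparison_test[OF _ g]) auto
  define d where "d j = (of_bool (b j) - of_bool (b' j)) / (3::real) ^ j" for j
  have sd: "summable d"
    unfolding d_def diff_divide_distrib by (intro summable_diff s)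
  have cd: "c b - c b' = suminf d"
    unfolding c_def d_def diff_divide_distrib by (intro suminf_diff s)
  have "suminf d = (\<Sum>i. d (i + Suc k)) + (\<Sum>i<Suc k. d i)"
    by (rule suminf_split_initial_segment[OF sd])
  also have "(\<Sum>i<Suc k. d i) = d k"
    using k2 by (simp add: d_def)
  finally have dd: "suminf d = (\<Sum>i. d (i + Suc k)) + d k" .
  have gs: "(\<lambda>i. 1 / 3 ^ Suc k * (1/3::real) ^ i) sums (1 / 3 ^ Suc k * (1 / (1 - 1/3)))"
    by (intro sums_mult geometric_sums) auto
  have nd: "norm (d (i + Suc k)) \<le> 1 / 3 ^ Suc k * (1/3) ^ i" for i
    by (auto simp: d_def power_add power_one_over field_simps)
  have sn: "summable (\<lambda>i. norm (d (i + Suc k)))"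
    by (rule summable_comparison_test[OF _ sums_summable[OF gs]]) (use nd in auto)
  have "\<bar>\<Sum>i. d (i + Suc k)\<bar> \<le> (\<Sum>i. norm (d (i + Suc k)))"
    using summable_norm[OF sn] by simp
  also have "\<dots> \<le> (\<Sum>i. 1 / 3 ^ Suc k * (1/3) ^ i)"
    by (intro suminf_le nd sn sums_summable[OF gs])
  also have "\<dots> = 1 / (2 * 3 ^ k)"
    using sums_unique[OF gs] by simp
  finally have tail: "\<bar>\<Sum>i. d (i + Suc k)\<bar> \<le> 1 / (2 * 3 ^ k)" .
  have "\<bar>d k\<bar> = 1 / 3 ^ k"
    using k1 by (auto simp: d_def abs_if)
  with tail dd have "\<bar>suminf d\<bar> \<ge> 1 / (2 * 3 ^ k)"
    by (simp add: abs_if split: if_splits)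
  moreover have "1 / (2 * 3 ^ k) \<ge> 1 / (2 * (3::real) ^ m)"
    using \<open>k \<le> m\<close> by (intro divide_left_mono mult_left_mono power_increasing) auto
  ultimately show False
    using close cd by linarith
qed

text \<open>A point is coded by the ternary number whose digits record membership in the balls of
  countably many finite covers; nearby codes force nearby points.\<close>

lemma compact_real_code:
  fixes S :: "'a::metric_space set"
  assumes "compact S" "S \<noteq> {}"
  obtains c :: "'a \<Rightarrow> real"
  where "\<And>x. 0 \<le> c x \<and> c x \<le> 3/2"
    and "\<And>\<epsilon>. \<epsilon> > 0 \<Longrightarrow> \<exists>\<delta>>0. \<forall>x\<in>S. \<forall>y\<in>S. \<bar>c x - c y\<bar> < \<delta> \<longrightarrow> dist x y < \<epsilon>"
proof -
  have "\<exists>A. finite A \<and> A \<subseteq> S \<and> S \<subseteq> (\<Union>a\<in>A. ball a (1 / real (Suc k)))" for k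
    using compact_imp_seq_compact[OF assms(1), THEN seq_compact_imp_totally_bounded] by simp
  then obtain A where A: "\<And>k. finite (A k)" "\<And>k. A k \<subseteq> S"
    "\<And>k. S \<subseteq> (\<Union>a\<in>A k. ball a (1 / real (Suc k)))"
    by metis
  define U where "U = (\<Union>k. (\<lambda>a. ball a (1 / real (Suc k))) ` A k)"
  have "countable U"
    unfolding U_def by (rule countable_UN) (simp_all add: A(1) countable_finite)
  moreover have "U \<noteq> {}"
    using A(3)[of 0] assms(2) unfolding U_def by blast
  ultimately have U: "countable U" "U \<noteq> {}" .
  define B where "B = from_nat_into U"
  have B: "range B = U"
    unfolding B_def using U by (simp add: range_from_nat_into)
  define c where "c x = (\<Sum>j. of_bool (x \<in> B j) / (3::real) ^ j)" for x
  have gs: "(\<lambda>j. 1 / (3::real) ^ j) sums (3/2)"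
    using geometric_sums[of "1/3::real"] by (simp add: power_one_over)
  have s: "summable (\<lambda>j. of_bool (a j) / (3::real) ^ j)" for a
    by (rule summable_comparison_test[OF _ sums_summable[OF gs]]) auto
  show thesis
  proof (rule that[of c])
    fix x
    have "c x \<le> (\<Sum>j. 1 / (3::real) ^ j)"
      unfolding c_def by (intro suminf_le s sums_summable[OF gs]) (auto simp: divide_simps)
    then show "0 \<le> c x \<and> c x \<le> 3/2"
      using sums_unique[OF gs] suminf_nonneg[OF s] by (auto simp: c_def)
  next
    fix \<epsilon> :: real assume "\<epsilon> > 0"
    then obtain k where k: "1 / real (Suc k) < \<epsilon> / 2"
      by (metis half_gt_zero nat_approx_posE)
    have "(\<lambda>a. ball a (1 / real (Suc k))) ` A k \<subseteq> range B"
      unfolding B by (auto simp: U_def)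
    \<comment> \<open>Only the finitely many balls of the \<open>k\<close>-th cover have to be
      compared, so agreement of the digits up to their largest index \<open>m\<close> is
      enough.\<close>
    then obtain J where J: "finite J" "(\<lambda>a. ball a (1 / real (Suc k))) ` A k = B ` J"
      using finite_subset_image[of "(\<lambda>a. ball a (1 / real (Suc k))) ` A k" B UNIV] A by auto
    obtain m where m: "\<And>j. j \<in> J \<Longrightarrow> j \<le> m"
      using Max_ge[OF J(1)] that by metis
    have "dist x y < \<epsilon>" if xy: "x \<in> S" "y \<in> S" "\<bar>c x - c y\<bar> < 1 / (2 * 3 ^ m)" for x y
    proof -
      obtain a where a: "a \<in> A k" "x \<in> ball a (1 / real (Suc k))"
        using A(3) xy by blast
      then obtain j where j: "j \<in> J" "ball a (1 / real (Suc k)) = B j"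
        using J(2) by blast
      have "(x \<in> B j) = (y \<in> B j)"
        using ternary_code_separates[of "\<lambda>j. x \<in> B j" "\<lambda>j. y \<in> B j" m j] xy m[OF j(1)]
        by (simp add: c_def)
      then have "x \<in> ball a (1 / real (Suc k))" "y \<in> ball a (1 / real (Suc k))"
        using a(2) unfolding j(2) by blast+
      then have "dist a x < \<epsilon>/2" "dist a y < \<epsilon>/2"
        using k unfolding mem_ball by linarith+
      then show ?thesis
        by (metis dist_commute dist_triangle_half_r)
    qed
    then show "\<exists>\<delta>>0. \<forall>x\<in>S. \<forall>y\<in>S. \<bar>c x - c y\<bar> < \<delta> \<longrightarrow> dist x y < \<epsilon>"
      by (intro exI[of _ "1 / (2 * 3 ^ m)"]) auto
  qed
qed

text \<open>The inverse of \<open>c\<close> is uniformly continuous on the image of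
  \<open>S\<close>, and \<open>S\<close> is complete, so it extends to the closure. A code made of
  membership digits can jump, hence its image need not be closed.\<close>

lemma compact_continuous_decoding:
  fixes S :: "'a::metric_space set" and c :: "'a \<Rightarrow> real"
  assumes "compact S"
    and c: "\<And>\<epsilon>. \<epsilon> > 0 \<Longrightarrow> \<exists>\<delta>>0. \<forall>x\<in>S. \<forall>y\<in>S. \<bar>c x - c y\<bar> < \<delta> \<longrightarrow> dist x y < \<epsilon>"
  obtains \<phi> where "continuous_on (closure (c ` S)) \<phi>" "\<phi> ` closure (c ` S) \<subseteq> S"
    "\<And>x. x \<in> S \<Longrightarrow> \<phi> (c x) = x"
proof -
  \<comment> \<open>The decoded point is described through all points with nearby codes,
    independently of any sequence approaching \<open>t\<close>; the non-strict bound survives the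
    limit.\<close>
  have "\<exists>y\<in>S. \<forall>\<epsilon>>0. \<exists>\<delta>>0. \<forall>x\<in>S. \<bar>c x - t\<bar> < \<delta> \<longrightarrow> dist x y \<le> \<epsilon>"
    if t: "t \<in> closure (c ` S)" for t
  proof -
    obtain s where s: "\<And>n. s n \<in> c ` S" "s \<longlonglongrightarrow> t"
      using t unfolding closure_sequential by blast
    then have "\<forall>n. \<exists>x\<in>S. s n = c x"
      by auto
    then obtain x where x: "\<And>n. x n \<in> S" "\<And>n. s n = c (x n)"
      by metis
    obtain y q where y: "y \<in> S" "strict_mono q" "(x \<circ> q) \<longlonglongrightarrow> y"
      using compact_imp_seq_compact[OF assms(1)] x(1) unfolding seq_compact_def by metis
    show ?thesis
    proof (intro bexI[OF _ y(1)] allI impI)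
      fix \<epsilon> :: real assume "\<epsilon> > 0"
      then obtain \<delta> where \<delta>: "\<delta> > 0" "\<forall>x\<in>S. \<forall>y\<in>S. \<bar>c x - c y\<bar> < \<delta> \<longrightarrow> dist x y < \<epsilon>"
        using c by blast
      have ev: "\<forall>\<^sub>F n in sequentially. dist (s (q n)) t < \<delta> / 2"
        using LIMSEQ_subseq_LIMSEQ[OF s(2) y(2)] \<delta>(1)
        by (intro tendstoD) (auto simp: o_def)
      have "dist z y \<le> \<epsilon>" if z: "z \<in> S" "\<bar>c z - t\<bar> < \<delta> / 2" for z
      proof (rule tendsto_upperbound)
        show "(\<lambda>n. dist z (x (q n))) \<longlonglongrightarrow> dist z y"
          using y(3) by (intro tendsto_intros) (simp add: o_def)
        show "\<forall>\<^sub>F n in sequentially. dist z (x (q n)) \<le> \<epsilon>"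
          using ev
        proof eventually_elim
          case (elim n)
          then have "\<bar>c z - c (x (q n))\<bar> < \<delta>"
            using z(2) x(2)[of "q n"] unfolding dist_real_def by linarith
          then show ?case
            using \<delta>(2) z x(1) by (simp add: less_imp_le)
        qed
      qed auto
      then show "\<exists>\<delta>>0. \<forall>x\<in>S. \<bar>c x - t\<bar> < \<delta> \<longrightarrow> dist x y \<le> \<epsilon>"
        using \<delta>(1) by (intro exI[of _ "\<delta>/2"]) auto
    qed
  qed
  then have "\<forall>t\<in>closure (c ` S). \<exists>y. y \<in> S \<and>
      (\<forall>\<epsilon>>0. \<exists>\<delta>>0. \<forall>x\<in>S. \<bar>c x - t\<bar> < \<delta> \<longrightarrow> dist x y \<le> \<epsilon>)"
    by blast
  from bchoice[OF this] obtain \<phi> where \<phi>: "\<And>t. t \<in> closure (c ` S) \<Longrightarrow> \<phi> t \<in> S"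
    "\<And>t \<epsilon>. t \<in> closure (c ` S) \<Longrightarrow> \<epsilon> > 0 \<Longrightarrow>
       \<exists>\<delta>>0. \<forall>x\<in>S. \<bar>c x - t\<bar> < \<delta> \<longrightarrow> dist x (\<phi> t) \<le> \<epsilon>"
    by blast
  show thesis
  proof (rule that[of \<phi>])
    show "\<phi> ` closure (c ` S) \<subseteq> S"
      using \<phi>(1) by auto
    show "\<phi> (c x) = x" if "x \<in> S" for x
    proof -
      have t: "c x \<in> closure (c ` S)"
        using that closure_subset[of "c ` S"] by auto
      have "dist x (\<phi> (c x)) \<le> \<epsilon>" if "\<epsilon> > 0" for \<epsilon>
      proof -
        obtain \<delta> where "\<delta> > 0" "\<forall>z\<in>S. \<bar>c z - c x\<bar> < \<delta> \<longrightarrow> dist z (\<phi> (c x)) \<le> \<epsilon>"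
          using \<phi>(2)[OF t \<open>\<epsilon> > 0\<close>] by auto
        then show ?thesis
          using \<open>x \<in> S\<close> by simp
      qed
      from this[of "dist x (\<phi> (c x)) / 2"] show ?thesis
        by (cases "x = \<phi> (c x)") auto
    qed
    show "continuous_on (closure (c ` S)) \<phi>"
      unfolding continuous_on_iff
    proof (intro ballI allI impI)
      fix t and \<epsilon> :: real assume t: "t \<in> closure (c ` S)" and "\<epsilon> > 0"
      then have e3: "\<epsilon> / 3 > 0" by simp
      obtain \<delta> where \<delta>: "\<delta> > 0" "\<forall>x\<in>S. \<bar>c x - t\<bar> < \<delta> \<longrightarrow> dist x (\<phi> t) \<le> \<epsilon>/3"
        using \<phi>(2)[OF t e3] by blast
      have "dist (\<phi> t') (\<phi> t) < \<epsilon>" if t': "t' \<in> closure (c ` S)" "dist t' t < \<delta> / 2" for t'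
      proof -
        obtain \<delta>' where \<delta>': "\<delta>' > 0" "\<forall>x\<in>S. \<bar>c x - t'\<bar> < \<delta>' \<longrightarrow> dist x (\<phi> t') \<le> \<epsilon>/3"
          using \<phi>(2)[OF t'(1) e3] by blast
        have "min (\<delta>/2) \<delta>' > 0" using \<delta> \<delta>' by simp
        then obtain x where x: "x \<in> S" "dist (c x) t' < min (\<delta>/2) \<delta>'"
          using t'(1) unfolding closure_approachable by blast
        have "\<bar>c x - t\<bar> < \<delta>" "\<bar>c x - t'\<bar> < \<delta>'"
          using x(2) t'(2) unfolding dist_real_def by linarith+
        then have "dist x (\<phi> t) \<le> \<epsilon>/3" "dist x (\<phi> t') \<le> \<epsilon>/3"
          using \<delta>(2) \<delta>'(2) x(1) by auto
        then show ?thesis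
          using dist_triangle[of "\<phi> t'" "\<phi> t" x] \<open>\<epsilon> > 0\<close> by (simp add: dist_commute)
      qed
      then show "\<exists>d>0. \<forall>x'\<in>closure (c ` S). dist x' t < d \<longrightarrow> dist (\<phi> x') (\<phi> t) < \<epsilon>"
        using \<delta>(1) by (intro exI[of _ "\<delta>/2"]) auto
    qed
  qed
qed

text \<open>Coding transports the laws to a bounded interval, where Helly selection applies; the limit is
  carried by the closure of the codes and is pushed back to \<open>S\<close> by the continuous decoding.\<close>

lemma Zf_weak_sequentially_compact:
  fixes S :: "'a::metric_space set"
  assumes S: "compact S" "S \<noteq> {}" and p: "\<And>n::nat. p n \<in> Zf S"
  obtains s M where "strict_mono s" "M \<in> Delta S" "weak_conv S (\<lambda>n. to_meas (p (s n))) M"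
proof -
  obtain c :: "'a \<Rightarrow> real" where c: "\<And>x. 0 \<le> c x \<and> c x \<le> 3/2"
    "\<And>\<epsilon>. \<epsilon> > 0 \<Longrightarrow> \<exists>\<delta>>0. \<forall>x\<in>S. \<forall>y\<in>S. \<bar>c x - c y\<bar> < \<delta> \<longrightarrow> dist x y < \<epsilon>"
    using compact_real_code[OF S] by blast
  define K where "K = closure (c ` S)"
  obtain \<phi> where \<phi>: "continuous_on K \<phi>" "\<phi> ` K \<subseteq> S" "\<And>x. x \<in> S \<Longrightarrow> \<phi> (c x) = x"
    using compact_continuous_decoding[OF S(1) c(2)] unfolding K_def by blast
  have K: "closed K" "K \<noteq> {}" "\<And>x. x \<in> S \<Longrightarrow> c x \<in> K"
    using S(2) closure_subset[of "c ` S"] by (auto simp: K_def)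
  define \<nu> where "\<nu> (n::nat) = distr (measure_pmf (p n)) borel c" for n
  have rd: "real_distribution (\<nu> n)" for n
    unfolding \<nu>_def by (intro prob_space.real_distribution_distr prob_space_measure_pmf) auto
  have "tight \<nu>"
    unfolding tight_def
  proof (intro conjI allI impI)
    fix \<epsilon> :: real assume "\<epsilon> > 0"
    have "measure (\<nu> n) {-1<..2} = 1" for n
    proof -
      have "-1 < c x \<and> c x \<le> 2" for x
        using c(1)[of x] by linarith
      then have "c -` {-1<..2} = UNIV"
        by auto
      then show ?thesis
        unfolding \<nu>_def by (subst measure_distr) auto
    qed
    then show "\<exists>a b. a < b \<and> (\<forall>n. 1 - \<epsilon> < measure (\<nu> n) {a<..b})"
      using \<open>\<epsilon> > 0\<close> by (intro exI[of _ "-1"] exI[of _ 2]) auto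
  qed (rule rd)
  from tight_imp_convergent_subsubsequence[OF this, of id]
  obtain s N where s: "strict_mono s" and N: "real_distribution N" and w: "weak_conv_m (\<nu> \<circ> s) N"
    by (auto simp: strict_mono_def)
  interpret N: real_distribution N by (rule N)
  have lim: "(\<lambda>n. mean (p (s n)) (\<lambda>x. h (c x))) \<longlonglongrightarrow> integral\<^sup>L N h"
    if h: "continuous_on UNIV h" "\<And>t. \<bar>h t\<bar> \<le> B" for h :: "real \<Rightarrow> real" and B
  proof -
    have "(\<lambda>n. integral\<^sup>L ((\<nu> \<circ> s) n) h) \<longlonglongrightarrow> integral\<^sup>L N h"
      by (rule weak_conv_imp_integral_bdd_continuous_conv[OF _ N w, where B = B])
        (use h rd in \<open>auto simp: continuous_on_eq_continuous_at\<close>)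
    moreover have "integral\<^sup>L ((\<nu> \<circ> s) n) h = mean (p (s n)) (\<lambda>x. h (c x))" for n
      unfolding \<nu>_def o_def
      by (rule integral_distr) (auto intro: borel_measurable_continuous_onI h)
    ultimately show ?thesis by simp
  qed
  \<comment> \<open>Weak convergence tests only continuous functions, so the closed set
    \<open>K\<close> is seen through its truncated distance function, which vanishes at every
    code.\<close>
  have AEK: "AE t in N. t \<in> K"
  proof -
    define h where "h t = min 1 (infdist t K)" for t
    have h: "continuous_on UNIV h" "\<bar>h t\<bar> \<le> 1" "h t \<ge> 0" for t
      unfolding h_def by (intro continuous_intros) (auto simp: infdist_nonneg)
    have "h (c x) = 0" if "x \<in> S" for x
      using K(3)[OF that] by (simp add: h_def)
    then have "mean (p (s n)) (\<lambda>x. h (c x)) = mean (p (s n)) (\<lambda>x. 0)" for n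
      using p[of "s n"] by (intro integral_cong_AE) (auto simp: AE_measure_pmf_iff Zf_def)
    then have "integral\<^sup>L N h = 0"
      using lim[OF h(1,2)] by (simp add: LIMSEQ_const_iff)
    moreover have "integrable N h"
    proof (rule N.integrable_const_bound[where B = 1])
      show "h \<in> borel_measurable N"
        using h(1) by (simp add: borel_measurable_continuous_onI)
    qed (use h(2) in simp)
    ultimately have "AE t in N. h t = 0"
      using integral_nonneg_eq_0_iff_AE[of N h] h(3) by auto
    then show ?thesis
      by eventually_elim
        (use K in \<open>auto simp: h_def min_def in_closed_iff_infdist_zero split: if_splits\<close>)
  qed
  obtain x0 where "x0 \<in> S" using S by auto
  \<comment> \<open>The value outside \<open>K\<close> is a default on a null set of
    \<open>N\<close>; it makes the decoding total, Borel and \<open>S\<close>-valued.\<close>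
  define \<psi> where "\<psi> t = (if t \<in> K then \<phi> t else x0)" for t
  have \<psi>m: "\<psi> \<in> borel_measurable borel"
    unfolding \<psi>_def using K(1) \<phi>(1)
    by (intro borel_measurable_continuous_on_if) (auto intro: borel_closed)
  have \<psi>S: "\<psi> t \<in> S" for t
    using \<phi>(2) \<open>x0 \<in> S\<close> by (auto simp: \<psi>_def)
  define M where "M = distr N borel \<psi>"
  have Sb: "S \<in> sets borel"
    using S by (intro borel_closed compact_imp_closed)
  have \<psi>N: "\<psi> \<in> measurable N borel"
    using \<psi>m by simp
  interpret M: prob_space M
    unfolding M_def by (intro N.prob_space_distr \<psi>N)
  have "emeasure M S = 1"
  proof -
    have "\<psi> -` S \<inter> space N = space N" using \<psi>S by auto
    then show ?thesis
      unfolding M_def by (subst emeasure_distr[OF \<psi>N Sb]) (simp only: N.emeasure_space_1)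
  qed
  then have "M \<in> Delta S"
    using M.prob_space_axioms by (simp add: Delta_def M_def)
  moreover have "weak_conv S (\<lambda>n. to_meas (p (s n))) M"
    unfolding weak_conv_def
  proof (intro allI impI)
    fix f :: "'a \<Rightarrow> real" assume f: "continuous_on S f"
    obtain B where B: "B > 0" "\<And>x. x \<in> S \<Longrightarrow> \<bar>f x\<bar> \<le> B"
      using compact_imp_bounded[OF compact_continuous_image[OF f S(1)]]
      unfolding bounded_pos by auto
    have "continuous_on K (\<lambda>t. f (\<phi> t))"
      by (rule continuous_on_compose2[OF f \<phi>(1,2)])
    \<comment> \<open>Convergence on the line is tested against functions continuous everywhere;
      Tietze extends the decoded test function with the same bound.\<close>
    then obtain h where h: "continuous_on UNIV h" "\<And>t. t \<in> K \<Longrightarrow> h t = f (\<phi> t)" "\<And>t. norm (h t) \<le> B"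
      using Tietze[of K "\<lambda>t. f (\<phi> t)" UNIV B] K(1) B \<phi>(2) by (auto simp: image_subset_iff)
    have fm: "(\<lambda>x. indicator S x *\<^sub>R f x) \<in> borel_measurable borel"
      using borel_measurable_continuous_on_indicator[OF Sb f] .
    have "(LINT x:S|M. f x) = (\<integral>t. indicator S (\<psi> t) *\<^sub>R f (\<psi> t) \<partial>N)"
      unfolding set_lebesgue_integral_def M_def by (rule integral_distr[OF \<psi>N fm])
    also have "\<dots> = integral\<^sup>L N h"
    proof (rule integral_cong_AE)
      show "(\<lambda>t. indicator S (\<psi> t) *\<^sub>R f (\<psi> t)) \<in> borel_measurable N"
        by (rule measurable_compose[OF \<psi>N fm])
      show "h \<in> borel_measurable N"
        using h(1) by (simp add: borel_measurable_continuous_onI)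
      show "AE t in N. indicator S (\<psi> t) *\<^sub>R f (\<psi> t) = h t"
        using AEK
      proof eventually_elim
        case (elim t)
        then show ?case
          using h(2)[OF elim] \<psi>S[of t] by (simp add: \<psi>_def)
      qed
    qed
    finally have eq: "(LINT x:S|M. f x) = integral\<^sup>L N h" .
    have "(LINT x:S|to_meas (p (s n)). f x) = mean (p (s n)) (\<lambda>x. h (c x))" for n
      unfolding set_lint_eq_pmf_expectation[OF S(1) f p]
      using p[of "s n"] h(2) K(3) \<phi>(3)
      by (intro integral_cong_AE) (auto simp: AE_measure_pmf_iff Zf_def)
    then show "(\<lambda>n. LINT x:S|to_meas (p (s n)). f x) \<longlonglongrightarrow> (LINT x:S|M. f x)"
      unfolding eq using lim[OF h(1), of B] h(3) by simp
  qed
  ultimately show thesis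
    using that s by blast
qed

section \<open>Finite minimax\<close>

text \<open>Second-order bound for the squared positive part, whose derivative at \<open>s\<close>
  is \<open>2 * max 0 s\<close>. These derivatives become the weights in the descent argument of the
  minimax lemma.\<close>

lemma pos_part_square_add:
  fixes s t :: real
  shows "(max 0 (s + t))\<^sup>2 \<le> (max 0 s)\<^sup>2 + 2 * max 0 s * t + t\<^sup>2"
proof (cases "s \<ge> 0")
  case True
  have "(max 0 (s + t))\<^sup>2 \<le> (s + t)\<^sup>2"
    by (auto simp: max_def)
  then show ?thesis using True by (simp add: power2_sum)
next
  case False
  then have "max 0 (s + t) \<le> \<bar>t\<bar>" by auto
  then have "(max 0 (s + t))\<^sup>2 \<le> \<bar>t\<bar>\<^sup>2" by (intro power_mono) auto
  then show ?thesis using False by simp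
qed

text \<open>If no point of \<open>D\<close> were close to the orthant, moving a near-minimiser \<open>d\<close> of the squared
  distance slightly towards a point that is favourable for the weights \<open>(c - d)\<^sup>+\<close> would decrease it
  below its infimum.\<close>

lemma finite_minimax:
  fixes D :: "('i \<Rightarrow> real) set" and c \<delta> B :: real
  assumes I: "finite I" and ne: "D \<noteq> {}"
    and bdd: "\<And>d i. d \<in> D \<Longrightarrow> i \<in> I \<Longrightarrow> \<bar>d i\<bar> \<le> B"
    and conv: "\<And>d e l. d \<in> D \<Longrightarrow> e \<in> D \<Longrightarrow> 0 < l \<Longrightarrow> l < 1 \<Longrightarrow>
        \<exists>h\<in>D. \<forall>i\<in>I. h i = (1 - l) * d i + l * e i"
    and weights: "\<And>y \<eta>. (\<And>i. 0 \<le> y i) \<Longrightarrow> \<eta> > 0 \<Longrightarrow>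
        \<exists>e\<in>D. (\<Sum>i\<in>I. y i * e i) \<ge> c * (\<Sum>i\<in>I. y i) - \<eta>"
    and "\<delta> > 0"
  shows "\<exists>d\<in>D. \<forall>i\<in>I. d i \<ge> c - \<delta>"
proof -
  define \<Phi> where "\<Phi> d = (\<Sum>i\<in>I. (max 0 (c - d i))\<^sup>2)" for d :: "'i \<Rightarrow> real"
  have \<Phi>0: "\<Phi> d \<ge> 0" for d
    by (simp add: \<Phi>_def sum_nonneg)
  define m where "m = Inf (\<Phi> ` D)"
  have bd: "bdd_below (\<Phi> ` D)"
    using \<Phi>0 by (intro bdd_belowI[of _ 0]) auto
  have mle: "m \<le> \<Phi> d" if "d \<in> D" for d
    unfolding m_def using bd that by (intro cInf_lower) auto
  have near: "\<exists>d\<in>D. \<Phi> d < m + \<eta>" if "\<eta> > 0" for \<eta>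
    using cInf_lessD[of "\<Phi> ` D" "m + \<eta>"] that ne unfolding m_def by auto
  have "m \<ge> 0"
    unfolding m_def using \<Phi>0 ne by (intro cInf_greatest) auto
  \<comment> \<open>\<open>K - 1\<close> bounds the sum of squares in the second-order term; the
    extra 1 absorbs the excess \<open>l\<^sup>2\<close> of the near-minimiser
    \<open>d\<close>.\<close>
  define K where "K = real (card I) * (2 * B)\<^sup>2 + 1"
  have K: "K > 0" by (simp add: K_def add_nonneg_pos)
  have "m \<le> 0"
  proof (rule ccontr)
    assume "\<not> m \<le> 0"
    then have m: "m > 0" by simp
    \<comment> \<open>With \<open>l * K \<le> m/4\<close> the second-order loss is at most
      \<open>l * m/4\<close>, less than the first-order gain \<open>l * m\<close>; that gain is what
      remains after the weights condition is used with slack \<open>m/2\<close>.\<close>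
    define l where "l = min (1/2) (m / (4 * K))"
    have l: "l > 0" "l < 1"
      using m K by (auto simp: l_def)
    have lK: "l * K \<le> m / 4"
    proof -
      have "l * K \<le> m / (4 * K) * K"
        unfolding l_def using K by (intro mult_right_mono) auto
      then show ?thesis using K by simp
    qed
    obtain d where d: "d \<in> D" "\<Phi> d < m + l\<^sup>2"
      using near[of "l\<^sup>2"] l by auto
    define y where "y i = max 0 (c - d i)" for i
    obtain e where e: "e \<in> D" "(\<Sum>i\<in>I. y i * e i) \<ge> c * (\<Sum>i\<in>I. y i) - m/2"
      using weights[of y "m/2"] m by (auto simp: y_def)
    obtain h where h: "h \<in> D" "\<And>i. i \<in> I \<Longrightarrow> h i = (1 - l) * d i + l * e i"
      using conv[OF d(1) e(1) l] by blast
    have "\<Phi> h \<le> (\<Sum>i\<in>I. (y i)\<^sup>2 + 2 * y i * (l * (d i - e i)) + (l * (d i - e i))\<^sup>2)"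
      unfolding \<Phi>_def
    proof (rule sum_mono)
      fix i assume "i \<in> I"
      then have "c - h i = (c - d i) + l * (d i - e i)"
        using h(2) by (simp add: algebra_simps)
      then show "(max 0 (c - h i))\<^sup>2 \<le> (y i)\<^sup>2 + 2 * y i * (l * (d i - e i)) + (l * (d i - e i))\<^sup>2"
        using pos_part_square_add[of "c - d i" "l * (d i - e i)"] unfolding y_def by (simp only:)
    qed
    also have "\<dots> = \<Phi> d + 2 * l * (\<Sum>i\<in>I. y i * (d i - e i)) + l\<^sup>2 * (\<Sum>i\<in>I. (d i - e i)\<^sup>2)"
      by (simp add: \<Phi>_def y_def[symmetric] sum.distrib sum_distrib_left power_mult_distrib ac_simps)
    finally have 1: "\<Phi> h \<le> \<Phi> d + 2 * l * (\<Sum>i\<in>I. y i * (d i - e i)) + l\<^sup>2 * (\<Sum>i\<in>I. (d i - e i)\<^sup>2)" .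
    have "(\<Sum>i\<in>I. y i * (c - d i)) = \<Phi> d"
      unfolding \<Phi>_def by (intro sum.cong) (auto simp: y_def max_def power2_eq_square)
    then have "(\<Sum>i\<in>I. y i * (d i - e i)) = - \<Phi> d + c * (\<Sum>i\<in>I. y i) - (\<Sum>i\<in>I. y i * e i)"
      by (simp add: algebra_simps sum.distrib sum_subtractf sum_distrib_left)
    then have 2: "(\<Sum>i\<in>I. y i * (d i - e i)) \<le> - (m / 2)"
      using e(2) mle[OF d(1)] by linarith
    have "(\<Sum>i\<in>I. (d i - e i)\<^sup>2) \<le> (\<Sum>i\<in>I. (2 * B)\<^sup>2)"
    proof (rule sum_mono)
      fix i assume "i \<in> I"
      then have "\<bar>d i - e i\<bar> \<le> 2 * B"
        using bdd[OF d(1)] bdd[OF e(1)] by (smt (verit))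
      then show "(d i - e i)\<^sup>2 \<le> (2 * B)\<^sup>2"
        using power_mono[of "\<bar>d i - e i\<bar>" "2 * B" 2] by simp
    qed
    then have "(\<Sum>i\<in>I. (d i - e i)\<^sup>2) \<le> K - 1"
      by (simp add: K_def)
    then have 3: "l\<^sup>2 * (\<Sum>i\<in>I. (d i - e i)\<^sup>2) \<le> l\<^sup>2 * (K - 1)"
      by (intro mult_left_mono) auto
    have "2 * l * (\<Sum>i\<in>I. y i * (d i - e i)) \<le> 2 * l * (- (m / 2))"
      using 2 l by (intro mult_left_mono) auto
    then have "\<Phi> h < m + l\<^sup>2 - l * m + l\<^sup>2 * (K - 1)"
      using 1 3 d(2) by simp
    also have "\<dots> = m - l * m + l * (l * K)"
      by (simp add: power2_eq_square algebra_simps)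
    also have "\<dots> \<le> m - l * m + l * (m / 4)"
      using lK l by (intro add_left_mono mult_left_mono) auto
    also have "\<dots> \<le> m"
      using l m by simp
    finally show False
      using mle[OF h(1)] by simp
  qed
  then obtain d where d: "d \<in> D" "\<Phi> d < \<delta>\<^sup>2"
    using near[of "\<delta>\<^sup>2"] \<open>\<delta> > 0\<close> \<open>m \<ge> 0\<close> by auto
  have "d i \<ge> c - \<delta>" if "i \<in> I" for i
  proof -
    have "(max 0 (c - d i))\<^sup>2 \<le> \<Phi> d"
      unfolding \<Phi>_def using I that by (intro member_le_sum) auto
    then have "(max 0 (c - d i))\<^sup>2 < \<delta>\<^sup>2"
      using d(2) by simp
    then have "max 0 (c - d i) < \<delta>"
      by (rule power_less_imp_less_base) (use \<open>\<delta> > 0\<close> in simp)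
    then show ?thesis by simp
  qed
  then show ?thesis using d(1) by blast
qed

section \<open>Evaluations\<close>

lemma summable_abs_increments:
  assumes "evaluation \<theta>"
  shows "summable (\<lambda>t. \<bar>\<theta> (Suc t) - \<theta> t\<bar>)"
proof (rule summable_comparison_test)
  have s: "summable \<theta>"
    using assms by (auto simp: evaluation_def sums_iff)
  show "summable (\<lambda>t. \<theta> (Suc t) + \<theta> t)"
    using s by (intro summable_add) (auto simp: summable_Suc_iff)
  have "\<bar>\<theta> (Suc t) - \<theta> t\<bar> \<le> \<theta> (Suc t) + \<theta> t" for t
    using assms unfolding evaluation_def by (smt (verit))
  then show "\<exists>N. \<forall>t\<ge>N. norm \<bar>\<theta> (Suc t) - \<theta> t\<bar> \<le> \<theta> (Suc t) + \<theta> t"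
    by auto
qed

lemma sum_abs_increments_le_impatience:
  assumes "evaluation \<theta>"
  shows "(\<Sum>t<n. \<bar>\<theta> (Suc t) - \<theta> t\<bar>) \<le> impatience \<theta>"
  unfolding impatience_def by (intro sum_le_suminf summable_abs_increments assms) auto

text \<open>A summable \<open>\<theta>\<close> tends to 0, so \<open>\<theta> t\<close> telescopes
  into later increments. This controls the boundary terms of summation by parts.\<close>

lemma evaluation_le_impatience:
  assumes "evaluation \<theta>"
  shows "\<theta> t \<le> impatience \<theta>"
proof -
  have sm: "summable \<theta>"
    using assms by (auto simp: evaluation_def sums_iff)
  have "\<theta> t - \<theta> (t + n) \<le> impatience \<theta>" for n
  proof -
    have "\<theta> t - \<theta> (t + n) \<le> (\<Sum>s=t..<t+n. \<bar>\<theta> (Suc s) - \<theta> s\<bar>)"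
      by (induction n) auto
    also have "\<dots> \<le> (\<Sum>s<t+n. \<bar>\<theta> (Suc s) - \<theta> s\<bar>)"
      by (intro sum_mono2) auto
    finally show ?thesis
      using sum_abs_increments_le_impatience[OF assms, of "t+n"] by simp
  qed
  moreover have "(\<lambda>n. \<theta> t - \<theta> (t + n)) \<longlonglongrightarrow> \<theta> t - 0"
    using LIMSEQ_ignore_initial_segment[OF summable_LIMSEQ_zero[OF sm], of t]
    by (intro tendsto_intros) (simp add: add.commute)
  ultimately show ?thesis
    by (intro tendsto_upperbound[of _ "\<theta> t"]) auto
qed

lemma evaluation_payoff_summable:
  assumes "evaluation \<theta>" "\<And>t. 0 \<le> a t \<and> a t \<le> 1"
  shows "summable (\<lambda>t. \<theta> t * a t)"
proof (rule summable_comparison_test)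
  show "summable \<theta>"
    using assms by (auto simp: evaluation_def sums_iff)
  show "\<exists>N. \<forall>t\<ge>N. norm (\<theta> t * a t) \<le> \<theta> t"
    using assms by (auto simp: evaluation_def abs_mult intro!: mult_left_le)
qed

lemma summation_by_parts:
  fixes \<theta> b :: "nat \<Rightarrow> real"
  shows "(\<Sum>t<N. \<theta> t * (b (Suc t) - b t))
    = \<theta> N * b N - \<theta> 0 * b 0 - (\<Sum>t<N. (\<theta> (Suc t) - \<theta> t) * b (Suc t))"
  by (induction N) (auto simp: algebra_simps)

text \<open>Within a block \<open>\<theta>\<close> is frozen at its value on the first stage. Each
  of the \<open>n\<close> stages then errs by at most the variation of \<open>\<theta>\<close> over
  the block, which sums to \<open>n * impatience \<theta>\<close> over all blocks.\<close>

lemma evaluation_payoff_ge_block_average: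
  fixes a :: "nat \<Rightarrow> real"
  assumes \<theta>: "evaluation \<theta>" and a: "\<And>t. 0 \<le> a t \<and> a t \<le> 1" and "n > 0"
    and block: "\<And>j. (\<Sum>i<n. a (j * n + i)) \<ge> n * c"
  shows "(\<Sum>t. \<theta> t * a t) \<ge> c - n * impatience \<theta>"
proof -
  \<comment> \<open>For very negative \<open>c\<close> the centred payoffs \<open>a t - c\<close>
    would exceed 1; the truncated level still lies below the block averages because \<open>a\<close>
    is nonnegative.\<close>
  define c' where "c' = max 0 c"
  have c': "0 \<le> c'" "(\<Sum>i<n. a (j * n + i)) \<ge> n * c'" for j
    using block[of j] a by (auto simp: c'_def max_def sum_nonneg)
  have "real n * c' \<le> (\<Sum>i<n. a (0 * n + i))" by (rule c'(2))
  also have "\<dots> \<le> (\<Sum>i<n. 1)" using a by (intro sum_mono) auto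
  finally have "c' \<le> 1" using \<open>n > 0\<close> by simp
  define b where "b t = a t - c'" for t
  have b1: "\<bar>b t\<bar> \<le> 1" for t
    using a[of t] \<open>c' \<le> 1\<close> \<open>0 \<le> c'\<close> by (auto simp: b_def)
  have bs: "(\<Sum>i<n. b (j * n + i)) \<ge> 0" for j
    using c'(2)[of j] by (simp add: b_def sum_subtractf)
  define \<Delta> where "\<Delta> t = \<bar>\<theta> (Suc t) - \<theta> t\<bar>" for t
  have inc: "\<bar>\<theta> (s + i) - \<theta> s\<bar> \<le> (\<Sum>k<i. \<Delta> (s + k))" for s i
  proof (induction i)
    case (Suc i)
    then show ?case by (simp add: \<Delta>_def)
  qed simp
  have blk: "(\<Sum>i<n. \<theta> (j*n+i) * b (j*n+i)) \<ge> - (n * (\<Sum>k<n. \<Delta> (j*n+k)))" for j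
  proof -
    have "\<theta> (j*n+i) * b (j*n+i) \<ge> \<theta> (j*n) * b (j*n+i) - (\<Sum>k<n. \<Delta> (j*n+k))" if "i < n" for i
    proof -
      have "\<bar>(\<theta> (j*n+i) - \<theta> (j*n)) * b (j*n+i)\<bar> \<le> \<bar>\<theta> (j*n+i) - \<theta> (j*n)\<bar>"
        using b1[of "j*n+i"] unfolding abs_mult by (intro mult_left_le) auto
      also have "\<dots> \<le> (\<Sum>k<i. \<Delta> (j*n+k))" by (rule inc)
      also have "\<dots> \<le> (\<Sum>k<n. \<Delta> (j*n+k))"
        using that by (intro sum_mono2) (auto simp: \<Delta>_def)
      finally show ?thesis by (simp add: algebra_simps abs_le_iff)
    qed
    then have "(\<Sum>i<n. \<theta> (j*n+i) * b (j*n+i)) \<ge> (\<Sum>i<n. \<theta> (j*n) * b (j*n+i) - (\<Sum>k<n. \<Delta> (j*n+k)))"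
      by (intro sum_mono) auto
    moreover have "(\<Sum>i<n. \<theta> (j*n) * b (j*n+i) - (\<Sum>k<n. \<Delta> (j*n+k)))
        = \<theta> (j*n) * (\<Sum>i<n. b (j*n+i)) - n * (\<Sum>k<n. \<Delta> (j*n+k))"
      by (simp add: sum_subtractf sum_distrib_left)
    moreover have "\<theta> (j*n) * (\<Sum>i<n. b (j*n+i)) \<ge> 0"
      using \<theta> bs by (auto simp: evaluation_def)
    ultimately show ?thesis by linarith
  qed
  have grp: "(\<Sum>t<J*n. f t) = (\<Sum>j<J. \<Sum>i<n. f (j*n+i))" for f :: "nat \<Rightarrow> real" and J
  proof -
    have "sum f {m..<m + n} = (\<Sum>i<n. f (m + i))" for m
      using sum.shift_bounds_nat_ivl[of f 0 m n] by (simp add: lessThan_atLeast0 add.commute)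
    then show ?thesis
      unfolding sum.nat_group[symmetric] by simp
  qed
  have part: "(\<Sum>t<J*n. \<theta> t * b t) \<ge> - (n * impatience \<theta>)" for J
  proof -
    have "(\<Sum>t<J*n. \<theta> t * b t) \<ge> (\<Sum>j<J. - (n * (\<Sum>k<n. \<Delta> (j*n+k))))"
      unfolding grp by (intro sum_mono blk)
    moreover have "(\<Sum>j<J. - (n * (\<Sum>k<n. \<Delta> (j*n+k)))) = - (n * (\<Sum>t<J*n. \<Delta> t))"
      unfolding grp by (simp add: sum_negf sum_distrib_left)
    moreover have "n * (\<Sum>t<J*n. \<Delta> t) \<le> n * impatience \<theta>"
      unfolding \<Delta>_def using sum_abs_increments_le_impatience[OF \<theta>] by (intro mult_left_mono) auto
    ultimately show ?thesis by linarith
  qed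
  have th: "\<theta> sums 1" using \<theta> by (simp add: evaluation_def)
  have "(\<lambda>t. \<theta> t * a t - c' * \<theta> t) sums ((\<Sum>t. \<theta> t * a t) - c' * 1)"
    by (intro sums_diff summable_sums evaluation_payoff_summable \<theta> a sums_mult th)
  then have "(\<lambda>t. \<theta> t * b t) sums ((\<Sum>t. \<theta> t * a t) - c')"
    by (simp add: b_def algebra_simps)
  then have "(\<lambda>N. \<Sum>t<N. \<theta> t * b t) \<longlonglongrightarrow> (\<Sum>t. \<theta> t * a t) - c'"
    by (simp add: sums_def)
  from LIMSEQ_subseq_LIMSEQ[OF this, of "\<lambda>J. J * n"]
  have "(\<lambda>J. \<Sum>t<J*n. \<theta> t * b t) \<longlonglongrightarrow> (\<Sum>t. \<theta> t * a t) - c'"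
    using \<open>n > 0\<close> by (simp add: o_def strict_mono_def)
  then have "(\<Sum>t. \<theta> t * a t) - c' \<ge> - (n * impatience \<theta>)"
    using part by (intro tendsto_lowerbound[where f = "\<lambda>J. \<Sum>t<J*n. \<theta> t * b t"]) auto
  then show ?thesis by (simp add: c'_def)
qed

text \<open>The average over the first \<open>Suc N\<close> stages changes only at its last stage,
  by \<open>1 / Suc N\<close>. It provides a common evaluation at which the upper and the lower
  bound can be compared.\<close>

lemma exists_patient_evaluation:
  fixes \<alpha> :: real
  assumes "\<alpha> > 0"
  shows "\<exists>\<theta>. evaluation \<theta> \<and> impatience \<theta> \<le> \<alpha>"
proof -
  obtain N where N: "1 / real (Suc N) < \<alpha>"
    using nat_approx_posE[OF assms] by blast
  define \<theta> where "\<theta> t = (if t < Suc N then 1 / real (Suc N) else 0)" for t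
  have "\<theta> sums (\<Sum>t<Suc N. \<theta> t)"
    by (intro sums_finite) (auto simp: \<theta>_def)
  then have "evaluation \<theta>"
    by (auto simp: evaluation_def \<theta>_def)
  have "(\<lambda>t. \<bar>\<theta> (Suc t) - \<theta> t\<bar>) sums (\<Sum>t\<in>{N}. \<bar>\<theta> (Suc t) - \<theta> t\<bar>)"
    by (intro sums_finite) (auto simp: \<theta>_def)
  then have "impatience \<theta> = 1 / real (Suc N)"
    by (simp add: impatience_def sums_iff \<theta>_def)
  then show ?thesis
    using \<open>evaluation \<theta>\<close> N by (intro exI[of _ \<theta>]) simp
qed

section \<open>Mixed extension and one-step operator\<close>

lemma mean_add: "finite (set_pmf p) \<Longrightarrow> mean p (\<lambda>x. f x + g x) = mean p f + mean p g"
  by (simp add: integrable_measure_pmf_finite)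

lemma mean_mono:
  assumes "p \<in> Zf S" "\<And>x. x \<in> S \<Longrightarrow> f x \<le> g x"
  shows "mean p f \<le> mean p g"
  using assms
  by (intro integral_mono_AE) (auto simp: Zf_def integrable_measure_pmf_finite AE_measure_pmf_iff)

lemma mean_bounds:
  assumes "p \<in> Zf S" "\<And>x. x \<in> S \<Longrightarrow> a \<le> f x \<and> f x \<le> b"
  shows "a \<le> mean p f \<and> mean p f \<le> b"
  using mean_mono[OF assms(1), of "\<lambda>_. a" f] mean_mono[OF assms(1), of f "\<lambda>_. b"] assms(2) by simp

lemma mean_diff_le:
  assumes "p \<in> Zf S" "\<And>x. x \<in> S \<Longrightarrow> \<bar>f x - g x\<bar> \<le> e"
  shows "\<bar>mean p f - mean p g\<bar> \<le> e"
proof -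
  have "mean p (\<lambda>x. f x - g x) = mean p f - mean p g"
    using assms(1) by (simp add: Zf_def integrable_measure_pmf_finite)
  then show ?thesis
    using mean_bounds[OF assms(1), of "-e" "\<lambda>x. f x - g x" e] assms(2) by (simp add: abs_le_iff) force
qed

lemma mean_return [simp]: "mean (return_pmf x) f = f x"
  by (subst integral_measure_pmf_real[where A = "{x}"]) auto

lemma mean_bind:
  assumes "finite (set_pmf p)" "\<And>x. x \<in> set_pmf p \<Longrightarrow> finite (set_pmf (f x))"
  shows "mean (bind_pmf p f) g = mean p (\<lambda>x. mean (f x) g)"
proof -
  have "mean (bind_pmf p f) g = (\<Sum>a\<in>set_pmf p. pmf p a *\<^sub>R mean (f a) g)"
    using assms by (intro pmf_expectation_bind) auto
  also have "\<dots> = mean p (\<lambda>x. mean (f x) g)"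
    using assms by (subst integral_measure_pmf_real[where A = "set_pmf p"]) (auto simp: mult.commute)
  finally show ?thesis .
qed

lemma return_in_Zf: "x \<in> S \<Longrightarrow> return_pmf x \<in> Zf S"
  by (simp add: Zf_def)

lemma bind_in_Zf:
  assumes "finite (set_pmf p)" "\<And>x. x \<in> set_pmf p \<Longrightarrow> f x \<in> Zf S"
  shows "bind_pmf p f \<in> Zf S"
  using assms by (auto simp: Zf_def)

lemma convF_bind:
  assumes "finite (set_pmf Q)" "\<And>i. i \<in> set_pmf Q \<Longrightarrow> g i \<in> convF F y"
  shows "bind_pmf Q g \<in> convF F y"
proof -
  have "\<forall>i\<in>set_pmf Q. \<exists>R. g i = join_pmf R \<and> finite (set_pmf R) \<and> set_pmf R \<subseteq> F y"
    using assms(2) by (auto simp: convF_def)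
  from bchoice[OF this] obtain R where
    R: "\<And>i. i \<in> set_pmf Q \<Longrightarrow> g i = join_pmf (R i) \<and> finite (set_pmf (R i)) \<and> set_pmf (R i) \<subseteq> F y"
    by blast
  have "bind_pmf Q g = bind_pmf Q (\<lambda>i. join_pmf (R i))"
    using R by (intro bind_pmf_cong) auto
  also have "\<dots> = join_pmf (bind_pmf Q R)"
    by (simp add: join_eq_bind_pmf bind_assoc_pmf)
  finally have "bind_pmf Q g = join_pmf (bind_pmf Q R)" .
  moreover have "finite (set_pmf (bind_pmf Q R))" "set_pmf (bind_pmf Q R) \<subseteq> F y"
    using assms(1) R by auto
  ultimately show ?thesis
    unfolding convF_def by (intro CollectI exI[of _ "bind_pmf Q R"] conjI)
qed

lemma F_subset_convF: "F y \<subseteq> convF F y"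
proof
  fix u assume "u \<in> F y"
  then show "u \<in> convF F y"
    unfolding convF_def by (intro CollectI exI[of _ "return_pmf u"]) (simp add: join_return_pmf)
qed

text \<open>The graph of \<^const>\<open>hatF\<close> is convex: at a state \<open>y\<close> one plays the mixture of the \<open>f i y\<close>
  under the posterior law of \<open>i\<close> given \<open>y\<close>.\<close>

lemma hatF_bind:
  assumes Q: "finite (set_pmf Q)"
    and p: "\<And>i. i \<in> set_pmf Q \<Longrightarrow> finite (set_pmf (p i))"
    and q: "\<And>i. i \<in> set_pmf Q \<Longrightarrow> q i \<in> hatF F (p i)"
  shows "bind_pmf Q q \<in> hatF F (bind_pmf Q p)"
proof -
  have "\<forall>i\<in>set_pmf Q. \<exists>f. q i = bind_pmf (p i) f \<and> (\<forall>y\<in>set_pmf (p i). f y \<in> convF F y)"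
    using q by (auto simp: hatF_def)
  from bchoice[OF this] obtain f where
    f: "\<And>i. i \<in> set_pmf Q \<Longrightarrow> q i = bind_pmf (p i) (f i)"
       "\<And>i y. i \<in> set_pmf Q \<Longrightarrow> y \<in> set_pmf (p i) \<Longrightarrow> f i y \<in> convF F y"
    by blast
  \<comment> \<open>Joint law of index and state; \<open>P\<close> is its second marginal, and
    conditioning on \<open>snd z = y\<close> gives the posterior law.\<close>
  define J where "J = bind_pmf Q (\<lambda>i. map_pmf (\<lambda>y. (i, y)) (p i))"
  define P where "P = bind_pmf Q p"
  have Jset: "set_pmf J = (SIGMA i:set_pmf Q. set_pmf (p i))"
    by (auto simp: J_def)
  have PJ: "P = map_pmf snd J"
    by (simp add: P_def J_def map_bind_pmf map_pmf_comp)
  have finJ: "finite (set_pmf J)"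
    unfolding Jset using Q p by auto
  have disint: "bind_pmf P (\<lambda>y. cond_pmf J {z. snd z = y}) = J"
  proof (rule bind_cond_pmf_cancel)
    fix y assume "y \<in> set_pmf P"
    then show "set_pmf J \<inter> {z. snd z = y} \<noteq> {}"
      by (auto simp: PJ)
  next
    fix z assume "z \<in> set_pmf J"
    then show "set_pmf P \<inter> {y. snd z = y} \<noteq> {}"
      by (auto simp: PJ)
  next
    fix y and z :: "'a \<times> 'b" assume "snd z = y"
    then have "{y. snd z = y} = {y}" "snd -` {y} = {z :: 'a \<times> 'b. snd z = y}"
      by auto
    then show "measure_pmf.prob J {z. snd z = y} = measure_pmf.prob P {y. snd z = y}"
      by (simp add: PJ)
  qed
  have "bind_pmf Q q = bind_pmf Q (\<lambda>i. bind_pmf (p i) (f i))"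
    using f(1) by (intro bind_pmf_cong) auto
  also have "\<dots> = bind_pmf J (\<lambda>(i, y). f i y)"
    by (simp add: J_def bind_assoc_pmf bind_map_pmf)
  also have "\<dots> = bind_pmf P (\<lambda>y. bind_pmf (cond_pmf J {z. snd z = y}) (\<lambda>(i, y). f i y))"
    by (subst disint[symmetric]) (simp add: bind_assoc_pmf)
  finally have eq: "bind_pmf Q q = bind_pmf P (\<lambda>y. bind_pmf (cond_pmf J {z. snd z = y}) (\<lambda>(i, y). f i y))" .
  have "bind_pmf (cond_pmf J {z. snd z = y}) (\<lambda>(i, y). f i y) \<in> convF F y"
    if "y \<in> set_pmf P" for y
  proof -
    have ne: "set_pmf J \<inter> {z. snd z = y} \<noteq> {}"
      using that by (auto simp: PJ)
    have sc: "set_pmf (cond_pmf J {z. snd z = y}) = set_pmf J \<inter> {z. snd z = y}"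
      by (rule set_cond_pmf[OF ne])
    show ?thesis
    proof (rule convF_bind)
      show "finite (set_pmf (cond_pmf J {z. snd z = y}))"
        unfolding sc using finJ by auto
      show "(case z of (i, y) \<Rightarrow> f i y) \<in> convF F y" if "z \<in> set_pmf (cond_pmf J {z. snd z = y})" for z
        using that f(2) unfolding sc Jset by auto
    qed
  qed
  then show ?thesis
    unfolding eq P_def[symmetric] by (auto simp: hatF_def)
qed

definition mix_pmf :: "real \<Rightarrow> 'a pmf \<Rightarrow> 'a pmf \<Rightarrow> 'a pmf" where
  "mix_pmf l p q = bind_pmf (bernoulli_pmf l) (\<lambda>b. if b then p else q)"

lemma mean_mix:
  assumes "finite (set_pmf p)" "finite (set_pmf q)" "0 \<le> l" "l \<le> 1"
  shows "mean (mix_pmf l p q) f = l * mean p f + (1 - l) * mean q f"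
  unfolding mix_pmf_def using assms by (subst mean_bind) auto

lemma hatF_mix:
  assumes "finite (set_pmf p)" "finite (set_pmf p')" "q \<in> hatF F p" "q' \<in> hatF F p'"
  shows "mix_pmf l q q' \<in> hatF F (mix_pmf l p p')"
  unfolding mix_pmf_def using assms
  by (intro hatF_bind) (auto intro: finite_subset[OF subset_UNIV])

locale gambling_house =
  fixes S :: "'a::metric_space set" and F :: "'a \<Rightarrow> 'a pmf set" and r :: "'a \<Rightarrow> real"
  assumes S_ne: "S \<noteq> {}" and S_compact: "compact S"
    and F: "\<And>x. x \<in> S \<Longrightarrow> F x \<noteq> {} \<and> F x \<subseteq> Zf S"
    and r01: "\<And>x. x \<in> S \<Longrightarrow> 0 \<le> r x \<and> r x \<le> 1"
    and r_cont: "continuous_on S r"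
    and nonexp: "\<And>x x' u. x \<in> S \<Longrightarrow> x' \<in> S \<Longrightarrow> u \<in> F x \<Longrightarrow>
      \<exists>u'\<in>F x'. dKR S (to_meas u) (to_meas u') \<le> dist x x'"
begin

definition T :: "('a \<Rightarrow> real) \<Rightarrow> 'a \<Rightarrow> real" where
  "T f x = (SUP u\<in>F x. mean u f)"

definition R :: "'a measure set" where
  "R = invariant_measures S F"

lemma F_in_Zf: "x \<in> S \<Longrightarrow> u \<in> F x \<Longrightarrow> u \<in> Zf S"
  using F by blast

lemma convF_in_Zf:
  assumes "x \<in> S" "u \<in> convF F x"
  shows "u \<in> Zf S"
proof -
  obtain Q where Q: "u = join_pmf Q" "finite (set_pmf Q)" "set_pmf Q \<subseteq> F x"
    using assms(2) by (auto simp: convF_def)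
  then show ?thesis
    unfolding Q(1) join_eq_bind_pmf using F_in_Zf[OF assms(1)] by (intro bind_in_Zf) auto
qed

lemma hatF_in_Zf:
  assumes "p \<in> Zf S" "q \<in> hatF F p"
  shows "q \<in> Zf S"
proof -
  obtain f where f: "q = bind_pmf p f" "\<forall>y\<in>set_pmf p. f y \<in> convF F y"
    using assms(2) by (auto simp: hatF_def)
  show ?thesis
    unfolding f(1) using assms(1) f(2) convF_in_Zf by (intro bind_in_Zf) (auto simp: Zf_def)
qed

definition bounded_fun :: "('a \<Rightarrow> real) \<Rightarrow> bool" where
  "bounded_fun f \<longleftrightarrow> (\<exists>B. \<forall>x\<in>S. \<bar>f x\<bar> \<le> B)"

lemma bounded_fun_cont: "continuous_on S f \<Longrightarrow> bounded_fun f"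
  using compact_imp_bounded[OF compact_continuous_image[OF _ S_compact]]
  by (fastforce simp: bounded_iff bounded_fun_def)

lemma T_bdd:
  assumes "bounded_fun f" "x \<in> S"
  shows "bdd_above ((\<lambda>u. mean u f) ` F x)"
proof -
  obtain B where B: "\<And>x. x \<in> S \<Longrightarrow> - B \<le> f x \<and> f x \<le> B"
    using assms(1) by (force simp: bounded_fun_def abs_le_iff)
  have "mean u f \<le> B" if "u \<in> F x" for u
    using mean_bounds[OF F_in_Zf[OF assms(2) that] B] by simp
  then show ?thesis by (auto intro!: bdd_aboveI)
qed

lemma T_upper: "bounded_fun f \<Longrightarrow> x \<in> S \<Longrightarrow> u \<in> F x \<Longrightarrow> mean u f \<le> T f x"
  unfolding T_def by (intro cSUP_upper T_bdd)

lemma T_least: "x \<in> S \<Longrightarrow> (\<And>u. u \<in> F x \<Longrightarrow> mean u f \<le> b) \<Longrightarrow> T f x \<le> b"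
  unfolding T_def using F by (intro cSUP_least) auto

lemma T_near:
  assumes "bounded_fun f" "x \<in> S" "\<eta> > 0"
  shows "\<exists>u\<in>F x. T f x - \<eta> < mean u f"
  using less_cSUP_iff[of "F x" "\<lambda>u. mean u f" "T f x - \<eta>"] F[OF assms(2)] T_bdd[OF assms(1,2)] assms(3)
  unfolding T_def by auto

lemma convF_le_T:
  assumes "bounded_fun f" "x \<in> S" "u \<in> convF F x"
  shows "mean u f \<le> T f x"
proof -
  obtain Q where Q: "u = join_pmf Q" "finite (set_pmf Q)" "set_pmf Q \<subseteq> F x"
    using assms(3) by (auto simp: convF_def)
  have "mean u f = mean Q (\<lambda>v. mean v f)"
    unfolding Q(1) join_eq_bind_pmf using Q(2,3) F_in_Zf[OF assms(2)]
    by (subst mean_bind) (auto simp: Zf_def)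
  also have "\<dots> \<le> T f x"
    using mean_mono[of Q "F x" "\<lambda>v. mean v f" "\<lambda>_. T f x"] Q T_upper[OF assms(1,2)] by (simp add: Zf_def)
  finally show ?thesis .
qed

lemma hatF_le_T:
  assumes "bounded_fun f" "p \<in> Zf S" "q \<in> hatF F p"
  shows "mean q f \<le> mean p (T f)"
proof -
  obtain g where g: "q = bind_pmf p g" "\<forall>y\<in>set_pmf p. g y \<in> convF F y"
    using assms(3) by (auto simp: hatF_def)
  have pS: "finite (set_pmf p)" "set_pmf p \<subseteq> S" using assms(2) by (auto simp: Zf_def)
  have "mean q f = mean p (\<lambda>y. mean (g y) f)"
    unfolding g(1) using pS g(2) convF_in_Zf by (intro mean_bind) (auto simp: Zf_def)
  also have "\<dots> \<le> mean p (T f)"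
    using pS g(2) convF_le_T[OF assms(1)] by (intro mean_mono[of p "set_pmf p"]) (auto simp: Zf_def)
  finally show ?thesis .
qed

text \<open>Suprema over \<open>F y\<close> need not be attained, so each state selects with loss
  \<open>\<eta>\<close>; pure selections from \<open>F\<close> suffice.\<close>

lemma hatF_near_T:
  assumes "bounded_fun f" "p \<in> Zf S" "\<eta> > 0"
  shows "\<exists>q\<in>hatF F p. mean q f \<ge> mean p (T f) - \<eta>"
proof -
  have "\<forall>y\<in>S. \<exists>u. u \<in> F y \<and> T f y - \<eta> < mean u f"
    using T_near[OF assms(1) _ assms(3)] by blast
  from bchoice[OF this] obtain g where g: "\<And>y. y \<in> S \<Longrightarrow> g y \<in> F y" "\<And>y. y \<in> S \<Longrightarrow> T f y - \<eta> < mean (g y) f"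
    by blast
  have pS: "finite (set_pmf p)" "set_pmf p \<subseteq> S" using assms(2) by (auto simp: Zf_def)
  have "bind_pmf p g \<in> hatF F p"
    unfolding hatF_def using g(1) pS F_subset_convF[of F] by (intro CollectI exI[of _ g]) blast
  moreover have "mean (bind_pmf p g) f = mean p (\<lambda>y. mean (g y) f)"
    using pS g(1) F_in_Zf by (intro mean_bind) (auto simp: Zf_def)
  moreover have "mean p (\<lambda>y. T f y + - \<eta>) \<le> mean p (\<lambda>y. mean (g y) f)"
    using g(2) by (intro mean_mono[OF assms(2)]) (simp add: less_imp_le)
  moreover have "mean p (\<lambda>y. T f y + - \<eta>) = mean p (T f) + - \<eta>"
    using pS by (subst mean_add) auto
  ultimately show ?thesis by force
qed

lemma T_mono:
  assumes "bounded_fun g" "\<And>x. x \<in> S \<Longrightarrow> f x \<le> g x + k" "x \<in> S"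
  shows "T f x \<le> T g x + k"
proof (rule T_least[OF assms(3)])
  fix u assume u: "u \<in> F x"
  have "mean u f \<le> mean u (\<lambda>x. g x + k)"
    by (rule mean_mono[OF F_in_Zf[OF assms(3) u]]) (rule assms(2))
  also have "\<dots> = mean u g + k"
    using F_in_Zf[OF assms(3) u] by (subst mean_add) (auto simp: Zf_def)
  finally show "mean u f \<le> T g x + k"
    using T_upper[OF assms(1,3) u] by simp
qed

lemma T_dist:
  assumes "bounded_fun f" "bounded_fun g" "\<And>x. x \<in> S \<Longrightarrow> \<bar>f x - g x\<bar> \<le> k" "x \<in> S"
  shows "\<bar>T f x - T g x\<bar> \<le> k"
proof -
  have "f y \<le> g y + k" "g y \<le> f y + k" if "y \<in> S" for y
    using assms(3)[OF that] by auto
  then show ?thesis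
    using T_mono[OF assms(2) _ assms(4), of f k] T_mono[OF assms(1) _ assms(4), of g k] by force
qed

text \<open>A real-valued \<open>SUP\<close> bounds its members only if the family is bounded. It
  is, because a 1-Lipschitz function oscillates on \<open>S\<close> by at most the diameter.\<close>

lemma mean_diff_le_dKR:
  assumes "u \<in> Zf S" "u' \<in> Zf S" "1-lipschitz_on S f"
  shows "mean u f - mean u' f \<le> dKR S (to_meas u) (to_meas u')"
proof -
  have eq: "(LINT x:S|to_meas p. g x) = mean p g" if "1-lipschitz_on S g" "p \<in> Zf S" for g :: "'a \<Rightarrow> real" and p
    by (intro set_lint_eq_pmf_expectation S_compact lipschitz_on_continuous_on[OF that(1)] that(2))
  have bd: "bdd_above ((\<lambda>g. (LINT x:S|to_meas u. g x) - (LINT x:S|to_meas u'. g x)) ` {g::'a \<Rightarrow> real. 1-lipschitz_on S g})"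
  proof (rule bdd_aboveI)
    fix y assume "y \<in> (\<lambda>g. (LINT x:S|to_meas u. g x) - (LINT x:S|to_meas u'. g x)) ` {g::'a \<Rightarrow> real. 1-lipschitz_on S g}"
    then obtain g where g: "1-lipschitz_on S g" "y = mean u g - mean u' g"
      using eq assms(1,2) by auto
    obtain x0 where x0: "x0 \<in> S" using S_ne by auto
    have "g x0 - diameter S \<le> g x \<and> g x \<le> g x0 + diameter S" if "x \<in> S" for x
      using lipschitz_onD[OF g(1) that x0] diameter_bounded_bound[OF compact_imp_bounded[OF S_compact] that x0]
      by (auto simp: dist_real_def)
    note b = this
    show "y \<le> 2 * diameter S"
      using mean_bounds[OF assms(1), of "g x0 - diameter S" g, OF b]
        mean_bounds[OF assms(2), of "g x0 - diameter S" g, OF b] unfolding g(2) by linarith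
  qed
  show ?thesis
    unfolding dKR_def using cSUP_upper[OF _ bd, of f] assms(3) eq[OF assms(3)] assms(1,2) by simp
qed

text \<open>For \<open>u \<in> F x\<close> nonexpansiveness supplies \<open>u' \<in> F x'\<close> at
  distance at most \<open>dist x x'\<close>, and the rescaled \<open>f\<close> is one of the test
  functions in \<open>dKR\<close>.\<close>

lemma T_lipschitz:
  assumes f: "K-lipschitz_on S f"
  shows "K-lipschitz_on S (T f)"
proof (rule lipschitz_onI)
  show "0 \<le> K" using f by (rule lipschitz_on_nonneg)
  have bf: "bounded_fun f"
    by (intro bounded_fun_cont lipschitz_on_continuous_on[OF f])
  \<comment> \<open>\<open>K\<close> may be 0, so \<open>f\<close> is divided by a strictly larger
    \<open>K'\<close>, which then decreases to \<open>K\<close>.\<close>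
  have step: "T f x \<le> T f x' + K' * dist x x'" if xx': "x \<in> S" "x' \<in> S" and "K' > K" for x x' K'
  proof (rule T_least[OF xx'(1)])
    have K': "K' > 0" using \<open>K' > K\<close> \<open>0 \<le> K\<close> by simp
    have l: "1-lipschitz_on S (\<lambda>x. f x / K')"
    proof (rule lipschitz_onI)
      fix x y assume "x \<in> S" "y \<in> S"
      then have "dist (f x) (f y) \<le> K * dist x y"
        by (rule lipschitz_onD[OF f])
      also have "\<dots> \<le> K' * dist x y"
        using \<open>K' > K\<close> by (intro mult_right_mono) auto
      finally show "dist (f x / K') (f y / K') \<le> 1 * dist x y"
        using K' by (simp add: dist_real_def field_simps flip: diff_divide_distrib)
    qed simp
    fix u assume u: "u \<in> F x"
    obtain u' where u': "u' \<in> F x'" "dKR S (to_meas u) (to_meas u') \<le> dist x x'"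
      using nonexp[OF xx' u] by blast
    have "mean u (\<lambda>x. f x / K') - mean u' (\<lambda>x. f x / K') \<le> dist x x'"
      using mean_diff_le_dKR[OF _ _ l, of u u'] u u' F_in_Zf xx' by force
    then have "mean u f / K' - mean u' f / K' \<le> dist x x'"
      by simp
    then have "mean u f \<le> mean u' f + K' * dist x x'"
      using K' by (simp add: field_simps)
    also have "mean u' f \<le> T f x'"
      by (rule T_upper[OF bf xx'(2) u'(1)])
    finally show "mean u f \<le> T f x' + K' * dist x x'" by simp
  qed
  have le: "T f x \<le> T f x' + K * dist x x'" if "x \<in> S" "x' \<in> S" for x x'
  proof (rule field_le_epsilon)
    fix e :: real assume "e > 0"
    define d where "d = e / (1 + dist x x')"
    have "1 + dist x x' > 0" by (smt (verit) zero_le_dist)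
    then have d: "d > 0" "d * dist x x' \<le> e"
      using \<open>e > 0\<close> unfolding d_def by (auto simp: field_simps)
    have "T f x \<le> T f x' + (K + d) * dist x x'"
      using step[OF that, of "K + d"] d by simp
    then show "T f x \<le> T f x' + K * dist x x' + e"
      using d(2) by (simp add: algebra_simps)
  qed
  show "dist (T f x) (T f y) \<le> K * dist x y" if "x \<in> S" "y \<in> S" for x y
    using le[OF that] le[OF that(2,1)] by (simp add: dist_real_def dist_commute abs_le_iff)
qed

end

section \<open>Affine functions on measures as integrals\<close>

lemma to_meas_return: "to_meas (return_pmf x) = return borel x"
  unfolding to_meas_def return_pmf.rep_eq by (subst distr_return) auto

lemma sets_mix_meas: "sets (mix_meas l M N) = sets borel"
  unfolding mix_meas_def by (subst sets_measure_of) (auto simp: sets.sigma_sets_eq[of borel, simplified])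

lemma emeasure_mix_meas:
  assumes "sets M = sets borel" "sets N = sets borel" "A \<in> sets borel"
  shows "emeasure (mix_meas l M N) A = ennreal l * emeasure M A + ennreal (1 - l) * emeasure N A"
proof (rule emeasure_measure_of[OF mix_meas_def])
  show "sets borel \<subseteq> Pow (UNIV::'a set)" by auto
  show "A \<in> sets (mix_meas l M N)" using assms(3) by (simp add: sets_mix_meas)
  show "positive (sets (mix_meas l M N)) (\<lambda>A. ennreal l * emeasure M A + ennreal (1 - l) * emeasure N A)"
    by (simp add: positive_def)
  show "countably_additive (sets (mix_meas l M N)) (\<lambda>A. ennreal l * emeasure M A + ennreal (1 - l) * emeasure N A)"
    unfolding countably_additive_def sets_mix_meas
  proof (intro allI impI)
    fix A :: "nat \<Rightarrow> 'a set"
    assume A: "range A \<subseteq> sets borel" "disjoint_family A"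
    have "(\<Sum>i. ennreal l * emeasure M (A i) + ennreal (1 - l) * emeasure N (A i))
        = ennreal l * (\<Sum>i. emeasure M (A i)) + ennreal (1 - l) * (\<Sum>i. emeasure N (A i))"
      by (subst suminf_add[symmetric]) (auto simp: summableI)
    also have "(\<Sum>i. emeasure M (A i)) = emeasure M (\<Union> (range A))"
      using A assms by (intro suminf_emeasure) auto
    also have "(\<Sum>i. emeasure N (A i)) = emeasure N (\<Union> (range A))"
      using A assms by (intro suminf_emeasure) auto
    finally show "(\<Sum>i. ennreal l * emeasure M (A i) + ennreal (1 - l) * emeasure N (A i))
      = ennreal l * emeasure M (\<Union> (range A)) + ennreal (1 - l) * emeasure N (\<Union> (range A))" .
  qed
qed

text \<open>As a two-point bind, the mixture inherits its integral formula from the monad structure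
  of measures.\<close>

lemma mix_meas_eq_bind:
  fixes M N :: "'a::metric_space measure"
  assumes M: "prob_space M" "sets M = sets borel" and N: "prob_space N" "sets N = sets borel"
    and l: "0 \<le> l" "l \<le> 1"
  shows "mix_meas l M N = measure_pmf (bernoulli_pmf l) \<bind> (\<lambda>b. if b then M else N)"
proof (rule measure_eqI)
  have m: "(\<lambda>b. if b then M else N) \<in> measurable (measure_pmf (bernoulli_pmf l)) (subprob_algebra borel)"
    using assms by (auto simp: space_subprob_algebra prob_space_imp_subprob_space)
  show "sets (mix_meas l M N) = sets (measure_pmf (bernoulli_pmf l) \<bind> (\<lambda>b. if b then M else N))"
    unfolding sets_mix_meas using M N by (subst sets_bind[where N = borel]) auto
  fix A assume "A \<in> sets (mix_meas l M N)"
  then have A: "A \<in> sets borel" by (simp add: sets_mix_meas)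
  have "emeasure (measure_pmf (bernoulli_pmf l) \<bind> (\<lambda>b. if b then M else N)) A
      = (\<integral>\<^sup>+b. emeasure (if b then M else N) A \<partial>measure_pmf (bernoulli_pmf l))"
    by (rule emeasure_bind[OF _ m A]) simp
  also have "\<dots> = ennreal l * emeasure M A + ennreal (1 - l) * emeasure N A"
    using l by (subst nn_integral_bernoulli_pmf) (auto simp: mult.commute)
  finally show "emeasure (mix_meas l M N) A
      = emeasure (measure_pmf (bernoulli_pmf l) \<bind> (\<lambda>b. if b then M else N)) A"
    using emeasure_mix_meas[OF M(2) N(2) A] by simp
qed

lemma integral_mix_meas:
  fixes f :: "'a::metric_space \<Rightarrow> real"
  assumes M: "prob_space M" "sets M = sets borel" and N: "prob_space N" "sets N = sets borel"
    and l: "0 \<le> l" "l \<le> 1" and f: "f \<in> borel_measurable borel" "\<And>x. \<bar>f x\<bar> \<le> B"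
  shows "integral\<^sup>L (mix_meas l M N) f = l * integral\<^sup>L M f + (1 - l) * integral\<^sup>L N f"
proof -
  have m: "(\<lambda>b. if b then M else N) \<in> measurable (measure_pmf (bernoulli_pmf l)) (subprob_algebra borel)"
    using assms by (auto simp: space_subprob_algebra prob_space_imp_subprob_space)
  have "integral\<^sup>L (mix_meas l M N) f
      = (\<integral>b. integral\<^sup>L (if b then M else N) f \<partial>measure_pmf (bernoulli_pmf l))"
    unfolding mix_meas_eq_bind[OF M N l]
    by (rule integral_bind[where K = borel and B = B and B' = 1])
      (use f m M N in \<open>auto simp: prob_space.emeasure_space_1 intro: measure_pmf.finite_measure\<close>)
  then show ?thesis
    using l by simp
qed

lemma to_meas_mix:
  fixes p q :: "'a::metric_space pmf"
  assumes "0 \<le> l" "l \<le> 1"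
  shows "to_meas (mix_pmf l p q) = mix_meas l (to_meas p) (to_meas q)"
proof (rule measure_eqI)
  show "sets (to_meas (mix_pmf l p q)) = sets (mix_meas l (to_meas p) (to_meas q))"
    by (simp add: sets_mix_meas to_meas_def)
  fix A assume "A \<in> sets (to_meas (mix_pmf l p q))"
  then have A: "A \<in> sets borel" by (simp add: to_meas_def)
  have e: "emeasure (to_meas u) A = emeasure (measure_pmf u) A" for u
    using A by (simp add: to_meas_def emeasure_distr)
  have "emeasure (measure_pmf (mix_pmf l p q)) A
      = (\<integral>\<^sup>+b. emeasure (measure_pmf (if b then p else q)) A \<partial>measure_pmf (bernoulli_pmf l))"
    unfolding mix_pmf_def by (rule emeasure_bind_pmf)
  also have "\<dots> = ennreal l * emeasure (measure_pmf p) A + ennreal (1 - l) * emeasure (measure_pmf q) A"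
    using assms by (subst nn_integral_bernoulli_pmf) (auto simp: mult.commute)
  finally show "emeasure (to_meas (mix_pmf l p q)) A = emeasure (mix_meas l (to_meas p) (to_meas q)) A"
    using A by (subst emeasure_mix_meas) (auto simp: e, auto simp: to_meas_def)
qed

text \<open>Induction on the size of the support: an atom \<open>x\<close> is split off, the rest is
  the conditional law given \<open>- {x}\<close>, and binary affinity applies to the two
  pieces.\<close>

lemma affine_eq_mean:
  assumes S: "compact S" and w: "affine_cont S w" and p: "p \<in> Zf S"
  shows "w (to_meas p) = mean p (\<lambda>x. w (return borel x))"
  using p
proof (induction "card (set_pmf p)" arbitrary: p rule: less_induct)
  case less
  obtain x where x: "x \<in> set_pmf p" using set_pmf_not_empty by fast
  have pS: "finite (set_pmf p)" "set_pmf p \<subseteq> S" using less.prems by (auto simp: Zf_def)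
  define l where "l = pmf p x"
  have l: "0 \<le> l" "l \<le> 1" by (auto simp: l_def pmf_le_1)
  show ?case
  proof (cases "set_pmf p = {x}")
    case True
    then have "p = return_pmf x" by (metis set_pmf_subset_singleton order_refl)
    then show ?thesis by (simp add: to_meas_return)
  next
    case False
    then have ne: "set_pmf p \<inter> (- {x}) \<noteq> {}" using x by auto
    define q where "q = cond_pmf p (- {x})"
    have sq: "set_pmf q = set_pmf p - {x}"
      unfolding q_def set_cond_pmf[OF ne] by auto
    have qS: "q \<in> Zf S" using pS by (auto simp: Zf_def sq)
    have "card (set_pmf q) < card (set_pmf p)"
      unfolding sq using pS(1) x by (intro psubset_card_mono) auto
    then have IH: "w (to_meas q) = mean q (\<lambda>x. w (return borel x))"
      using less.hyps qS by blast
    have "measure_pmf.prob p (- {x}) = 1 - l"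
      using measure_pmf.prob_compl[of "{x}" p] by (simp add: l_def measure_pmf_single Compl_eq_Diff_UNIV)
    moreover have "l \<noteq> 1"
      using calculation measure_measure_pmf_not_zero[OF ne] by simp
    ultimately have pq: "p = mix_pmf l (return_pmf x) q"
      using l by (intro pmf_eqI)
        (auto simp: mix_pmf_def pmf_bind q_def pmf_cond[OF ne] l_def indicator_def)
    have xS: "return_pmf x \<in> Zf S" using x pS by (auto simp: Zf_def)
    have "w (to_meas p) = w (mix_meas l (to_meas (return_pmf x)) (to_meas q))"
      by (subst pq) (simp add: to_meas_mix[OF l])
    also have "\<dots> = l * w (to_meas (return_pmf x)) + (1 - l) * w (to_meas q)"
      using w to_meas_in_Delta[OF S xS] to_meas_in_Delta[OF S qS] l
      unfolding affine_cont_def by auto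
    also have "\<dots> = mean (mix_pmf l (return_pmf x) q) (\<lambda>x. w (return borel x))"
      using l qS by (subst mean_mix) (auto simp: Zf_def IH to_meas_return)
    finally show ?thesis using pq by simp
  qed
qed

section \<open>Admissible functionals as dominating functions\<close>

context gambling_house
begin

text \<open>The traces of \<open>Wset\<close> on Dirac masses: \<open>w\<close> corresponds to
  \<open>f x = w (return borel x)\<close>, and \<open>f\<close> to its integral. Quantifying over
  \<open>u\<close> instead of taking a \<open>SUP\<close> avoids boundedness side
  conditions.\<close>

definition dominating :: "('a \<Rightarrow> real) set" where
  "dominating = {f. continuous_on S f \<and> (\<forall>x\<in>S. 0 \<le> f x \<and> f x \<le> 1) \<and> (\<forall>y\<in>S. \<forall>u\<in>F y. mean u f \<le> f y) \<and>
     (\<forall>M\<in>R. (LINT x:S|M. r x) \<le> (LINT x:S|M. f x))}"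

lemma S_borel: "S \<in> sets borel"
  using S_compact by (intro borel_closed compact_imp_closed)

lemma indicator_borel: "continuous_on S f \<Longrightarrow> (\<lambda>x. indicator S x *\<^sub>R f x :: real) \<in> borel_measurable borel"
  by (rule borel_measurable_continuous_on_indicator[OF S_borel])

lemma set_integrable_cont:
  fixes f :: "'a \<Rightarrow> real"
  assumes "M \<in> Delta S" "continuous_on S f"
  shows "set_integrable M S f"
proof -
  interpret prob_space M using assms(1) by (simp add: Delta_def)
  obtain B where B: "\<And>x. x \<in> S \<Longrightarrow> \<bar>f x\<bar> \<le> B"
    using bounded_fun_cont[OF assms(2)] by (auto simp: bounded_fun_def)
  have "(\<lambda>x. indicator S x *\<^sub>R f x) \<in> borel_measurable M"
    using indicator_borel[OF assms(2)] assms(1) by (simp add: Delta_def cong: measurable_cong_sets)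
  then show ?thesis
    unfolding set_integrable_def
    by (rule integrable_const_bound[where B = "max B 0", rotated])
      (use B in \<open>force intro!: AE_I2 simp: indicator_def\<close>)
qed

lemma set_lint_const:
  assumes "M \<in> Delta S"
  shows "(LINT x:S|M. (c::real)) = c"
proof -
  interpret prob_space M using assms by (simp add: Delta_def)
  have "measure M S = 1" "S \<in> sets M"
    using assms S_borel by (simp_all add: Delta_def measure_def)
  then show ?thesis
    by (simp add: set_lebesgue_integral_def emeasure_eq_measure sets.Int_space_eq2)
qed

lemma set_lint_mono:
  fixes f g :: "'a \<Rightarrow> real"
  assumes "M \<in> Delta S" "continuous_on S f" "continuous_on S g" "\<And>x. x \<in> S \<Longrightarrow> f x \<le> g x"
  shows "(LINT x:S|M. f x) \<le> (LINT x:S|M. g x)"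
  using assms by (intro set_integral_mono set_integrable_cont)

lemma set_lint_return:
  fixes f :: "'a \<Rightarrow> real"
  assumes "continuous_on S f" "x \<in> S"
  shows "(LINT y:S|return borel x. f y) = f x"
  unfolding set_lebesgue_integral_def
  using integral_return[OF _ indicator_borel[OF assms(1)], of x] assms(2) by simp

lemma lint_in_Wset:
  assumes f: "f \<in> dominating"
  shows "(\<lambda>M. LINT x:S|M. f x) \<in> Wset S F r"
proof -
  have fc: "continuous_on S f" and f01: "\<And>x. x \<in> S \<Longrightarrow> 0 \<le> f x \<and> f x \<le> 1"
    and fF: "\<And>y u. y \<in> S \<Longrightarrow> u \<in> F y \<Longrightarrow> mean u f \<le> f y"
    and fR: "\<And>M. M \<in> R \<Longrightarrow> (LINT x:S|M. r x) \<le> (LINT x:S|M. f x)"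
    using f by (auto simp: dominating_def)
  have "affine_cont S (\<lambda>M. LINT x:S|M. f x)"
    unfolding affine_cont_def
  proof (intro conjI ballI allI impI)
    fix M assume M: "M \<in> Delta S"
    show "0 \<le> (LINT x:S|M. f x)"
      using set_lint_mono[OF M, of "\<lambda>_. 0" f] fc f01 set_lint_const[OF M, of 0] by auto
    show "(LINT x:S|M. f x) \<le> 1"
      using set_lint_mono[OF M, of f "\<lambda>_. 1"] fc f01 set_lint_const[OF M, of 1] by auto
  next
    fix M N and l :: real assume "M \<in> Delta S" "N \<in> Delta S" "l \<in> {0..1}"
    then show "(LINT x:S|mix_meas l M N. f x) = l * (LINT x:S|M. f x) + (1 - l) * (LINT x:S|N. f x)"
      unfolding set_lebesgue_integral_def
      using integral_mix_meas[of M N l "\<lambda>x. indicator S x *\<^sub>R f x" 1] indicator_borel[OF fc] f01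
      by (auto simp: Delta_def indicator_def)
  qed (auto simp: weak_conv_def fc)
  moreover have "(SUP u \<in> F y. LINT x:S|to_meas u. f x) \<le> (LINT x:S|return borel y. f x)" if "y \<in> S" for y
    unfolding set_lint_return[OF fc that]
    using F[OF that] fF[OF that] set_lint_eq_pmf_expectation[OF S_compact fc] F_in_Zf[OF that]
    by (intro cSUP_least) auto
  ultimately show ?thesis
    using fR by (auto simp: Wset_def R_def)
qed

text \<open>Dirac masses depend weakly continuously on their base point, which makes
  \<open>f\<close> continuous. Invariant measures are by definition weak limits of finitely
  supported laws, so affinity on those laws and weak continuity already identify \<open>w M\<close>
  with the integral of \<open>f\<close>.\<close>

lemma Wset_to_dominating:
  assumes w: "w \<in> Wset S F r"
  shows "(\<lambda>x. w (return borel x)) \<in> dominating"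
proof -
  define f where "f x = w (return borel x)" for x
  have ac: "affine_cont S w" using w by (simp add: Wset_def)
  have Dr: "return borel x \<in> Delta S" if "x \<in> S" for x
    using to_meas_in_Delta[OF S_compact return_in_Zf[OF that]] by (simp add: to_meas_return)
  have wp: "w (to_meas p) = mean p f" if "p \<in> Zf S" for p
    unfolding f_def by (rule affine_eq_mean[OF S_compact ac that])
  have f01: "0 \<le> f x \<and> f x \<le> 1" if "x \<in> S" for x
    using ac Dr[OF that] unfolding f_def affine_cont_def by blast
  have wlim: "(\<lambda>n. w (Ms n)) \<longlonglongrightarrow> w M"
    if "\<And>n. Ms n \<in> Delta S" "M \<in> Delta S" "Defs.weak_conv S Ms M" for Ms M
    using ac that unfolding affine_cont_def by blast
  have fc: "continuous_on S f"
    unfolding continuous_on_sequentially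
  proof (intro allI impI ballI, elim conjE)
    fix s a assume a: "a \<in> S" and s: "\<forall>n. s n \<in> S" "s \<longlonglongrightarrow> a"
    have "Defs.weak_conv S (\<lambda>n. return borel (s n)) (return borel a)"
      unfolding weak_conv_def
    proof (intro allI impI)
      fix g :: "'a \<Rightarrow> real" assume g: "continuous_on S g"
      then have "(\<lambda>n. g (s n)) \<longlonglongrightarrow> g a"
        using a s unfolding continuous_on_sequentially by (auto simp: o_def)
      then show "(\<lambda>n. LINT x:S|return borel (s n). g x) \<longlonglongrightarrow> (LINT x:S|return borel a. g x)"
        using set_lint_return[OF g] a s by simp
    qed
    then show "(f \<circ> s) \<longlonglongrightarrow> f a"
      using wlim[of "\<lambda>n. return borel (s n)"] Dr a s unfolding f_def o_def by auto
  qed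
  have fF: "mean u f \<le> f y" if "y \<in> S" "u \<in> F y" for y u
  proof -
    have "bdd_above ((\<lambda>u. w (to_meas u)) ` F y)"
      using ac to_meas_in_Delta[OF S_compact F_in_Zf[OF that(1)]]
      unfolding affine_cont_def by (intro bdd_aboveI[of _ 1]) auto
    then have "w (to_meas u) \<le> (SUP u \<in> F y. w (to_meas u))"
      using that(2) by (intro cSUP_upper) auto
    also have "\<dots> \<le> f y"
      using w that(1) by (auto simp: Wset_def f_def)
    finally show ?thesis
      using wp[OF F_in_Zf[OF that]] by simp
  qed
  have "(LINT x:S|M. r x) \<le> (LINT x:S|M. f x)" if M: "M \<in> R" for M
  proof -
    obtain p where p: "M \<in> Delta S" "\<And>n. p n \<in> Zf S" "Defs.weak_conv S (\<lambda>n. to_meas (p n)) M"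
      using M unfolding R_def invariant_measures_def by blast
    have "(\<lambda>n. mean (p n) f) \<longlonglongrightarrow> w M"
      using wlim[of "\<lambda>n. to_meas (p n)" M] p to_meas_in_Delta[OF S_compact] wp by simp
    moreover have "(\<lambda>n. mean (p n) f) \<longlonglongrightarrow> (LINT x:S|M. f x)"
      using p(2,3) fc set_lint_eq_pmf_expectation[OF S_compact fc] unfolding weak_conv_def by fastforce
    ultimately have "w M = (LINT x:S|M. f x)"
      by (rule LIMSEQ_unique)
    then show ?thesis
      using w M by (auto simp: Wset_def R_def)
  qed
  then show ?thesis
    using fc f01 fF unfolding f_def dominating_def by simp
qed

text \<open>Makes the set under the infimum in \<open>vstar\<close> nonempty.\<close>

lemma one_in_dominating: "(\<lambda>_. 1) \<in> dominating"
proof -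
  have "(LINT x:S|M. r x) \<le> (LINT x:S|M. 1)" if "M \<in> R" for M
    using that r01 r_cont by (intro set_lint_mono) (auto simp: R_def invariant_measures_def)
  then show ?thesis by (simp add: dominating_def)
qed

lemma vstar_le:
  assumes "f \<in> dominating" "x \<in> S"
  shows "vstar S F r x \<le> f x"
proof -
  have "bdd_below {w (return borel x) | w. w \<in> Wset S F r}"
    using Wset_to_dominating assms(2) by (intro bdd_belowI[of _ 0]) (force simp: dominating_def)
  moreover have "f x \<in> {w (return borel x) | w. w \<in> Wset S F r}"
    using lint_in_Wset[OF assms(1)] set_lint_return[of f x] assms
    by (intro CollectI exI[of _ "\<lambda>M. LINT x:S|M. f x"]) (auto simp: dominating_def)
  ultimately show ?thesis
    unfolding vstar_def by (intro cInf_lower)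
qed

lemma vstar_greatest:
  assumes "\<And>f. f \<in> dominating \<Longrightarrow> c \<le> f x"
  shows "c \<le> vstar S F r x"
  unfolding vstar_def
  using lint_in_Wset[OF one_in_dominating] Wset_to_dominating assms by (intro cInf_greatest) auto

end

section \<open>Equicontinuous families\<close>

text \<open>The total boundedness half of Arzela-Ascoli. The net is drawn from the family itself, so
  its members keep every property that defines the family.\<close>

lemma equicontinuous_finite_net:
  fixes S :: "'a::metric_space set" and \<F> :: "('a \<Rightarrow> real) set"
  assumes S: "compact S" and b: "\<And>f x. f \<in> \<F> \<Longrightarrow> x \<in> S \<Longrightarrow> 0 \<le> f x \<and> f x \<le> 1"
    and eq: "\<And>\<epsilon>. \<epsilon> > 0 \<Longrightarrow> \<exists>\<delta>>0. \<forall>f\<in>\<F>. \<forall>x\<in>S. \<forall>y\<in>S. dist x y < \<delta> \<longrightarrow> \<bar>f x - f y\<bar> < \<epsilon>"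
    and "\<eta> > 0"
  obtains N where "finite N" "N \<subseteq> \<F>" "\<And>f. f \<in> \<F> \<Longrightarrow> \<exists>g\<in>N. \<forall>x\<in>S. \<bar>f x - g x\<bar> \<le> \<eta>"
proof -
  have "\<eta>/4 > 0" using \<open>\<eta> > 0\<close> by simp
  from eq[OF this] obtain \<delta> where \<delta>0: "\<delta> > 0"
    and \<delta>eq: "\<forall>f\<in>\<F>. \<forall>x\<in>S. \<forall>y\<in>S. dist x y < \<delta> \<longrightarrow> \<bar>f x - f y\<bar> < \<eta>/4"
    by (elim exE conjE)
  note \<delta> = \<delta>0 \<delta>eq[rule_format]
  have "\<exists>A. finite A \<and> A \<subseteq> S \<and> S \<subseteq> (\<Union>a\<in>A. ball a \<delta>)"
    using compact_imp_seq_compact[OF S, THEN seq_compact_imp_totally_bounded] \<delta>0 by simp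
  then obtain A where A: "finite A" "A \<subseteq> S" "S \<subseteq> (\<Union>a\<in>A. ball a \<delta>)"
    by blast
  \<comment> \<open>Rounding to a grid of mesh \<open>\<eta>/4\<close>: equal keys leave a gap below
    \<open>\<eta>/4\<close> on \<open>A\<close>, and two equicontinuity errors of the same size keep
    the total below \<open>\<eta>\<close> on \<open>S\<close>.\<close>
  define key where "key f = (\<lambda>a\<in>A. \<lfloor>f a * (4/\<eta>)\<rfloor>)" for f :: "'a \<Rightarrow> real"
  have "key ` \<F> \<subseteq> A \<rightarrow>\<^sub>E {0..\<lfloor>4/\<eta>\<rfloor>}"
  proof (intro image_subsetI PiE_I)
    fix f a assume f: "f \<in> \<F>" and a: "a \<in> A"
    then have "0 \<le> f a" "f a \<le> 1" using b A(2) by auto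
    then have "0 \<le> f a * (4/\<eta>)" "f a * (4/\<eta>) \<le> 4/\<eta>"
      using \<open>\<eta> > 0\<close> by (auto intro!: divide_right_mono)
    then show "key f a \<in> {0..\<lfloor>4/\<eta>\<rfloor>}"
      using a by (auto simp: key_def intro: floor_mono)
  qed (auto simp: key_def)
  then have fin: "finite (key ` \<F>)"
    by (rule finite_subset) (intro finite_PiE A(1), auto)
  define N where "N = inv_into \<F> key ` (key ` \<F>)"
  have N\<F>: "N \<subseteq> \<F>"
    unfolding N_def by (auto intro: inv_into_into)
  have "\<exists>g\<in>N. \<forall>x\<in>S. \<bar>f x - g x\<bar> \<le> \<eta>" if f: "f \<in> \<F>" for f
  proof (intro bexI ballI)
    define g where "g = inv_into \<F> key (key f)"
    show "inv_into \<F> key (key f) \<in> N" using f by (simp add: N_def)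
    then have g: "g \<in> \<F>" using N\<F> g_def by auto
    have kg: "key g = key f"
      unfolding g_def using f by (simp add: f_inv_into_f)
    fix x assume x: "x \<in> S"
    then obtain a where a: "a \<in> A" "dist x a < \<delta>" using A(3) by (auto simp: dist_commute)
    have "\<lfloor>g a * (4/\<eta>)\<rfloor> = \<lfloor>f a * (4/\<eta>)\<rfloor>"
      using fun_cong[OF kg, of a] a by (simp add: key_def)
    then have "\<bar>f a * (4/\<eta>) - g a * (4/\<eta>)\<bar> < 1"
      by linarith
    then have "\<bar>f a - g a\<bar> * (4/\<eta>) < 1"
      using \<open>\<eta> > 0\<close> abs_mult[of "f a - g a" "4/\<eta>"]
      unfolding left_diff_distrib[symmetric] by simp
    then have "\<bar>f a - g a\<bar> < \<eta>/4"
      using \<open>\<eta> > 0\<close> by (simp add: pos_less_divide_eq)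
    moreover have "\<bar>f x - f a\<bar> < \<eta>/4" "\<bar>g x - g a\<bar> < \<eta>/4"
      using \<delta>(2)[OF f x _ a(2)] \<delta>(2)[OF g x _ a(2)] a A(2) by auto
    ultimately show "\<bar>f x - inv_into \<F> key (key f) x\<bar> \<le> \<eta>"
      unfolding g_def[symmetric] using \<open>\<eta> > 0\<close> by linarith
  qed
  then show thesis
    using that[of N] fin N\<F> by (auto simp: N_def)
qed

text \<open>At level \<open>n\<close> the pigeonhole principle on a finite net yields a subsequence
  with mutual distances at most \<open>1 / Suc n\<close>; the diagonal sequence is uniformly
  Cauchy.\<close>

lemma equicontinuous_convergent_subsequence:
  fixes S :: "'a::metric_space set" and f :: "nat \<Rightarrow> 'a \<Rightarrow> real"
  assumes S: "compact S" and b: "\<And>k x. x \<in> S \<Longrightarrow> 0 \<le> f k x \<and> f k x \<le> 1"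
    and eq: "\<And>\<epsilon>. \<epsilon> > 0 \<Longrightarrow> \<exists>\<delta>>0. \<forall>k. \<forall>x\<in>S. \<forall>y\<in>S. dist x y < \<delta> \<longrightarrow> \<bar>f k x - f k y\<bar> < \<epsilon>"
  obtains s :: "nat \<Rightarrow> nat" and g where "strict_mono s"
    "\<And>\<epsilon>. \<epsilon> > 0 \<Longrightarrow> \<exists>K. \<forall>k\<ge>K. \<forall>x\<in>S. \<bar>f (s k) x - g x\<bar> \<le> \<epsilon>"
proof -
  define P where "P n s \<longleftrightarrow> (\<forall>i j. \<forall>x\<in>S. \<bar>f (s i) x - f (s j) x\<bar> \<le> 1 / real (Suc n))" for n and s :: "nat \<Rightarrow> nat"
  interpret subseqs P
  proof
    fix n and s :: "nat \<Rightarrow> nat" assume "strict_mono s"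
    have "1 / (2 * real (Suc n)) > 0" by simp
    obtain N where N: "finite N" "N \<subseteq> range f"
      "\<And>h. h \<in> range f \<Longrightarrow> \<exists>g\<in>N. \<forall>x\<in>S. \<bar>h x - g x\<bar> \<le> 1 / (2 * real (Suc n))"
      by (rule equicontinuous_finite_net[OF S, of "range f", OF _ _ \<open>1 / (2 * real (Suc n)) > 0\<close>])
        (use b eq in auto)
    have "\<forall>i. \<exists>g. g \<in> N \<and> (\<forall>x\<in>S. \<bar>f (s i) x - g x\<bar> \<le> 1 / (2 * real (Suc n)))"
      using N(3) by auto
    from choice[OF this] obtain G where G: "\<And>i. G i \<in> N"
      "\<And>i x. x \<in> S \<Longrightarrow> \<bar>f (s i) x - G i x\<bar> \<le> 1 / (2 * real (Suc n))"
      by blast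
    have "finite (range G)" using G(1) by (intro finite_subset[OF _ N(1)]) auto
    then obtain i0 where "infinite {i \<in> UNIV. G i = G i0}"
      using pigeonhole_infinite[of "UNIV::nat set" G] by auto
    from infinite_enumerate[OF this]
    obtain q :: "nat \<Rightarrow> nat" where q: "strict_mono q" "\<And>n. q n \<in> {i \<in> UNIV. G i = G i0}"
      by blast
    have "P n (s \<circ> q)"
      unfolding P_def
    proof (intro allI ballI)
      fix i j x assume x: "x \<in> S"
      have "\<bar>f (s (q i)) x - f (s (q j)) x\<bar> \<le> 1 / (2 * real (Suc n)) + 1 / (2 * real (Suc n))"
        using G(2)[OF x, of "q i"] G(2)[OF x, of "q j"] q(2)[of i] q(2)[of j] by simp
      also have "\<dots> = 1 / real (Suc n)" by (simp add: field_simps)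
      finally show "\<bar>f ((s \<circ> q) i) x - f ((s \<circ> q) j) x\<bar> \<le> 1 / real (Suc n)" by simp
    qed
    with q(1) show "\<exists>r'. strict_mono r' \<and> P n (s \<circ> r')" by blast
  qed
  define s where "s = diagseq"
  have close: "\<bar>f (s i) x - f (s j) x\<bar> \<le> 1 / real (Suc n)" if "i > n" "j > n" "x \<in> S" for i j n x
  proof -
    have "P n (diagseq \<circ> ((+) (Suc n)))"
      by (rule diagseq_holds) (auto simp: P_def)
    then have "\<bar>f (diagseq (Suc n + (i - Suc n))) x - f (diagseq (Suc n + (j - Suc n))) x\<bar> \<le> 1 / real (Suc n)"
      using that(3) unfolding P_def o_def by blast
    then show ?thesis
      using that(1,2) by (simp add: s_def)
  qed
  have "\<exists>l. (\<lambda>i. f (s i) x) \<longlonglongrightarrow> l" if x: "x \<in> S" for x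
  proof -
    have "Cauchy (\<lambda>i. f (s i) x)"
    proof (rule metric_CauchyI)
      fix e :: real assume "e > 0"
      then obtain n where n: "1 / real (Suc n) < e" using nat_approx_posE by blast
      show "\<exists>M. \<forall>m\<ge>M. \<forall>k\<ge>M. dist (f (s m) x) (f (s k) x) < e"
        using close[of n _ _ x] n x
        by (intro exI[of _ "Suc n"]) (force simp: dist_real_def Suc_le_eq intro: le_less_trans)
    qed
    then show ?thesis using Cauchy_convergent_iff convergent_def by blast
  qed
  then have "\<forall>x\<in>S. \<exists>l. (\<lambda>i. f (s i) x) \<longlonglongrightarrow> l" by blast
  from bchoice[OF this] obtain g where g: "\<And>x. x \<in> S \<Longrightarrow> (\<lambda>i. f (s i) x) \<longlonglongrightarrow> g x"
    by blast
  have "\<exists>K. \<forall>k\<ge>K. \<forall>x\<in>S. \<bar>f (s k) x - g x\<bar> \<le> \<epsilon>" if "\<epsilon> > 0" for \<epsilon>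
  proof -
    obtain n where n: "1 / real (Suc n) < \<epsilon>" using nat_approx_posE[OF \<open>\<epsilon> > 0\<close>] by blast
    have "\<bar>f (s k) x - g x\<bar> \<le> \<epsilon>" if "k \<ge> Suc n" "x \<in> S" for k x
    proof (rule tendsto_upperbound)
      show "(\<lambda>i. \<bar>f (s k) x - f (s i) x\<bar>) \<longlonglongrightarrow> \<bar>f (s k) x - g x\<bar>"
        by (intro tendsto_intros g that)
      show "\<forall>\<^sub>F i in sequentially. \<bar>f (s k) x - f (s i) x\<bar> \<le> \<epsilon>"
        using eventually_gt_at_top[of n]
      proof eventually_elim
        case (elim i)
        then show ?case using close[of n k i x] that n by simp
      qed
    qed simp
    then show ?thesis by blast
  qed
  then show thesis
    using that subseq_diagseq unfolding s_def by blast
qed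

lemma uniform_limit_mean:
  assumes "\<And>\<epsilon>. \<epsilon> > 0 \<Longrightarrow> \<exists>K. \<forall>k\<ge>K. \<forall>x\<in>S. \<bar>f k x - g x\<bar> \<le> (\<epsilon>::real)" "p \<in> Zf S"
  shows "(\<lambda>k. mean p (f k)) \<longlonglongrightarrow> mean p g"
proof (rule LIMSEQ_I)
  fix e :: real assume "e > 0"
  then obtain K where "\<forall>k\<ge>K. \<forall>x\<in>S. \<bar>f k x - g x\<bar> \<le> e/2"
    using assms(1)[of "e/2"] by auto
  then have "\<bar>mean p (f k) - mean p g\<bar> \<le> e/2" if "k \<ge> K" for k
    using mean_diff_le[OF assms(2), of "f k" g] that by blast
  then show "\<exists>K. \<forall>k\<ge>K. norm (mean p (f k) - mean p g) < e"
    using \<open>e > 0\<close> by (intro exI[of _ K]) force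
qed

text \<open>The inf-convolution of \<open>r\<close> with \<open>L * dist\<close> is
  \<open>L\<close>-Lipschitz and lies below \<open>r\<close> on \<open>S\<close>.\<close>

lemma lipschitz_approximation:
  fixes r :: "'a::metric_space \<Rightarrow> real"
  assumes S: "compact S" "S \<noteq> {}" and r: "continuous_on S r" and r01: "\<And>x. x \<in> S \<Longrightarrow> 0 \<le> r x \<and> r x \<le> 1"
    and "\<eta> > 0"
  shows "\<exists>L g. L-lipschitz_on S g \<and> (\<forall>x\<in>S. \<bar>r x - g x\<bar> \<le> \<eta>)"
proof -
  have "uniformly_continuous_on S r"
    by (rule compact_uniformly_continuous[OF r S(1)])
  then obtain \<delta> where \<delta>: "\<delta> > 0" "\<And>x y. x \<in> S \<Longrightarrow> y \<in> S \<Longrightarrow> dist y x < \<delta> \<Longrightarrow> \<bar>r y - r x\<bar> < \<eta>"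
    using \<open>\<eta> > 0\<close> unfolding uniformly_continuous_on_def dist_real_def by metis
  \<comment> \<open>Beyond distance \<open>\<delta>\<close> the penalty is at least 1, the full
    range of \<open>r\<close>; closer points change \<open>r\<close> by less than
    \<open>\<eta>\<close>.\<close>
  define L where "L = 1 / \<delta>"
  define g where "g x = (INF y\<in>S. r y + L * dist x y)" for x
  have L: "L \<ge> 0" using \<delta>(1) by (simp add: L_def)
  have bd: "bdd_below ((\<lambda>y. r y + L * dist x y) ` S)" for x
    using r01 L by (intro bdd_belowI[of _ 0]) auto
  have gle: "g x \<le> r y + L * dist x y" if "y \<in> S" for x y
    unfolding g_def using bd that by (intro cINF_lower)
  have lip: "g x \<le> g x' + L * dist x x'" for x x'
  proof -
    have "g x - L * dist x x' \<le> r y + L * dist x' y" if "y \<in> S" for y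
    proof -
      have "L * dist x y \<le> L * dist x x' + L * dist x' y"
        using mult_left_mono[OF dist_triangle[of x y x'] L] by (simp add: distrib_left)
      then show ?thesis using gle[OF that, of x] by simp
    qed
    then have "g x - L * dist x x' \<le> g x'"
      unfolding g_def[of x'] using S(2) by (intro cINF_greatest)
    then show ?thesis by simp
  qed
  have "L-lipschitz_on S g"
  proof (rule lipschitz_onI)
    show "dist (g x) (g y) \<le> L * dist x y" for x y
      using lip[of x y] lip[of y x] unfolding dist_real_def dist_commute[of y x] by linarith
  qed (rule L)
  moreover have "\<bar>r x - g x\<bar> \<le> \<eta>" if x: "x \<in> S" for x
  proof -
    have "r x - \<eta> \<le> r y + L * dist x y" if y: "y \<in> S" for y
    proof (cases "dist y x < \<delta>")
      case True
      have "0 \<le> L * dist x y" using L by simp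
      then show ?thesis using \<delta>(2)[OF x y True] by linarith
    next
      case False
      then have "1 \<le> L * dist x y"
        using \<delta>(1) by (simp add: L_def dist_commute field_simps)
      then show ?thesis using r01[OF x] r01[OF y] \<open>\<eta> > 0\<close> by linarith
    qed
    then have "r x - \<eta> \<le> g x"
      unfolding g_def using S(2) by (intro cINF_greatest)
    then show ?thesis using gle[OF x, of x] \<open>\<eta> > 0\<close> by auto
  qed
  ultimately show ?thesis by blast
qed

context gambling_house
begin

section \<open>Plays above the value\<close>

text \<open>One rate function, fixed from \<open>r\<close>, against which the whole class is
  measured; only its values at positive arguments are meaningful.\<close>

definition lip_const :: "real \<Rightarrow> real" where
  "lip_const = (SOME K. \<forall>\<eta>>0. \<exists>g. (K \<eta>)-lipschitz_on S g \<and> (\<forall>x\<in>S. \<bar>r x - g x\<bar> \<le> \<eta>))"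

text \<open>Approximation by Lipschitz functions at a prescribed rate, rather than a modulus of
  continuity, because \<open>T\<close> preserves Lipschitz constants (nonexpansiveness of \<open>F\<close> for the dual form of
  the Kantorovich distance) and is a sup-norm contraction. The weight \<open>c\<close> makes the class additive
  and homogeneous.\<close>

definition equicont :: "real \<Rightarrow> ('a \<Rightarrow> real) \<Rightarrow> bool" where
  "equicont c h \<longleftrightarrow> (\<forall>\<eta>>0. \<exists>g. (c * lip_const \<eta>)-lipschitz_on S g \<and> (\<forall>x\<in>S. \<bar>h x - g x\<bar> \<le> c * \<eta>))"

lemma equicont_r: "equicont 1 r"
proof -
  have "\<forall>\<eta>\<in>{0<..}. \<exists>K. \<exists>g. K-lipschitz_on S g \<and> (\<forall>x\<in>S. \<bar>r x - g x\<bar> \<le> \<eta>)"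
    using lipschitz_approximation[OF S_compact S_ne r_cont r01] by auto
  from bchoice[OF this]
  have "\<exists>K. \<forall>\<eta>>0. \<exists>g. (K \<eta>)-lipschitz_on S g \<and> (\<forall>x\<in>S. \<bar>r x - g x\<bar> \<le> \<eta>)"
    by (simp only: Ball_def greaterThan_iff)
  from someI_ex[OF this] show ?thesis
    unfolding equicont_def lip_const_def[symmetric] by simp
qed

lemma lip_const_nonneg: "\<eta> > 0 \<Longrightarrow> lip_const \<eta> \<ge> 0"
  using equicont_r lipschitz_on_nonneg unfolding equicont_def by (metis mult_1)

lemma equicont_add:
  assumes "equicont a f" "equicont b g"
  shows "equicont (a + b) (\<lambda>x. f x + g x)"
  unfolding equicont_def
proof (intro allI impI)
  fix \<eta> :: real assume \<eta>: "\<eta> > 0"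
  obtain f' where f': "(a * lip_const \<eta>)-lipschitz_on S f'" "\<forall>x\<in>S. \<bar>f x - f' x\<bar> \<le> a * \<eta>"
    using assms(1) \<eta> unfolding equicont_def by blast
  obtain g' where g': "(b * lip_const \<eta>)-lipschitz_on S g'" "\<forall>x\<in>S. \<bar>g x - g' x\<bar> \<le> b * \<eta>"
    using assms(2) \<eta> unfolding equicont_def by blast
  have "((a + b) * lip_const \<eta>)-lipschitz_on S (\<lambda>x. f' x + g' x)"
    using lipschitz_on_add[OF f'(1) g'(1)] by (simp add: distrib_right)
  moreover have "\<bar>(f x + g x) - (f' x + g' x)\<bar> \<le> (a + b) * \<eta>" if "x \<in> S" for x
    using bspec[OF f'(2) that] bspec[OF g'(2) that] unfolding distrib_right by linarith
  ultimately show "\<exists>k. ((a + b) * lip_const \<eta>)-lipschitz_on S k \<and> (\<forall>x\<in>S. \<bar>f x + g x - k x\<bar> \<le> (a + b) * \<eta>)"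
    by blast
qed

lemma equicont_cmult:
  assumes "equicont a f" "c \<ge> 0"
  shows "equicont (c * a) (\<lambda>x. c * f x)"
  unfolding equicont_def
proof (intro allI impI)
  fix \<eta> :: real assume \<eta>: "\<eta> > 0"
  obtain f' where f': "(a * lip_const \<eta>)-lipschitz_on S f'" "\<forall>x\<in>S. \<bar>f x - f' x\<bar> \<le> a * \<eta>"
    using assms(1) \<eta> unfolding equicont_def by blast
  have "(c * a * lip_const \<eta>)-lipschitz_on S (\<lambda>x. c * f' x)"
    using lipschitz_on_cmult_real[OF f'(1), of c] assms(2) by (simp add: mult.assoc)
  moreover have "\<bar>c * f x - c * f' x\<bar> \<le> c * a * \<eta>" if "x \<in> S" for x
  proof -
    have "\<bar>c * f x - c * f' x\<bar> = c * \<bar>f x - f' x\<bar>"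
      using assms(2) by (simp add: abs_mult flip: right_diff_distrib)
    also have "\<dots> \<le> c * (a * \<eta>)"
      using f'(2) that assms(2) by (intro mult_left_mono) auto
    finally show ?thesis by (simp add: mult.assoc)
  qed
  ultimately show "\<exists>k. (c * a * lip_const \<eta>)-lipschitz_on S k \<and> (\<forall>x\<in>S. \<bar>c * f x - k x\<bar> \<le> c * a * \<eta>)"
    by blast
qed

text \<open>The approximating Lipschitz functions share the constant
  \<open>c * lip_const \<eta>\<close>, so one \<open>\<delta>\<close> serves every \<open>h\<close>.
  This supplies the finite nets and the compactness.\<close>

lemma equicont_equicontinuous:
  assumes "c \<ge> 0" "\<epsilon> > 0"
  shows "\<exists>\<delta>>0. \<forall>h. equicont c h \<longrightarrow> (\<forall>x\<in>S. \<forall>y\<in>S. dist x y < \<delta> \<longrightarrow> \<bar>h x - h y\<bar> < \<epsilon>)"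
proof -
  define \<eta> where "\<eta> = \<epsilon> / (4 * (c + 1))"
  have \<eta>: "\<eta> > 0" "c * \<eta> \<le> \<epsilon>/4"
    using assms by (auto simp: \<eta>_def field_simps)
  define K where "K = c * lip_const \<eta>"
  have K: "K \<ge> 0" using lip_const_nonneg[OF \<eta>(1)] assms by (simp add: K_def)
  define \<delta> where "\<delta> = \<epsilon> / (4 * (K + 1))"
  have \<delta>: "\<delta> > 0" "K * \<delta> \<le> \<epsilon>/4"
    using assms K by (auto simp: \<delta>_def field_simps)
  have "\<bar>h x - h y\<bar> < \<epsilon>" if h: "equicont c h" and xy: "x \<in> S" "y \<in> S" "dist x y < \<delta>" for h x y
  proof -
    obtain g where g: "K-lipschitz_on S g" "\<forall>x\<in>S. \<bar>h x - g x\<bar> \<le> c * \<eta>"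
      using h \<eta>(1) unfolding equicont_def K_def by blast
    have "\<bar>g x - g y\<bar> \<le> K * dist x y"
      using lipschitz_onD[OF g(1) xy(1,2)] by (simp add: dist_real_def)
    also have "\<dots> \<le> K * \<delta>"
      using xy(3) K by (intro mult_left_mono) auto
    finally have "\<bar>g x - g y\<bar> \<le> \<epsilon>/4" using \<delta>(2) by simp
    then show ?thesis
      using bspec[OF g(2) xy(1)] bspec[OF g(2) xy(2)] \<eta>(2) \<open>\<epsilon> > 0\<close> by linarith
  qed
  then show ?thesis using \<delta>(1) by blast
qed

lemma equicont_nonneg: "equicont c h \<Longrightarrow> c \<ge> 0"
  unfolding equicont_def using S_ne by (metis abs_ge_zero all_not_in_conv mult_1_right order_trans zero_less_one)

lemma equicont_continuous:
  assumes "equicont c h"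
  shows "continuous_on S h"
  unfolding continuous_on_iff
proof (intro ballI allI impI)
  fix x and e :: real assume "x \<in> S" "e > 0"
  then obtain \<delta> where "\<delta> > 0" "\<forall>x\<in>S. \<forall>y\<in>S. dist x y < \<delta> \<longrightarrow> \<bar>h x - h y\<bar> < e"
    using equicont_equicontinuous[OF equicont_nonneg[OF assms] \<open>e > 0\<close>] assms by blast
  then show "\<exists>d>0. \<forall>x'\<in>S. dist x' x < d \<longrightarrow> dist (h x') (h x) < e"
    using \<open>x \<in> S\<close> by (auto simp: dist_real_def)
qed

lemma equicont_bounded: "equicont c h \<Longrightarrow> bounded_fun h"
  by (intro bounded_fun_cont equicont_continuous)

lemma equicont_T:
  assumes "equicont c h"
  shows "equicont c (T h)"
  unfolding equicont_def
proof (intro allI impI)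
  fix \<eta> :: real assume \<eta>: "\<eta> > 0"
  obtain g where g: "(c * lip_const \<eta>)-lipschitz_on S g" "\<forall>x\<in>S. \<bar>h x - g x\<bar> \<le> c * \<eta>"
    using assms(1) \<eta> unfolding equicont_def by blast
  have "\<bar>T h x - T g x\<bar> \<le> c * \<eta>" if "x \<in> S" for x
    using g(2) by (intro T_dist equicont_bounded[OF assms] bounded_fun_cont lipschitz_on_continuous_on[OF g(1)] that) auto
  then show "\<exists>k. (c * lip_const \<eta>)-lipschitz_on S k \<and> (\<forall>x\<in>S. \<bar>T h x - k x\<bar> \<le> c * \<eta>)"
    using T_lipschitz[OF g(1)] by blast
qed

lemma R_Delta: "M \<in> R \<Longrightarrow> M \<in> Delta S"
  by (simp add: R_def invariant_measures_def)

text \<open>On the graph of \<open>hatF\<close> one has \<open>mean q f \<le> mean p (T f)\<close>,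
  and both laws tend to \<open>M\<close>. Domination of \<open>r\<close> on invariant measures
  thereby survives an application of \<open>T\<close>.\<close>

lemma R_le_T:
  assumes M: "M \<in> R" and f: "continuous_on S f" "continuous_on S (T f)"
  shows "(LINT x:S|M. f x) \<le> (LINT x:S|M. T f x)"
proof -
  obtain p q where pq: "\<And>n. p n \<in> Zf S" "\<And>n. q n \<in> hatF F (p n)"
    "Defs.weak_conv S (\<lambda>n. to_meas (p n)) M" "Defs.weak_conv S (\<lambda>n. to_meas (q n)) M"
    using M unfolding R_def invariant_measures_def by blast
  have q: "q n \<in> Zf S" for n
    by (rule hatF_in_Zf[OF pq(1,2)])
  have "(\<lambda>n. mean (q n) f) \<longlonglongrightarrow> (LINT x:S|M. f x)"
    using pq(4) f(1) unfolding weak_conv_def set_lint_eq_pmf_expectation[OF S_compact f(1) q, symmetric] by blast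
  moreover have "(\<lambda>n. mean (p n) (T f)) \<longlonglongrightarrow> (LINT x:S|M. T f x)"
    using pq(3) f(2) unfolding weak_conv_def set_lint_eq_pmf_expectation[OF S_compact f(2) pq(1), symmetric] by blast
  ultimately show ?thesis
    by (rule LIMSEQ_le) (use hatF_le_T[OF bounded_fun_cont[OF f(1)] pq(1,2)] in auto)
qed

lemma set_lint_add:
  fixes f g :: "'a \<Rightarrow> real"
  assumes "M \<in> Delta S" "continuous_on S f" "continuous_on S g"
  shows "(LINT x:S|M. f x + g x) = (LINT x:S|M. f x) + (LINT x:S|M. g x)"
  using assms by (intro set_integral_add set_integrable_cont)

text \<open>The constraints of \<^const>\<open>dominating\<close> scaled by \<open>c\<close>, with the excessivity condition relaxed by
  \<open>c / n\<close>. The relaxation is what a block of \<open>n\<close> stages of payoff costs, so that the class is stable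
  under block operators (lemma \<open>near_excessive_block\<close>).\<close>

definition near_excessive :: "nat \<Rightarrow> real \<Rightarrow> ('a \<Rightarrow> real) \<Rightarrow> bool" where
  "near_excessive n c f \<longleftrightarrow> equicont c f \<and> (\<forall>x\<in>S. 0 \<le> f x \<and> f x \<le> c) \<and> (\<forall>y\<in>S. T f y \<le> f y + c / n) \<and>
     (\<forall>M\<in>R. c * (LINT x:S|M. r x) \<le> (LINT x:S|M. f x))"

lemma T_add_le:
  assumes "bounded_fun f" "bounded_fun g" "x \<in> S"
  shows "T (\<lambda>x. f x + g x) x \<le> T f x + T g x"
proof (rule T_least[OF assms(3)])
  fix u assume u: "u \<in> F x"
  then have "mean u (\<lambda>x. f x + g x) = mean u f + mean u g"
    using F_in_Zf[OF assms(3)] by (intro mean_add) (auto simp: Zf_def)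
  then show "mean u (\<lambda>x. f x + g x) \<le> T f x + T g x"
    using T_upper[OF assms(1,3) u] T_upper[OF assms(2,3) u] by simp
qed

lemma T_cmult_le:
  assumes "bounded_fun f" "x \<in> S" "c \<ge> 0"
  shows "T (\<lambda>x. c * f x) x \<le> c * T f x"
proof (rule T_least[OF assms(2)])
  fix u assume u: "u \<in> F x"
  then show "mean u (\<lambda>x. c * f x) \<le> c * T f x"
    using T_upper[OF assms(1,2) u] assms(3) by (simp add: mult_left_mono)
qed

lemma near_excessive_add:
  assumes "near_excessive n a f" "near_excessive n b g"
  shows "near_excessive n (a + b) (\<lambda>x. f x + g x)"
proof -
  have f: "equicont a f" "\<And>x. x \<in> S \<Longrightarrow> 0 \<le> f x \<and> f x \<le> a" "\<And>y. y \<in> S \<Longrightarrow> T f y \<le> f y + a / n"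
     "\<And>M. M \<in> R \<Longrightarrow> a * (LINT x:S|M. r x) \<le> (LINT x:S|M. f x)"
    using assms(1) by (auto simp: near_excessive_def)
  have g: "equicont b g" "\<And>x. x \<in> S \<Longrightarrow> 0 \<le> g x \<and> g x \<le> b" "\<And>y. y \<in> S \<Longrightarrow> T g y \<le> g y + b / n"
     "\<And>M. M \<in> R \<Longrightarrow> b * (LINT x:S|M. r x) \<le> (LINT x:S|M. g x)"
    using assms(2) by (auto simp: near_excessive_def)
  have "T (\<lambda>x. f x + g x) y \<le> f y + g y + (a + b) / n" if "y \<in> S" for y
    using T_add_le[OF equicont_bounded[OF f(1)] equicont_bounded[OF g(1)] that] f(3)[OF that] g(3)[OF that]
    unfolding add_divide_distrib by linarith
  moreover have "(a + b) * (LINT x:S|M. r x) \<le> (LINT x:S|M. f x + g x)" if "M \<in> R" for M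
    using set_lint_add[OF R_Delta[OF that] equicont_continuous[OF f(1)] equicont_continuous[OF g(1)]]
      f(4)[OF that] g(4)[OF that] unfolding distrib_right by linarith
  ultimately show ?thesis
    unfolding near_excessive_def using equicont_add[OF f(1) g(1)] f(2) g(2) by (auto intro: add_mono)
qed

lemma near_excessive_cmult:
  assumes "near_excessive n a f" "c \<ge> 0"
  shows "near_excessive n (c * a) (\<lambda>x. c * f x)"
proof -
  have f: "equicont a f" "\<And>x. x \<in> S \<Longrightarrow> 0 \<le> f x \<and> f x \<le> a" "\<And>y. y \<in> S \<Longrightarrow> T f y \<le> f y + a / n"
     "\<And>M. M \<in> R \<Longrightarrow> a * (LINT x:S|M. r x) \<le> (LINT x:S|M. f x)"
    using assms(1) by (auto simp: near_excessive_def)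
  have "T (\<lambda>x. c * f x) y \<le> c * f y + c * a / n" if "y \<in> S" for y
    using T_cmult_le[OF equicont_bounded[OF f(1)] that assms(2)] mult_left_mono[OF f(3)[OF that] assms(2)]
    by (simp add: distrib_left)
  moreover have "c * a * (LINT x:S|M. r x) \<le> (LINT x:S|M. c * f x)" if "M \<in> R" for M
    using mult_left_mono[OF f(4)[OF that] assms(2)] by (simp add: mult.assoc)
  ultimately show ?thesis
    unfolding near_excessive_def using equicont_cmult[OF f(1) assms(2)] f(2) assms(2) by (auto intro: mult_left_mono)
qed

lemma near_excessive_one: "near_excessive n 1 (\<lambda>_. 1)"
proof -
  have "equicont 1 (\<lambda>_. 1)"
    unfolding equicont_def using lip_const_nonneg
    by (auto intro!: exI[of _ "\<lambda>_. 1"] lipschitz_onI)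
  moreover have "T (\<lambda>_. 1) y \<le> 1 + 1 / real n" if "y \<in> S" for y
    using that by (intro T_least) auto
  moreover have "(LINT x:S|M. r x) \<le> (LINT x:S|M. 1)" if "M \<in> R" for M
    using one_in_dominating that by (simp add: dominating_def)
  ultimately show ?thesis by (simp add: near_excessive_def)
qed

lemma near_excessive_sum:
  assumes "finite N" "\<And>g. g \<in> N \<Longrightarrow> near_excessive n 1 g" "\<And>g. y g \<ge> 0"
  shows "near_excessive n (\<Sum>g\<in>N. y g) (\<lambda>x. \<Sum>g\<in>N. y g * g x)"
  using assms(1,2)
proof (induction N rule: finite_induct)
  case empty
  then show ?case using near_excessive_cmult[OF near_excessive_one, of 0] by simp
next
  case (insert g N)
  then show ?case
    using near_excessive_add[OF near_excessive_cmult[OF insert.prems[of g] assms(3)[of g]] insert.IH] by simp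
qed

text \<open>Bellman operator whose payoff is collected after the move, as in a play, where the
  starting state itself pays nothing.\<close>

definition \<Phi> :: "real \<Rightarrow> ('a \<Rightarrow> real) \<Rightarrow> 'a \<Rightarrow> real" where
  "\<Phi> b h = T (\<lambda>x. b * r x + h x)"

text \<open>The bound on the increment of the iterates is inherited: initially it is
  \<open>a/n\<close> from \<open>h\<close> plus \<open>b/n\<close> from one payoff, and
  \<open>T\<close> is monotone and does not enlarge a constant shift. Scale and domination weight
  rise by \<open>b/n\<close> per step, hence by \<open>b\<close> in total.\<close>

lemma near_excessive_block:
  assumes h: "near_excessive n a h" and b: "b \<ge> 0" and n: "n > 0"
  shows "near_excessive n (a + b) ((\<Phi> (b / n) ^^ n) h)"
proof -
  define \<beta> where "\<beta> = b / n"
  have \<beta>: "\<beta> \<ge> 0" "n * \<beta> = b" using b n by (auto simp: \<beta>_def)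
  define H where "H k = (\<Phi> \<beta> ^^ k) h" for k
  have HS: "H (Suc k) = T (\<lambda>x. \<beta> * r x + H k x)" for k
    by (simp add: H_def \<Phi>_def)
  have h': "equicont a h" "\<And>x. x \<in> S \<Longrightarrow> 0 \<le> h x \<and> h x \<le> a" "\<And>y. y \<in> S \<Longrightarrow> T h y \<le> h y + a / n"
     "\<And>M. M \<in> R \<Longrightarrow> a * (LINT x:S|M. r x) \<le> (LINT x:S|M. h x)"
    using h by (auto simp: near_excessive_def)
  have E: "equicont (a + k * \<beta>) (H k)" for k
  proof (induction k)
    case 0 then show ?case using h'(1) by (simp add: H_def)
  next
    case (Suc k)
    have "equicont (\<beta> * 1 + (a + k * \<beta>)) (\<lambda>x. \<beta> * r x + H k x)"
      by (intro equicont_add equicont_cmult equicont_r \<beta>(1) Suc)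
    then show ?case unfolding HS using equicont_T by (simp add: algebra_simps)
  qed
  have Er: "equicont (\<beta> + (a + k * \<beta>)) (\<lambda>x. \<beta> * r x + H k x)" for k
    using equicont_add[OF equicont_cmult[OF equicont_r \<beta>(1)] E[of k]] by simp
  have ub: "0 \<le> H k x \<and> H k x \<le> a + k * \<beta>" if "x \<in> S" for k x
    using that
  proof (induction k arbitrary: x)
    case 0 then show ?case using h'(2) by (simp add: H_def)
  next
    case (Suc k)
    have bd: "0 \<le> \<beta> * r y + H k y \<and> \<beta> * r y + H k y \<le> a + Suc k * \<beta>" if "y \<in> S" for y
      using Suc.IH[OF that] r01[OF that] \<beta>(1) mult_left_le[of "r y" \<beta>] by (auto simp: algebra_simps)
    obtain u where u: "u \<in> F x" using F[OF Suc.prems] by blast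
    have "0 \<le> mean u (\<lambda>x. \<beta> * r x + H k x)"
      using mean_bounds[OF F_in_Zf[OF Suc.prems u] bd] by simp
    also have "\<dots> \<le> H (Suc k) x"
      unfolding HS by (rule T_upper[OF equicont_bounded[OF Er] Suc.prems u])
    finally have "0 \<le> H (Suc k) x" .
    moreover have "H (Suc k) x \<le> a + Suc k * \<beta>"
      unfolding HS using mean_bounds[OF F_in_Zf[OF Suc.prems] bd] by (intro T_least[OF Suc.prems]) simp
    ultimately show ?case by simp
  qed
  have step: "H (Suc k) x \<le> H k x + (a + b) / n" if "x \<in> S" for k x
    using that
  proof (induction k arbitrary: x)
    case 0
    have "H (Suc 0) x \<le> T h x + \<beta>"
      unfolding HS
    proof (rule T_mono[OF equicont_bounded[OF h'(1)] _ 0])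
      fix y assume "y \<in> S"
      then show "\<beta> * r y + H 0 y \<le> h y + \<beta>"
        using r01[of y] \<beta>(1) mult_left_le[of "r y" \<beta>] by (simp add: H_def)
    qed
    also have "\<dots> \<le> h x + a / n + \<beta>" using h'(3)[OF 0] by simp
    finally show ?case by (simp add: H_def \<beta>_def add_divide_distrib)
  next
    case (Suc k)
    have "T (\<lambda>x. \<beta> * r x + H (Suc k) x) x \<le> T (\<lambda>x. \<beta> * r x + H k x) x + (a + b) / n"
      by (rule T_mono[OF equicont_bounded[OF Er] _ Suc.prems]) (use Suc.IH in \<open>simp add: add.assoc\<close>)
    then show ?case
      by (simp only: HS[symmetric])
  qed
  have Rk: "(a + k * \<beta>) * (LINT x:S|M. r x) \<le> (LINT x:S|M. H k x)" if M: "M \<in> R" for k M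
  proof (induction k)
    case 0 then show ?case using h'(4)[OF M] by (simp add: H_def)
  next
    case (Suc k)
    have c: "continuous_on S (\<lambda>x. \<beta> * r x + H k x)" by (rule equicont_continuous[OF Er])
    have "(a + Suc k * \<beta>) * (LINT x:S|M. r x) \<le> \<beta> * (LINT x:S|M. r x) + (LINT x:S|M. H k x)"
      using Suc.IH by (simp add: algebra_simps)
    also have "\<dots> = (LINT x:S|M. \<beta> * r x + H k x)"
      using set_lint_add[OF R_Delta[OF M], of "\<lambda>x. \<beta> * r x" "H k"] r_cont equicont_continuous[OF E[of k]]
      by (simp add: continuous_on_mult_left)
    also have "\<dots> \<le> (LINT x:S|M. H (Suc k) x)"
      unfolding HS by (rule R_le_T[OF M c equicont_continuous[OF equicont_T[OF Er]]])
    finally show ?case .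
  qed
  \<comment> \<open>Since \<open>r \<ge> 0\<close>, \<open>T (H n)\<close> lies below one more
    iterate, to which the increment bound applies.\<close>
  have "T (H n) y \<le> H n y + (a + b) / n" if "y \<in> S" for y
  proof -
    have "T (H n) y \<le> H (Suc n) y + 0"
      unfolding HS using \<beta>(1) r01 by (intro T_mono[OF equicont_bounded[OF Er] _ that]) auto
    then show ?thesis using step[OF that, of n] by simp
  qed
  then show ?thesis
    unfolding near_excessive_def \<beta>_def[symmetric] H_def[symmetric]
    using E[of n] ub[of _ n] Rk[of _ n] \<beta>(2) by simp
qed

text \<open>Near-optimal selections are made one stage at a time, each step leaving half of its
  tolerance to the remaining stages. \<open>\<tau> 0\<close> is the law before the block, so payoffs
  are taken at \<open>Suc t\<close>.\<close>

lemma path_near_\<Phi>: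
  assumes "u \<in> Zf S" "equicont a h" "\<beta> \<ge> 0" "\<eta> > 0"
  shows "\<exists>\<tau>. \<tau> 0 = u \<and> (\<forall>t<k. \<tau> (Suc t) \<in> hatF F (\<tau> t)) \<and>
     (\<Sum>t<k. \<beta> * mean (\<tau> (Suc t)) r) + mean (\<tau> k) h \<ge> mean u ((\<Phi> \<beta> ^^ k) h) - \<eta>"
  using assms(1,4)
proof (induction k arbitrary: u \<eta>)
  case 0
  then show ?case by (intro exI[of _ "\<lambda>_. u"]) auto
next
  case (Suc k)
  have "\<exists>c. equicont c ((\<Phi> \<beta> ^^ j) h)" for j
  proof (induction j)
    case 0 then show ?case using assms(2) by auto
  next
    case (Suc j)
    then obtain c where "equicont c ((\<Phi> \<beta> ^^ j) h)" by blast
    then have "equicont (\<beta> * 1 + c) ((\<Phi> \<beta> ^^ Suc j) h)"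
      unfolding funpow.simps o_def \<Phi>_def[of \<beta> "(\<Phi> \<beta> ^^ j) h"] by (intro equicont_T equicont_add equicont_cmult equicont_r assms(3))
    then show ?case by blast
  qed
  then obtain c where c: "equicont c ((\<Phi> \<beta> ^^ k) h)" by blast
  then have b: "bounded_fun (\<lambda>x. \<beta> * r x + (\<Phi> \<beta> ^^ k) h x)"
    by (rule equicont_bounded[OF equicont_add[OF equicont_cmult[OF equicont_r assms(3)]]])
  have "\<eta>/2 > 0" using Suc.prems by simp
  obtain q where q: "q \<in> hatF F u"
    "mean q (\<lambda>x. \<beta> * r x + (\<Phi> \<beta> ^^ k) h x) \<ge> mean u (T (\<lambda>x. \<beta> * r x + (\<Phi> \<beta> ^^ k) h x)) - \<eta>/2"
    using hatF_near_T[OF b Suc.prems(1) \<open>\<eta>/2 > 0\<close>] by blast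
  have qS: "q \<in> Zf S" by (rule hatF_in_Zf[OF Suc.prems(1) q(1)])
  obtain \<tau> where \<tau>: "\<tau> 0 = q" "\<forall>t<k. \<tau> (Suc t) \<in> hatF F (\<tau> t)"
     "(\<Sum>t<k. \<beta> * mean (\<tau> (Suc t)) r) + mean (\<tau> k) h \<ge> mean q ((\<Phi> \<beta> ^^ k) h) - \<eta>/2"
    using Suc.IH[OF qS \<open>\<eta>/2 > 0\<close>] by blast
  define \<tau>' where "\<tau>' = case_nat u \<tau>"
  have "\<tau>' (Suc t) \<in> hatF F (\<tau>' t)" if "t < Suc k" for t
    using that \<tau>(1,2) q(1) by (cases t) (auto simp: \<tau>'_def)
  moreover have "(\<Sum>t<Suc k. \<beta> * mean (\<tau>' (Suc t)) r) + mean (\<tau>' (Suc k)) h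
      = \<beta> * mean q r + ((\<Sum>t<k. \<beta> * mean (\<tau> (Suc t)) r) + mean (\<tau> k) h)"
    by (subst sum.lessThan_Suc_shift) (simp add: \<tau>'_def \<tau>(1))
  moreover have "mean q (\<lambda>x. \<beta> * r x + (\<Phi> \<beta> ^^ k) h x) = \<beta> * mean q r + mean q ((\<Phi> \<beta> ^^ k) h)"
    using qS by (subst mean_add) (auto simp: Zf_def)
  moreover have "(\<Phi> \<beta> ^^ Suc k) h = T (\<lambda>x. \<beta> * r x + (\<Phi> \<beta> ^^ k) h x)"
    by (simp add: \<Phi>_def)
  ultimately show ?case
    using q(2) \<tau>(3) by (intro exI[of _ \<tau>']) (auto simp: \<tau>'_def)
qed

text \<open>The invariant that is propagated from one block of \<open>n\<close> stages to the next.\<close>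

definition guarantees :: "nat \<Rightarrow> real \<Rightarrow> 'a pmf \<Rightarrow> bool" where
  "guarantees n c u \<longleftrightarrow> (\<forall>f. near_excessive n 1 f \<longrightarrow> c \<le> mean u f)"

text \<open>Homogeneity carries the bound from scale 1 to every positive scale. At scale 0 no
  normalisation is possible, but then \<open>h\<close> vanishes on \<open>S\<close>.\<close>

lemma guarantees_scale:
  assumes "guarantees n c u" "u \<in> Zf S" "near_excessive n a h"
  shows "c * a \<le> mean u h"
proof (cases "a > 0")
  case True
  have "near_excessive n ((1/a) * a) (\<lambda>x. (1/a) * h x)"
    using True by (intro near_excessive_cmult assms) auto
  then have "near_excessive n 1 (\<lambda>x. (1/a) * h x)"
    using True by simp
  then have "c \<le> mean u (\<lambda>x. (1/a) * h x)"
    using assms(1) unfolding guarantees_def by blast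
  then show ?thesis using True by (simp add: field_simps)
next
  case False
  have h: "equicont a h" "\<And>x. x \<in> S \<Longrightarrow> 0 \<le> h x \<and> h x \<le> a"
    using assms(3) by (auto simp: near_excessive_def)
  have "a = 0" using equicont_nonneg[OF h(1)] False by simp
  then show ?thesis
    using mean_bounds[OF assms(2) h(2)] by simp
qed

lemma near_excessive_finite_net:
  assumes "\<eta> > 0"
  obtains N where "finite N" "\<And>g. g \<in> N \<Longrightarrow> near_excessive n 1 g"
    "\<And>f. near_excessive n 1 f \<Longrightarrow> \<exists>g\<in>N. \<forall>x\<in>S. \<bar>f x - g x\<bar> \<le> \<eta>"
proof -
  obtain N where "finite N" "N \<subseteq> {f. near_excessive n 1 f}"
    "\<And>f. f \<in> {f. near_excessive n 1 f} \<Longrightarrow> \<exists>g\<in>N. \<forall>x\<in>S. \<bar>f x - g x\<bar> \<le> \<eta>"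
  proof (rule equicontinuous_finite_net[OF S_compact _ _ assms])
    show "\<exists>\<delta>>0. \<forall>f\<in>{f. near_excessive n 1 f}. \<forall>x\<in>S. \<forall>y\<in>S. dist x y < \<delta> \<longrightarrow> \<bar>f x - f y\<bar> < \<epsilon>" if "\<epsilon> > 0" for \<epsilon>
    proof -
      obtain \<delta> where "\<delta> > 0" "\<forall>h. equicont 1 h \<longrightarrow> (\<forall>x\<in>S. \<forall>y\<in>S. dist x y < \<delta> \<longrightarrow> \<bar>h x - h y\<bar> < \<epsilon>)"
        using equicont_equicontinuous[of 1 \<epsilon>] \<open>\<epsilon> > 0\<close> by auto
      then show ?thesis unfolding near_excessive_def by (intro exI[of _ \<delta>]) simp
    qed
  qed (auto simp: near_excessive_def)
  then show thesis using that by blast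
qed

lemma path_in_Zf:
  assumes "\<tau> 0 \<in> Zf S" "\<forall>t<n. \<tau> (Suc t) \<in> hatF F (\<tau> t)" "t \<le> n"
  shows "\<tau> t \<in> Zf S"
  using assms(3)
proof (induction t)
  case 0 then show ?case using assms(1) by simp
next
  case (Suc t)
  then show ?case using assms(2) hatF_in_Zf[of "\<tau> t" "\<tau> (Suc t)"] by auto
qed

text \<open>The block average and the means of finitely many test functions \<open>g\<close> at the end of the block
  are handled simultaneously by minimax: for fixed weights, the optimal value of the weighted sum is
  the integral of a near-excessive function.\<close>

lemma guarantees_block:
  assumes n: "n > 0" and u: "u \<in> Zf S" and g: "guarantees n c u" and "\<delta> > 0"
  shows "\<exists>\<tau>. \<tau> 0 = u \<and> (\<forall>t<n. \<tau> (Suc t) \<in> hatF F (\<tau> t)) \<and>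
     (\<Sum>t<n. mean (\<tau> (Suc t)) r) \<ge> n * (c - \<delta>) \<and> guarantees n (c - \<delta>) (\<tau> n)"
proof -
  define path where "path \<tau> \<longleftrightarrow> \<tau> 0 = u \<and> (\<forall>t<n. \<tau> (Suc t) \<in> hatF F (\<tau> t))" for \<tau>
  have pZ: "\<tau> t \<in> Zf S" if "path \<tau>" "t \<le> n" for \<tau> t
  proof (rule path_in_Zf[OF _ _ that(2)])
    show "\<tau> 0 \<in> Zf S" "\<forall>t<n. \<tau> (Suc t) \<in> hatF F (\<tau> t)"
      using that(1) u by (simp_all add: path_def)
  qed
  have "\<delta>/2 > 0" using \<open>\<delta> > 0\<close> by simp
  obtain N where N: "finite N" "\<And>g. g \<in> N \<Longrightarrow> near_excessive n 1 g"
    "\<And>f. near_excessive n 1 f \<Longrightarrow> \<exists>g\<in>N. \<forall>x\<in>S. \<bar>f x - g x\<bar> \<le> \<delta>/2"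
    by (rule near_excessive_finite_net[OF \<open>\<delta>/2 > 0\<close>, of n]) blast
  have N01: "0 \<le> g x \<and> g x \<le> 1" if "g \<in> N" "x \<in> S" for g x
    using N(2)[OF that(1)] that(2) by (auto simp: near_excessive_def)
  \<comment> \<open>The option type puts the block average and the final means into one index set
    for minimax.\<close>
  define vec where "vec \<tau> i = (case i of None \<Rightarrow> (\<Sum>t<n. mean (\<tau> (Suc t)) r) / n | Some f \<Rightarrow> mean (\<tau> n) f)"
    for \<tau> and i :: "('a \<Rightarrow> real) option"
  define D where "D = {vec \<tau> | \<tau>. path \<tau>}"
  define I where "I = insert None (Some ` N)"
  have sumI: "(\<Sum>i\<in>I. w i) = w None + (\<Sum>g\<in>N. w (Some g))" for w :: "('a \<Rightarrow> real) option \<Rightarrow> real"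
    unfolding I_def using N(1) by (subst sum.insert) (auto simp: sum.reindex)
  have "\<exists>d\<in>D. \<forall>i\<in>I. d i \<ge> c - \<delta>/2"
  proof (rule finite_minimax[where B = 1])
    show "finite I" using N(1) by (simp add: I_def)
    show "\<delta>/2 > 0" by fact
  next
    fix y :: "('a \<Rightarrow> real) option \<Rightarrow> real" and \<eta> :: real assume y: "\<And>i. 0 \<le> y i" and \<eta>: "\<eta> > 0"
    define h where "h x = (\<Sum>g\<in>N. y (Some g) * g x)" for x
    define a where "a = (\<Sum>g\<in>N. y (Some g))"
    have h: "near_excessive n a h" unfolding a_def h_def[abs_def] by (intro near_excessive_sum N y)
    \<comment> \<open>A weight on the block average is that weight spread equally over the
      \<open>n\<close> stages.\<close>
    define \<beta> where "\<beta> = y None / n"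
    have \<beta>: "\<beta> \<ge> 0" using y by (simp add: \<beta>_def)
    have "near_excessive n (a + y None) ((\<Phi> \<beta> ^^ n) h)"
      unfolding \<beta>_def by (rule near_excessive_block[OF h y n])
    then have 1: "c * (a + y None) \<le> mean u ((\<Phi> \<beta> ^^ n) h)"
      by (rule guarantees_scale[OF g u])
    have "equicont a h" using h by (simp add: near_excessive_def)
    then obtain \<tau> where \<tau>: "path \<tau>"
      "(\<Sum>t<n. \<beta> * mean (\<tau> (Suc t)) r) + mean (\<tau> n) h \<ge> mean u ((\<Phi> \<beta> ^^ n) h) - \<eta>"
      using path_near_\<Phi>[OF u _ \<beta> \<eta>, of a h n] unfolding path_def by blast
    have "mean (\<tau> n) h = (\<Sum>g\<in>N. y (Some g) * mean (\<tau> n) g)"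
      unfolding h_def[abs_def] using pZ[OF \<tau>(1), of n] by (simp add: Zf_def integrable_measure_pmf_finite)
    then have "(\<Sum>i\<in>I. y i * vec \<tau> i) = (\<Sum>t<n. \<beta> * mean (\<tau> (Suc t)) r) + mean (\<tau> n) h"
      unfolding sumI vec_def \<beta>_def by (simp add: sum_distrib_left sum_divide_distrib)
    moreover have "(\<Sum>i\<in>I. y i) = a + y None"
      unfolding sumI a_def by simp
    ultimately have "(\<Sum>i\<in>I. y i * vec \<tau> i) \<ge> c * (\<Sum>i\<in>I. y i) - \<eta>"
      using 1 \<tau>(2) by simp
    moreover have "vec \<tau> \<in> D" using \<tau>(1) by (auto simp: D_def)
    ultimately show "\<exists>e\<in>D. (\<Sum>i\<in>I. y i * e i) \<ge> c * (\<Sum>i\<in>I. y i) - \<eta>" by blast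
  next
    \<comment> \<open>Only the existence of a path matters here; payoff weight 0, terminal function
      \<open>r\<close> and tolerance 1 are arbitrary choices.\<close>
    obtain \<tau> where "path \<tau>"
      using path_near_\<Phi>[OF u equicont_r, of 0 1 n] unfolding path_def by auto
    then show "D \<noteq> {}" by (auto simp: D_def)
  next
    fix d i assume "d \<in> D" "i \<in> I"
    then obtain \<tau> where \<tau>: "path \<tau>" "d = vec \<tau>" by (auto simp: D_def)
    show "\<bar>d i\<bar> \<le> 1"
    proof (cases i)
      case None
      have b: "0 \<le> mean (\<tau> (Suc t)) r \<and> mean (\<tau> (Suc t)) r \<le> 1" if "t < n" for t
        using mean_bounds[OF pZ[OF \<tau>(1), of "Suc t"] r01] that by simp
      then have "0 \<le> (\<Sum>t<n. mean (\<tau> (Suc t)) r)" by (intro sum_nonneg) auto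
      moreover have "(\<Sum>t<n. mean (\<tau> (Suc t)) r) \<le> (\<Sum>t<n. 1)" using b by (intro sum_mono) auto
      ultimately show ?thesis using n by (simp add: \<tau>(2) vec_def None)
    next
      case (Some f)
      then have "f \<in> N" using \<open>i \<in> I\<close> by (auto simp: I_def)
      then show ?thesis
        using mean_bounds[OF pZ[OF \<tau>(1), of n], of 0 f 1] N01[OF \<open>f \<in> N\<close>] by (simp add: \<tau>(2) vec_def Some)
    qed
  next
    fix d e and l :: real assume "d \<in> D" "e \<in> D" and l: "0 < l" "l < 1"
    then obtain \<tau> \<tau>' where \<tau>: "path \<tau>" "d = vec \<tau>" "path \<tau>'" "e = vec \<tau>'" by (auto simp: D_def)
    \<comment> \<open>Laws are mixed stage by stage; convexity of the graph of \<open>hatF\<close>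
      keeps this a path.\<close>
    define \<rho> where "\<rho> t = mix_pmf l (\<tau>' t) (\<tau> t)" for t
    have fin: "finite (set_pmf (\<tau> t))" "finite (set_pmf (\<tau>' t))" if "t \<le> n" for t
      using pZ[OF \<tau>(1) that] pZ[OF \<tau>(3) that] by (auto simp: Zf_def)
    have "path \<rho>"
      unfolding path_def
    proof (intro conjI allI impI)
      show "\<rho> 0 = u" using \<tau>(1,3) by (simp add: \<rho>_def path_def mix_pmf_def)
      show "\<rho> (Suc t) \<in> hatF F (\<rho> t)" if "t < n" for t
        unfolding \<rho>_def using \<tau>(1,3) that fin[of t] by (intro hatF_mix) (auto simp: path_def)
    qed
    moreover have m: "mean (\<rho> t) f = (1 - l) * mean (\<tau> t) f + l * mean (\<tau>' t) f" if "t \<le> n" for t f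
      unfolding \<rho>_def using fin[OF that] l by (simp add: mean_mix)
    have "vec \<rho> i = (1 - l) * d i + l * e i" for i
    proof (cases i)
      case None
      have "(\<Sum>t<n. mean (\<rho> (Suc t)) r) = (\<Sum>t<n. (1 - l) * mean (\<tau> (Suc t)) r + l * mean (\<tau>' (Suc t)) r)"
        by (intro sum.cong refl m) auto
      then show ?thesis
        by (simp add: None vec_def \<tau> sum.distrib sum_distrib_left[symmetric] add_divide_distrib)
    next
      case (Some f)
      then show ?thesis using m[of n f] by (simp add: vec_def \<tau>)
    qed
    ultimately show "\<exists>h\<in>D. \<forall>i\<in>I. h i = (1 - l) * d i + l * e i"
      by (intro bexI[of _ "vec \<rho>"]) (auto simp: D_def)
  qed
  then obtain \<tau> where \<tau>: "path \<tau>" "\<And>i. i \<in> I \<Longrightarrow> vec \<tau> i \<ge> c - \<delta>/2"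
    by (auto simp: D_def)
  have "c - \<delta> \<le> (\<Sum>t<n. mean (\<tau> (Suc t)) r) / n"
    using \<tau>(2)[of None] \<open>\<delta> > 0\<close> by (simp add: I_def vec_def)
  then have "(\<Sum>t<n. mean (\<tau> (Suc t)) r) \<ge> n * (c - \<delta>)"
    using n by (simp add: field_simps)
  moreover have "guarantees n (c - \<delta>) (\<tau> n)"
    unfolding guarantees_def
  proof (intro allI impI)
    fix f assume "near_excessive n 1 f"
    then obtain g where g: "g \<in> N" "\<forall>x\<in>S. \<bar>f x - g x\<bar> \<le> \<delta>/2" using N(3) by blast
    have "c - \<delta>/2 \<le> mean (\<tau> n) g"
      using \<tau>(2)[of "Some g"] g(1) by (simp add: I_def vec_def)
    \<comment> \<open>The second half of \<open>\<delta>\<close> pays for replacing \<open>f\<close>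
      by a member of the net.\<close>
    moreover have "\<bar>mean (\<tau> n) f - mean (\<tau> n) g\<bar> \<le> \<delta>/2"
      using g(2) by (intro mean_diff_le[OF pZ[OF \<tau>(1)]]) auto
    ultimately show "c - \<delta> \<le> mean (\<tau> n) f" by linarith
  qed
  ultimately show ?thesis
    using \<tau>(1) unfolding path_def by blast
qed

section \<open>From blocks to plays\<close>

lemma hatF_return: "hatF F (return_pmf x) = convF F x"
  unfolding hatF_def by (auto simp: bind_return_pmf)

text \<open>Block \<open>j\<close> loses \<open>\<epsilon> / 2^(j+1)\<close>, so the level never
  falls below \<open>c - \<epsilon>\<close>; \<open>c' j\<close> is the level left after block
  \<open>j\<close>.\<close>

lemma guarantees_play:
  assumes n: "n > 0" and x: "x \<in> S" and g: "guarantees n c (return_pmf x)" and "\<epsilon> > 0"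
  shows "\<exists>\<sigma>. is_play F x \<sigma> \<and> (\<forall>j. (\<Sum>i<n. mean (\<sigma> (j * n + i)) r) \<ge> n * (c - \<epsilon>))"
proof -
  define c' where "c' j = c - \<epsilon> * (1 - 1 / 2 ^ Suc j)" for j
  have c': "c - \<epsilon> \<le> c' j" for j
  proof -
    have "\<epsilon> * (1 - 1 / 2 ^ Suc j) \<le> \<epsilon> * 1"
      using \<open>\<epsilon> > 0\<close> by (intro mult_left_mono) auto
    then show ?thesis by (simp add: c'_def)
  qed
  define P where "P j \<tau> \<longleftrightarrow> \<tau> 0 \<in> Zf S \<and> (\<forall>t<n. \<tau> (Suc t) \<in> hatF F (\<tau> t)) \<and>
      (\<Sum>t<n. mean (\<tau> (Suc t)) r) \<ge> n * (c - \<epsilon>) \<and> guarantees n (c' j) (\<tau> n) \<and>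
      (j = 0 \<longrightarrow> \<tau> 0 = return_pmf x)" for j \<tau>
  have mono: "n * (c - \<epsilon>) \<le> n * c' j" for j
    using c' by (intro mult_left_mono) auto
  have "\<exists>f. \<forall>j. P j (f j) \<and> f (Suc j) 0 = f j n"
  proof (rule dependent_nat_choice)
    have "\<epsilon>/2 > 0" using \<open>\<epsilon> > 0\<close> by simp
    moreover have "c - \<epsilon>/2 = c' 0" by (simp add: c'_def)
    ultimately obtain \<tau> where \<tau>: "\<tau> 0 = return_pmf x" "\<forall>t<n. \<tau> (Suc t) \<in> hatF F (\<tau> t)"
      "(\<Sum>t<n. mean (\<tau> (Suc t)) r) \<ge> n * c' 0" "guarantees n (c' 0) (\<tau> n)"
      using guarantees_block[OF n return_in_Zf[OF x] g] by metis
    then show "\<exists>\<tau>. P 0 \<tau>"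
      unfolding P_def using return_in_Zf[OF x] mono[of 0] by (intro exI[of _ \<tau>]) auto
  next
    fix \<tau> j assume P: "P j \<tau>"
    have "\<tau> n \<in> Zf S"
      using P unfolding P_def by (intro path_in_Zf[of \<tau> n n]) auto
    moreover have "guarantees n (c' j) (\<tau> n)" using P by (simp add: P_def)
    moreover have "\<epsilon> / 2 ^ Suc (Suc j) > 0" using \<open>\<epsilon> > 0\<close> by simp
    moreover have "c' j - \<epsilon> / 2 ^ Suc (Suc j) = c' (Suc j)"
      by (simp add: c'_def algebra_simps)
    ultimately obtain \<rho> where \<rho>: "\<rho> 0 = \<tau> n" "\<forall>t<n. \<rho> (Suc t) \<in> hatF F (\<rho> t)"
      "(\<Sum>t<n. mean (\<rho> (Suc t)) r) \<ge> n * c' (Suc j)" "guarantees n (c' (Suc j)) (\<rho> n)"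
      using guarantees_block[OF n, of "\<tau> n" "c' j" "\<epsilon> / 2 ^ Suc (Suc j)"] by metis
    then show "\<exists>\<rho>. P (Suc j) \<rho> \<and> \<rho> 0 = \<tau> n"
      unfolding P_def using \<open>\<tau> n \<in> Zf S\<close> mono[of "Suc j"] by (intro exI[of _ \<rho>]) auto
  qed
  then obtain f where f: "\<And>j. P j (f j)" "\<And>j. f (Suc j) 0 = f j n"
    by blast
  \<comment> \<open>The last law of a block is the first law of the next, so each block contributes
    \<open>n\<close> transitions and the concatenation stays a path.\<close>
  define \<rho> where "\<rho> t = f (t div n) (t mod n)" for t
  have \<rho>S: "\<rho> (Suc t) = f (t div n) (Suc (t mod n))" for t
  proof (cases "Suc (t mod n) = n")
    case True
    then show ?thesis by (simp add: \<rho>_def div_Suc mod_Suc f(2))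
  next
    case False
    then show ?thesis by (simp add: \<rho>_def div_Suc mod_Suc)
  qed
  \<comment> \<open>The shift drops the Dirac mass at \<open>x\<close>, which precedes stage
    1.\<close>
  define \<sigma> where "\<sigma> t = \<rho> (Suc t)" for t
  have step: "\<rho> (Suc t) \<in> hatF F (\<rho> t)" for t
    unfolding \<rho>S using f(1)[of "t div n"] n unfolding P_def \<rho>_def by simp
  have "\<rho> 0 = return_pmf x"
    using f(1)[of 0] by (simp add: \<rho>_def P_def)
  then have "is_play F x \<sigma>"
    unfolding is_play_def \<sigma>_def using step[of 0] step by (auto simp: hatF_return)
  moreover have "(\<Sum>i<n. mean (\<sigma> (j * n + i)) r) \<ge> n * (c - \<epsilon>)" for j
  proof -
    have "(\<Sum>i<n. mean (\<sigma> (j * n + i)) r) = (\<Sum>i<n. mean (f j (Suc i)) r)"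
      unfolding \<sigma>_def \<rho>S by (intro sum.cong) auto
    then show ?thesis using f(1)[of j] by (simp add: P_def)
  qed
  ultimately show ?thesis by blast
qed

lemma play_in_Zf:
  assumes "x \<in> S" "is_play F x \<sigma>"
  shows "\<sigma> t \<in> Zf S"
proof (induction t)
  case 0
  then show ?case using assms convF_in_Zf by (auto simp: is_play_def)
next
  case (Suc t)
  then show ?case using assms hatF_in_Zf by (auto simp: is_play_def)
qed

text \<open>Unlike \<^const>\<open>equicont\<close>, a bound by this common modulus of continuity visibly passes to
  pointwise limits.\<close>

definition modulus :: "real \<Rightarrow> real" where
  "modulus = (SOME d. \<forall>\<epsilon>\<in>{0<..}. d \<epsilon> > 0 \<and>
     (\<forall>h. equicont 1 h \<longrightarrow> (\<forall>x\<in>S. \<forall>y\<in>S. dist x y < d \<epsilon> \<longrightarrow> \<bar>h x - h y\<bar> < \<epsilon>)))"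

lemma modulus:
  assumes "\<epsilon> > 0"
  shows "modulus \<epsilon> > 0" "equicont 1 h \<Longrightarrow> x \<in> S \<Longrightarrow> y \<in> S \<Longrightarrow> dist x y < modulus \<epsilon> \<Longrightarrow> \<bar>h x - h y\<bar> < \<epsilon>"
proof -
  have "\<forall>\<epsilon>\<in>{0<..}. \<exists>d. d > 0 \<and>
     (\<forall>h. equicont 1 h \<longrightarrow> (\<forall>x\<in>S. \<forall>y\<in>S. dist x y < d \<longrightarrow> \<bar>h x - h y\<bar> < \<epsilon>))"
    using equicont_equicontinuous[of 1] by simp
  from bchoice[OF this]
  have "\<exists>d. \<forall>\<epsilon>\<in>{0<..}. d \<epsilon> > 0 \<and>
     (\<forall>h. equicont 1 h \<longrightarrow> (\<forall>x\<in>S. \<forall>y\<in>S. dist x y < d \<epsilon> \<longrightarrow> \<bar>h x - h y\<bar> < \<epsilon>))" .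
  from someI_ex[OF this]
  have *: "\<forall>\<epsilon>\<in>{0<..}. modulus \<epsilon> > 0 \<and>
     (\<forall>h. equicont 1 h \<longrightarrow> (\<forall>x\<in>S. \<forall>y\<in>S. dist x y < modulus \<epsilon> \<longrightarrow> \<bar>h x - h y\<bar> < \<epsilon>))"
    unfolding modulus_def[symmetric] .
  have "\<epsilon> \<in> {0<..}" using assms by simp
  note ** = bspec[OF * this]
  show "modulus \<epsilon> > 0" using ** ..
  show "equicont 1 h \<Longrightarrow> x \<in> S \<Longrightarrow> y \<in> S \<Longrightarrow> dist x y < modulus \<epsilon> \<Longrightarrow> \<bar>h x - h y\<bar> < \<epsilon>"
    using ** by blast
qed

text \<open>A totally bounded part of \<open>dominating\<close>, large enough to contain the uniform
  limits of near-excessive functions at scale 1 as \<open>n\<close> grows.\<close>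

definition dominating_equicont :: "('a \<Rightarrow> real) set" where
  "dominating_equicont = {f \<in> dominating. \<forall>\<epsilon>>0. \<forall>x\<in>S. \<forall>y\<in>S. dist x y < modulus \<epsilon> \<longrightarrow> \<bar>f x - f y\<bar> \<le> \<epsilon>}"

text \<open>Compactness: counterexamples at every \<open>Suc k\<close> have a uniformly convergent
  subsequence, along which the relaxation \<open>1 / Suc k\<close> vanishes. The limit is dominating
  and eventually within \<open>\<epsilon>\<close>, a contradiction.\<close>

lemma near_excessive_near_dominating_equicont:
  assumes "\<epsilon> > 0"
  shows "\<exists>n>0. \<forall>f. near_excessive n 1 f \<longrightarrow> (\<exists>g\<in>dominating_equicont. \<forall>x\<in>S. \<bar>f x - g x\<bar> \<le> \<epsilon>)"
proof (rule ccontr)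
  assume neg: "\<not> ?thesis"
  have "\<forall>k. \<exists>f. near_excessive (Suc k) 1 f \<and> \<not> (\<exists>g\<in>dominating_equicont. \<forall>x\<in>S. \<bar>f x - g x\<bar> \<le> \<epsilon>)"
  proof
    fix k show "\<exists>f. near_excessive (Suc k) 1 f \<and> \<not> (\<exists>g\<in>dominating_equicont. \<forall>x\<in>S. \<bar>f x - g x\<bar> \<le> \<epsilon>)"
      using neg zero_less_Suc[of k] by blast
  qed
  from choice[OF this] obtain f where f: "\<And>k. near_excessive (Suc k) 1 (f k)"
    "\<And>k. \<not> (\<exists>g\<in>dominating_equicont. \<forall>x\<in>S. \<bar>f k x - g x\<bar> \<le> \<epsilon>)"
    by blast
  have fE: "equicont 1 (f k)" and f01: "\<And>x. x \<in> S \<Longrightarrow> 0 \<le> f k x \<and> f k x \<le> 1"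
    and fT: "\<And>y. y \<in> S \<Longrightarrow> T (f k) y \<le> f k y + 1 / Suc k"
    and fR: "\<And>M. M \<in> R \<Longrightarrow> (LINT x:S|M. r x) \<le> (LINT x:S|M. f k x)" for k
    using f(1)[of k] by (auto simp: near_excessive_def)
  obtain s :: "nat \<Rightarrow> nat" and g where s: "strict_mono s"
    and unif: "\<And>e. e > 0 \<Longrightarrow> \<exists>K. \<forall>k\<ge>K. \<forall>x\<in>S. \<bar>f (s k) x - g x\<bar> \<le> e"
  proof (rule equicontinuous_convergent_subsequence[OF S_compact f01])
    show "\<exists>\<delta>>0. \<forall>k. \<forall>x\<in>S. \<forall>y\<in>S. dist x y < \<delta> \<longrightarrow> \<bar>f k x - f k y\<bar> < e" if "e > 0" for e
      using modulus[OF that] fE by (intro exI[of _ "modulus e"]) simp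
  qed auto
  have lim: "(\<lambda>k. mean p (f (s k))) \<longlonglongrightarrow> mean p g" if "p \<in> Zf S" for p
    using uniform_limit_mean[of S "\<lambda>k. f (s k)", OF unif that] .
  have limx: "(\<lambda>k. f (s k) x) \<longlonglongrightarrow> g x" if "x \<in> S" for x
    using lim[OF return_in_Zf[OF that]] by simp
  have gmod: "\<bar>g x - g y\<bar> \<le> e" if "e > 0" "x \<in> S" "y \<in> S" "dist x y < modulus e" for e x y
  proof (rule tendsto_upperbound)
    show "(\<lambda>k. \<bar>f (s k) x - f (s k) y\<bar>) \<longlonglongrightarrow> \<bar>g x - g y\<bar>"
      by (intro tendsto_intros limx that)
    show "\<forall>\<^sub>F k in sequentially. \<bar>f (s k) x - f (s k) y\<bar> \<le> e"
      using modulus(2)[OF that(1) fE that(2-4)] by (simp add: less_imp_le)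
  qed simp
  have g01: "0 \<le> g x \<and> g x \<le> 1" if "x \<in> S" for x
    using tendsto_lowerbound[OF limx[OF that], of 0] tendsto_upperbound[OF limx[OF that], of 1] f01[OF that]
    by simp
  have gc: "continuous_on S g"
    unfolding continuous_on_iff
  proof (intro ballI allI impI)
    fix x and e :: real assume x: "x \<in> S" and "e > 0"
    then have e2: "e/2 > 0" by simp
    have "dist (g y) (g x) < e" if "y \<in> S" "dist y x < modulus (e/2)" for y
      using gmod[OF e2 that(1) x that(2)] \<open>e > 0\<close> by (simp add: dist_real_def)
    then show "\<exists>d>0. \<forall>x'\<in>S. dist x' x < d \<longrightarrow> dist (g x') (g x) < e"
      using modulus(1)[OF e2] by blast
  qed
  have gF: "mean u g \<le> g y" if y: "y \<in> S" and u: "u \<in> F y" for y u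
  proof (rule LIMSEQ_le)
    show "(\<lambda>k. mean u (f (s k))) \<longlonglongrightarrow> mean u g"
      by (rule lim[OF F_in_Zf[OF y u]])
    have "(\<lambda>k. 1 / real (Suc (s k))) \<longlonglongrightarrow> 0"
      using LIMSEQ_subseq_LIMSEQ[OF lim_1_over_n[THEN LIMSEQ_Suc] s] by (simp add: o_def)
    then have "(\<lambda>k. f (s k) y + 1 / real (Suc (s k))) \<longlonglongrightarrow> g y + 0"
      by (intro tendsto_add limx[OF y])
    then show "(\<lambda>k. f (s k) y + 1 / real (Suc (s k))) \<longlonglongrightarrow> g y" by simp
    show "\<exists>N. \<forall>k\<ge>N. mean u (f (s k)) \<le> f (s k) y + 1 / real (Suc (s k))"
      using T_upper[OF equicont_bounded[OF fE] y u] fT[OF y] by (meson order_trans)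
  qed
  have gR: "(LINT x:S|M. r x) \<le> (LINT x:S|M. g x)" if M: "M \<in> R" for M
  proof (rule field_le_epsilon)
    fix e :: real assume "e > 0"
    then obtain K where K: "\<forall>k\<ge>K. \<forall>x\<in>S. \<bar>f (s k) x - g x\<bar> \<le> e" using unif by blast
    have "(LINT x:S|M. r x) \<le> (LINT x:S|M. f (s K) x)" by (rule fR[OF M])
    also have "\<dots> \<le> (LINT x:S|M. g x + e)"
      using K by (intro set_lint_mono[OF R_Delta[OF M]] equicont_continuous[OF fE] continuous_intros gc) force
    also have "\<dots> = (LINT x:S|M. g x) + e"
      using set_lint_add[OF R_Delta[OF M] gc, of "\<lambda>_. e"] set_lint_const[OF R_Delta[OF M], of e] by simp
    finally show "(LINT x:S|M. r x) \<le> (LINT x:S|M. g x) + e" .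
  qed
  have "g \<in> dominating_equicont"
    unfolding dominating_equicont_def dominating_def using gmod g01 gc gF gR by blast
  moreover obtain K where "\<forall>k\<ge>K. \<forall>x\<in>S. \<bar>f (s k) x - g x\<bar> \<le> \<epsilon>" using unif[OF assms] by blast
  then have "\<forall>x\<in>S. \<bar>f (s K) x - g x\<bar> \<le> \<epsilon>" by (rule allE[of _ K]) simp
  ultimately have "\<exists>g\<in>dominating_equicont. \<forall>x\<in>S. \<bar>f (s K) x - g x\<bar> \<le> \<epsilon>" by (intro bexI[of _ g])
  with f(2) show False by (rule notE)
qed

text \<open>\<open>n\<close> depends on \<open>\<epsilon>\<close> alone; this order of quantifiers
  makes the threshold on the impatience uniform in \<open>x\<close>. Half of
  \<open>\<epsilon>\<close> pays for approximating near-excessive functions, half for the losses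
  over the blocks.\<close>

lemma block_plays_above:
  assumes "\<epsilon> > 0"
  shows "\<exists>n>0::nat. (\<forall>x\<in>S. \<forall>c. (\<forall>g\<in>dominating_equicont. c \<le> g x) \<longrightarrow>
    (\<exists>\<sigma>. is_play F x \<sigma> \<and> (\<forall>\<theta>. evaluation \<theta> \<longrightarrow> gamma r \<theta> \<sigma> \<ge> c - \<epsilon> - real n * impatience \<theta>)))"
proof -
  have e2: "\<epsilon>/2 > 0" using assms by simp
  obtain n where n: "n > 0" "\<And>f. near_excessive n 1 f \<Longrightarrow> \<exists>g\<in>dominating_equicont. \<forall>x\<in>S. \<bar>f x - g x\<bar> \<le> \<epsilon>/2"
    using near_excessive_near_dominating_equicont[OF e2] by blast
  have "\<exists>\<sigma>. is_play F x \<sigma> \<and> (\<forall>\<theta>. evaluation \<theta> \<longrightarrow> gamma r \<theta> \<sigma> \<ge> c - \<epsilon> - n * impatience \<theta>)"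
    if x: "x \<in> S" and c: "\<forall>g\<in>dominating_equicont. c \<le> g x" for x c
  proof -
    have "guarantees n (c - \<epsilon>/2) (return_pmf x)"
      unfolding guarantees_def
    proof (intro allI impI)
      fix f assume "near_excessive n 1 f"
      then obtain g where "g \<in> dominating_equicont" "\<forall>x\<in>S. \<bar>f x - g x\<bar> \<le> \<epsilon>/2" using n(2) by blast
      then have "c \<le> g x" "\<bar>f x - g x\<bar> \<le> \<epsilon>/2" using c x by auto
      then show "c - \<epsilon>/2 \<le> mean (return_pmf x) f" unfolding mean_return by linarith
    qed
    from guarantees_play[OF n(1) x this e2] obtain \<sigma> where \<sigma>: "is_play F x \<sigma>"
      "\<And>j. (\<Sum>i<n. mean (\<sigma> (j * n + i)) r) \<ge> n * (c - \<epsilon>/2 - \<epsilon>/2)"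
      by blast
    have "gamma r \<theta> \<sigma> \<ge> c - \<epsilon> - n * impatience \<theta>" if \<theta>: "evaluation \<theta>" for \<theta>
      unfolding gamma_def rZ_def
    proof (rule evaluation_payoff_ge_block_average[OF \<theta> _ n(1)])
      show "n * (c - \<epsilon>) \<le> (\<Sum>i<n. mean (\<sigma> (j * n + i)) r)" for j
        using \<sigma>(2)[of j] by simp
      show "0 \<le> mean (\<sigma> t) r \<and> mean (\<sigma> t) r \<le> 1" for t
        by (rule mean_bounds[OF play_in_Zf[OF x \<sigma>(1)] r01])
    qed
    then show ?thesis using \<sigma>(1) by blast
  qed
  then show ?thesis using n(1) by blast
qed

section \<open>Upper bound through invariant measures\<close>

text \<open>Almost invariant pairs violating the bound for \<open>\<eta>\<close> tending to 0 would
  have an invariant weak limit violating domination. Closeness is measured uniformly over bounded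
  \<open>g\<close>, a total variation condition that occupation measures do satisfy.\<close>

lemma invariant_approx:
  assumes f: "f \<in> dominating" and "\<epsilon> > 0"
  shows "\<exists>\<eta>>0. \<forall>p\<in>Zf S. \<forall>q\<in>hatF F p.
    (\<forall>g. (\<forall>x\<in>S. \<bar>g x\<bar> \<le> 1) \<longrightarrow> \<bar>mean q g - mean p g\<bar> \<le> \<eta>) \<longrightarrow> mean p r \<le> mean p f + \<epsilon>"
proof (rule ccontr)
  assume neg: "\<not> ?thesis"
  have "\<forall>k. \<exists>pq. fst pq \<in> Zf S \<and> snd pq \<in> hatF F (fst pq) \<and>
    (\<forall>g. (\<forall>x\<in>S. \<bar>g x\<bar> \<le> 1) \<longrightarrow> \<bar>mean (snd pq) g - mean (fst pq) g\<bar> \<le> 1 / real (Suc k)) \<and>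
    mean (fst pq) r > mean (fst pq) f + \<epsilon>"
  proof
    fix k
    have "1 / real (Suc k) > 0" by simp
    then obtain p q where "p \<in> Zf S" "q \<in> hatF F p"
      "\<forall>g. (\<forall>x\<in>S. \<bar>g x\<bar> \<le> 1) \<longrightarrow> \<bar>mean q g - mean p g\<bar> \<le> 1 / real (Suc k)"
      "\<not> mean p r \<le> mean p f + \<epsilon>"
      using neg by blast
    then show "\<exists>pq. fst pq \<in> Zf S \<and> snd pq \<in> hatF F (fst pq) \<and>
      (\<forall>g. (\<forall>x\<in>S. \<bar>g x\<bar> \<le> 1) \<longrightarrow> \<bar>mean (snd pq) g - mean (fst pq) g\<bar> \<le> 1 / real (Suc k)) \<and>
      mean (fst pq) r > mean (fst pq) f + \<epsilon>"
      by (intro exI[of _ "(p, q)"]) auto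
  qed
  from choice[OF this] obtain pq where pq: "\<forall>k. fst (pq k) \<in> Zf S \<and> snd (pq k) \<in> hatF F (fst (pq k)) \<and>
    (\<forall>g. (\<forall>x\<in>S. \<bar>g x\<bar> \<le> 1) \<longrightarrow> \<bar>mean (snd (pq k)) g - mean (fst (pq k)) g\<bar> \<le> 1 / real (Suc k)) \<and>
    mean (fst (pq k)) r > mean (fst (pq k)) f + \<epsilon>" ..
  define p where "p k = fst (pq k)" for k
  define q where "q k = snd (pq k)" for k
  have p: "p k \<in> Zf S" and q: "q k \<in> hatF F (p k)"
    and close: "(\<forall>x\<in>S. \<bar>g x\<bar> \<le> 1) \<Longrightarrow> \<bar>mean (q k) g - mean (p k) g\<bar> \<le> 1 / real (Suc k)"
    and gap: "mean (p k) f + \<epsilon> \<le> mean (p k) r" for k g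
    using pq by (auto simp: p_def q_def less_imp_le)
  have qZ: "q k \<in> Zf S" for k by (rule hatF_in_Zf[OF p q])
  obtain s M where s: "strict_mono s" and M: "M \<in> Delta S" "Defs.weak_conv S (\<lambda>n. to_meas (p (s n))) M"
    by (rule Zf_weak_sequentially_compact[OF S_compact S_ne p])
  have limp: "(\<lambda>n. mean (p (s n)) g) \<longlonglongrightarrow> (LINT x:S|M. g x)" if g: "continuous_on S g" for g
    using M(2) g unfolding weak_conv_def set_lint_eq_pmf_expectation[OF S_compact g p, symmetric] by blast
  have "Defs.weak_conv S (\<lambda>n. to_meas (q (s n))) M"
    unfolding weak_conv_def
  proof (intro allI impI)
    fix g :: "'a \<Rightarrow> real" assume g: "continuous_on S g"
    obtain B where B: "\<forall>x\<in>S. \<bar>g x\<bar> \<le> B" using bounded_fun_cont[OF g] by (auto simp: bounded_fun_def)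
    define B' where "B' = max B 1"
    have B': "B' > 0" "\<forall>x\<in>S. \<bar>g x\<bar> \<le> B'" using B by (auto simp: B'_def intro: order_trans)
    have "(\<lambda>n. mean (q (s n)) g - mean (p (s n)) g) \<longlonglongrightarrow> 0"
    proof (rule Lim_null_comparison)
      show "\<forall>\<^sub>F n in sequentially. norm (mean (q (s n)) g - mean (p (s n)) g) \<le> B' * (1 / real (Suc (s n)))"
      proof (rule always_eventually, rule allI)
        fix n
        have "\<forall>x\<in>S. \<bar>g x / B'\<bar> \<le> 1" using B' by simp
        from close[OF this, of "s n"]
        have "\<bar>(mean (q (s n)) g - mean (p (s n)) g) / B'\<bar> \<le> 1 / real (Suc (s n))"
          by (simp add: diff_divide_distrib)
        then show "norm (mean (q (s n)) g - mean (p (s n)) g) \<le> B' * (1 / real (Suc (s n)))"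
          using B'(1) by (simp add: pos_divide_le_eq mult.commute)
      qed
      have "(\<lambda>k. 1 / real (Suc (s k))) \<longlonglongrightarrow> 0"
        using LIMSEQ_subseq_LIMSEQ[OF lim_1_over_n[THEN LIMSEQ_Suc] s] by (simp add: o_def)
      then show "(\<lambda>n. B' * (1 / real (Suc (s n)))) \<longlonglongrightarrow> 0"
        by (rule tendsto_mult_right_zero)
    qed
    from tendsto_add[OF limp[OF g] this] have "(\<lambda>n. mean (q (s n)) g) \<longlonglongrightarrow> (LINT x:S|M. g x)" by simp
    then show "(\<lambda>n. LINT x:S|to_meas (q (s n)). g x) \<longlonglongrightarrow> (LINT x:S|M. g x)"
      unfolding set_lint_eq_pmf_expectation[OF S_compact g qZ] .
  qed
  then have "M \<in> R"
    unfolding R_def invariant_measures_def using M p q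
    by (intro CollectI conjI exI[of _ "\<lambda>n. p (s n)"] exI[of _ "\<lambda>n. q (s n)"]) auto
  then have "(LINT x:S|M. r x) \<le> (LINT x:S|M. f x)" using f by (simp add: dominating_def)
  moreover have "continuous_on S f" using f by (simp add: dominating_def)
  have "(LINT x:S|M. f x) + \<epsilon> \<le> (LINT x:S|M. r x)"
    by (rule LIMSEQ_le[OF tendsto_add[OF limp[OF \<open>continuous_on S f\<close>] tendsto_const] limp[OF r_cont]])
      (use gap in auto)
  ultimately show False using \<open>\<epsilon> > 0\<close> by simp
qed

lemma payoff_upper_bound:
  assumes f: "f \<in> dominating" and "\<epsilon> > 0"
  shows "\<exists>\<alpha>>0. \<forall>\<theta> x \<sigma>. evaluation \<theta> \<longrightarrow> impatience \<theta> \<le> \<alpha> \<longrightarrow> x \<in> S \<longrightarrow> is_play F x \<sigma> \<longrightarrow>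
    gamma r \<theta> \<sigma> \<le> f x + \<epsilon>"
proof -
  have "\<epsilon>/2 > 0" using \<open>\<epsilon> > 0\<close> by simp
  obtain \<eta> where \<eta>: "\<eta> > 0" "\<And>p q. p \<in> Zf S \<Longrightarrow> q \<in> hatF F p \<Longrightarrow>
    (\<And>g. (\<forall>x\<in>S. \<bar>g x\<bar> \<le> 1) \<Longrightarrow> \<bar>mean q g - mean p g\<bar> \<le> \<eta>) \<Longrightarrow> mean p r \<le> mean p f + \<epsilon>/2"
    using invariant_approx[OF f \<open>\<epsilon>/2 > 0\<close>] by meson
  have fc: "continuous_on S f" and fF: "\<And>y. y \<in> S \<Longrightarrow> T f y \<le> f y"
    using f by (auto simp: dominating_def intro: T_least)
  \<comment> \<open>The 6 in the threshold: summation by parts leaves three terms of size at most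
    the impatience, and division by \<open>\<Theta> > 1/2\<close> at most doubles them.\<close>
  have "gamma r \<theta> \<sigma> \<le> f x + \<epsilon>"
    if \<theta>: "evaluation \<theta>" and I: "impatience \<theta> \<le> \<eta>/6" and x: "x \<in> S" and \<sigma>: "is_play F x \<sigma>" for \<theta> x \<sigma>
  proof -
    have \<sigma>Z: "\<sigma> t \<in> Zf S" for t by (rule play_in_Zf[OF x \<sigma>])
    have \<theta>0: "\<theta> t \<ge> 0" for t using \<theta> by (simp add: evaluation_def)
    have a: "0 \<le> mean (\<sigma> t) r \<and> mean (\<sigma> t) r \<le> 1" for t
      by (rule mean_bounds[OF \<sigma>Z r01])
    \<comment> \<open>Laws in \<open>Zf\<close> have finite support, so the evaluation is cut at a
      stage \<open>N\<close> that loses less than \<open>\<epsilon>/4\<close> of payoff and keeps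
      mass above 1/2.\<close>
    have "(\<lambda>N. \<Sum>t<N. \<theta> t * mean (\<sigma> t) r) \<longlonglongrightarrow> gamma r \<theta> \<sigma>"
      using summable_LIMSEQ[OF evaluation_payoff_summable[OF \<theta> a]] by (simp add: gamma_def rZ_def)
    then have "\<forall>\<^sub>F N in sequentially. (\<Sum>t<N. \<theta> t * mean (\<sigma> t) r) > gamma r \<theta> \<sigma> - \<epsilon>/4"
      using \<open>\<epsilon> > 0\<close> by (intro order_tendstoD(1)) auto
    moreover have "(\<lambda>N. \<Sum>t<N. \<theta> t) \<longlonglongrightarrow> 1" using \<theta> by (simp add: evaluation_def sums_def)
    then have "\<forall>\<^sub>F N in sequentially. (\<Sum>t<N. \<theta> t) > 1/2"
      by (rule order_tendstoD(1)) simp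
    ultimately have "\<forall>\<^sub>F N in sequentially. (\<Sum>t<N. \<theta> t * mean (\<sigma> t) r) > gamma r \<theta> \<sigma> - \<epsilon>/4 \<and> (\<Sum>t<N. \<theta> t) > 1/2"
      by eventually_elim simp
    from eventually_happens'[OF sequentially_bot this]
    obtain N where N: "(\<Sum>t<N. \<theta> t * mean (\<sigma> t) r) > gamma r \<theta> \<sigma> - \<epsilon>/4" "(\<Sum>t<N. \<theta> t) > 1/2"
      by blast
    define \<Theta> where "\<Theta> = (\<Sum>t<N. \<theta> t)"
    have \<Theta>: "\<Theta> > 1/2" "\<Theta> \<le> 1"
      using N(2) sum_le_suminf[of \<theta> "{..<N}"] \<theta> \<theta>0 by (auto simp: \<Theta>_def evaluation_def sums_iff)
    define Q where "Q = embed_pmf (\<lambda>t. if t < N then \<theta> t / \<Theta> else 0)"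
    have "(\<integral>\<^sup>+t. ennreal (if t < N then \<theta> t / \<Theta> else 0) \<partial>count_space UNIV)
        = (\<Sum>t<N. ennreal (if t < N then \<theta> t / \<Theta> else 0))"
      by (rule nn_integral_count_space'[where A = "{..<N}"]) auto
    also have "\<dots> = ennreal (\<Sum>t<N. if t < N then \<theta> t / \<Theta> else 0)"
      using \<theta>0 \<Theta> by (intro sum_ennreal) auto
    also have "(\<Sum>t<N. if t < N then \<theta> t / \<Theta> else 0) = 1"
      using \<Theta> by (simp add: sum_divide_distrib[symmetric] \<Theta>_def[symmetric])
    finally have pQ: "pmf Q t = (if t < N then \<theta> t / \<Theta> else 0)" for t
      unfolding Q_def using \<theta>0 \<Theta> by (subst pmf_embed_pmf) auto
    have sQ: "set_pmf Q \<subseteq> {..<N}"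
      by (auto simp: set_pmf_iff pQ split: if_splits)
    then have fQ: "finite (set_pmf Q)" by (rule finite_subset) simp
    have mQ: "mean Q w = (\<Sum>t<N. \<theta> t * w t) / \<Theta>" for w
    proof -
      have "mean Q w = (\<Sum>t<N. w t * pmf Q t)"
        using sQ by (intro integral_measure_pmf_real) auto
      also have "\<dots> = (\<Sum>t<N. \<theta> t * w t / \<Theta>)"
        by (intro sum.cong) (auto simp: pQ)
      finally show ?thesis by (simp add: sum_divide_distrib)
    qed
    define p where "p = bind_pmf Q \<sigma>"
    define q where "q = bind_pmf Q (\<lambda>t. \<sigma> (Suc t))"
    have fin: "finite (set_pmf (\<sigma> t))" for t using \<sigma>Z[of t] by (simp add: Zf_def)
    have mp: "mean p g = (\<Sum>t<N. \<theta> t * mean (\<sigma> t) g) / \<Theta>" for g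
      unfolding p_def mQ[symmetric] by (rule mean_bind[OF fQ fin])
    have mq: "mean q g = (\<Sum>t<N. \<theta> t * mean (\<sigma> (Suc t)) g) / \<Theta>" for g
      unfolding q_def mQ[symmetric] by (rule mean_bind[OF fQ fin])
    have pZ: "p \<in> Zf S" unfolding p_def by (rule bind_in_Zf[OF fQ \<sigma>Z])
    have qF: "q \<in> hatF F p"
      unfolding p_def q_def using \<sigma> fin by (intro hatF_bind[OF fQ]) (auto simp: is_play_def)
    have "\<bar>mean q g - mean p g\<bar> \<le> \<eta>" if g: "\<forall>x\<in>S. \<bar>g x\<bar> \<le> 1" for g
    proof -
      define b where "b t = mean (\<sigma> t) g" for t
      have b: "\<bar>b t\<bar> \<le> 1" for t
        using mean_bounds[OF \<sigma>Z, of "-1" g 1 t] g by (force simp: b_def abs_le_iff)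
      have \<theta>I: "\<theta> t * \<bar>b s\<bar> \<le> impatience \<theta>" for t s
        using evaluation_le_impatience[OF \<theta>, of t] mult_left_le[OF b[of s] \<theta>0[of t]] by linarith
      have "\<bar>\<Sum>t<N. (\<theta> (Suc t) - \<theta> t) * b (Suc t)\<bar> \<le> (\<Sum>t<N. \<bar>\<theta> (Suc t) - \<theta> t\<bar>)"
        by (rule order_trans[OF sum_abs]) (auto intro!: sum_mono mult_left_le b simp: abs_mult)
      also have "\<dots> \<le> impatience \<theta>" by (rule sum_abs_increments_le_impatience[OF \<theta>])
      finally have 1: "\<bar>\<Sum>t<N. (\<theta> (Suc t) - \<theta> t) * b (Suc t)\<bar> \<le> impatience \<theta>" .
      have "\<bar>\<theta> N * b N\<bar> \<le> impatience \<theta>" "\<bar>\<theta> 0 * b 0\<bar> \<le> impatience \<theta>"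
        using \<theta>I[of N N] \<theta>I[of 0 0] \<theta>0 by (auto simp: abs_mult)
      with 1 have le: "\<bar>\<Sum>t<N. \<theta> t * (b (Suc t) - b t)\<bar> \<le> 3 * impatience \<theta>"
        unfolding summation_by_parts by linarith
      have "mean q g - mean p g = (\<Sum>t<N. \<theta> t * (b (Suc t) - b t)) / \<Theta>"
        unfolding mp mq b_def by (simp add: right_diff_distrib sum_subtractf diff_divide_distrib)
      then have "\<bar>mean q g - mean p g\<bar> \<le> 3 * impatience \<theta> / \<Theta>"
        using le \<Theta> by (simp add: divide_right_mono)
      also have "\<dots> \<le> (\<eta>/2) / \<Theta>"
        using I \<Theta> by (intro divide_right_mono) auto
      also have "\<dots> \<le> \<eta>"
        using \<Theta> \<eta>(1) by (simp add: field_simps)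
      finally show ?thesis .
    qed
    then have pr: "mean p r \<le> mean p f + \<epsilon>/2" by (rule \<eta>(2)[OF pZ qF])
    have \<sigma>f: "mean (\<sigma> t) f \<le> f x" for t
    proof (induction t)
      case 0
      have "\<sigma> 0 \<in> convF F x" using \<sigma> by (simp add: is_play_def)
      then show ?case using convF_le_T[OF bounded_fun_cont[OF fc] x] fF[OF x] by force
    next
      case (Suc t)
      have "\<sigma> (Suc t) \<in> hatF F (\<sigma> t)" using \<sigma> by (simp add: is_play_def)
      then have "mean (\<sigma> (Suc t)) f \<le> mean (\<sigma> t) (T f)"
        by (rule hatF_le_T[OF bounded_fun_cont[OF fc] \<sigma>Z])
      also have "\<dots> \<le> mean (\<sigma> t) f" by (rule mean_mono[OF \<sigma>Z fF])
      finally show ?case using Suc by simp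
    qed
    have "mean p f \<le> (\<Sum>t<N. \<theta> t * f x) / \<Theta>"
      unfolding mp using \<sigma>f \<theta>0 \<Theta> by (intro divide_right_mono sum_mono mult_left_mono) auto
    then have pf: "mean p f \<le> f x"
      using \<Theta> by (simp add: sum_distrib_right[symmetric] \<Theta>_def[symmetric])
    have "(\<Sum>t<N. \<theta> t * mean (\<sigma> t) r) = \<Theta> * mean p r"
      unfolding mp using \<Theta> by simp
    \<comment> \<open>Normalising only helps: \<open>\<Theta> \<le> 1\<close> and the payoff is
      nonnegative.\<close>
    also have "\<dots> \<le> mean p r"
      using \<Theta> mean_bounds[OF pZ r01] by (intro mult_left_le_one_le) auto
    finally show ?thesis using N(1) pr pf \<open>\<epsilon> > 0\<close> by linarith
  qed
  then show ?thesis
    using \<eta>(1) by (intro exI[of _ "\<eta>/6"]) auto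
qed

section \<open>Identification of the value\<close>

text \<open>If the equicontinuous infimum exceeded \<open>vstar\<close> by
  \<open>\<epsilon>\<close>, some play would earn at least \<open>vstar + \<epsilon>/2\<close> at
  patient evaluations, while each dominating \<open>f\<close> caps its payoff by
  \<open>f x + \<epsilon>/4\<close>. Every such \<open>f x\<close> would then be at least
  \<open>vstar + \<epsilon>/4\<close>, against the definition as an infimum.\<close>

lemma dominating_equicont_near_vstar:
  assumes x: "x \<in> S" and "\<epsilon> > 0"
  shows "\<exists>g\<in>dominating_equicont. g x < vstar S F r x + \<epsilon>"
proof (rule ccontr)
  assume "\<not> ?thesis"
  then have c: "\<forall>g\<in>dominating_equicont. vstar S F r x + \<epsilon> \<le> g x" by force
  have e4: "\<epsilon>/4 > 0" using \<open>\<epsilon> > 0\<close> by simp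
  obtain n \<sigma> where n: "n > 0" and \<sigma>: "is_play F x \<sigma>"
    "\<And>\<theta>. evaluation \<theta> \<Longrightarrow> gamma r \<theta> \<sigma> \<ge> vstar S F r x + \<epsilon> - \<epsilon>/4 - real n * impatience \<theta>"
    using block_plays_above[OF e4] x c by metis
  have "vstar S F r x + \<epsilon>/4 \<le> f x" if f: "f \<in> dominating" for f
  proof -
    obtain \<alpha> where \<alpha>: "\<alpha> > 0" "\<And>\<theta>. evaluation \<theta> \<Longrightarrow> impatience \<theta> \<le> \<alpha> \<Longrightarrow> gamma r \<theta> \<sigma> \<le> f x + \<epsilon>/4"
      using payoff_upper_bound[OF f e4] x \<sigma>(1) by metis
    \<comment> \<open>\<open>\<alpha>\<close> depends on \<open>f\<close>, the play and
      \<open>n\<close> do not; a sufficiently patient evaluation meets both bounds.\<close>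
    have "min \<alpha> (\<epsilon>/4/n) > 0" using \<alpha>(1) e4 n by simp
    then obtain \<theta> where \<theta>: "evaluation \<theta>" "impatience \<theta> \<le> min \<alpha> (\<epsilon>/4/n)"
      using exists_patient_evaluation by blast
    have "real n * impatience \<theta> \<le> n * (\<epsilon>/4/n)"
      using \<theta>(2) by (intro mult_left_mono) auto
    then have "real n * impatience \<theta> \<le> \<epsilon>/4" using n by simp
    then show ?thesis
      using \<sigma>(2)[OF \<theta>(1)] \<alpha>(2)[OF \<theta>(1)] \<theta>(2) by simp
  qed
  then have "vstar S F r x + \<epsilon>/4 \<le> vstar S F r x" by (rule vstar_greatest)
  then show False using \<open>\<epsilon> > 0\<close> by simp
qed

lemma uniform_plays:
  assumes "\<epsilon> > 0"
  shows "\<exists>\<alpha>>0. \<exists>\<sigma>. (\<forall>x\<in>S. is_play F x (\<sigma> x)) \<and>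
        (\<forall>\<theta>. evaluation \<theta> \<and> impatience \<theta> \<le> \<alpha> \<longrightarrow>
           (\<forall>x\<in>S. gamma r \<theta> (\<sigma> x) \<ge> vstar S F r x - \<epsilon>))"
proof -
  have e2: "\<epsilon>/2 > 0" using assms by simp
  obtain n :: nat where n: "n > 0" and ex: "\<forall>x\<in>S. \<forall>c. (\<forall>g\<in>dominating_equicont. c \<le> g x) \<longrightarrow>
    (\<exists>\<sigma>. is_play F x \<sigma> \<and> (\<forall>\<theta>. evaluation \<theta> \<longrightarrow> gamma r \<theta> \<sigma> \<ge> c - \<epsilon>/2 - real n * impatience \<theta>))"
    using block_plays_above[OF e2] by (elim exE conjE)
  have "\<forall>x\<in>S. \<exists>\<sigma>. is_play F x \<sigma> \<and>
    (\<forall>\<theta>. evaluation \<theta> \<longrightarrow> gamma r \<theta> \<sigma> \<ge> vstar S F r x - \<epsilon>/2 - real n * impatience \<theta>)"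
  proof
    fix x assume x: "x \<in> S"
    have "\<forall>g\<in>dominating_equicont. vstar S F r x \<le> g x" using vstar_le x by (auto simp: dominating_equicont_def)
    then show "\<exists>\<sigma>. is_play F x \<sigma> \<and>
      (\<forall>\<theta>. evaluation \<theta> \<longrightarrow> gamma r \<theta> \<sigma> \<ge> vstar S F r x - \<epsilon>/2 - real n * impatience \<theta>)"
      by (rule ex[THEN bspec, OF x, THEN spec, THEN mp])
  qed
  from bchoice[OF this] obtain \<sigma> where \<sigma>: "\<And>x. x \<in> S \<Longrightarrow> is_play F x (\<sigma> x)"
    "\<And>x \<theta>. x \<in> S \<Longrightarrow> evaluation \<theta> \<Longrightarrow> gamma r \<theta> (\<sigma> x) \<ge> vstar S F r x - \<epsilon>/2 - real n * impatience \<theta>"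
    by blast
  have "gamma r \<theta> (\<sigma> x) \<ge> vstar S F r x - \<epsilon>"
    if "evaluation \<theta>" "impatience \<theta> \<le> \<epsilon>/2/n" "x \<in> S" for \<theta> x
  proof -
    have "real n * impatience \<theta> \<le> n * (\<epsilon>/2/n)"
      using that(2) by (intro mult_left_mono) auto
    then have "real n * impatience \<theta> \<le> \<epsilon>/2" using n by simp
    then show ?thesis using \<sigma>(2)[OF that(3,1)] by linarith
  qed
  moreover have "\<epsilon>/2/n > 0" using e2 n by simp
  ultimately show ?thesis
    using \<sigma>(1) by (intro exI[of _ "\<epsilon>/2/n"] conjI exI[of _ \<sigma>]) auto
qed

text \<open>An equicontinuous dominating function with value close to \<open>vstar\<close> at
  \<open>x\<close> varies with \<open>x\<close>; a finite net leaves finitely many functions, and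
  the least of their thresholds serves all \<open>x\<close>.\<close>

lemma uniform_upper_bound:
  assumes "\<epsilon> > 0"
  shows "\<exists>\<alpha>>0. \<forall>\<theta> x \<sigma>. evaluation \<theta> \<longrightarrow> impatience \<theta> \<le> \<alpha> \<longrightarrow> x \<in> S \<longrightarrow> is_play F x \<sigma> \<longrightarrow>
    gamma r \<theta> \<sigma> \<le> vstar S F r x + \<epsilon>"
proof -
  have e3: "\<epsilon>/3 > 0" using assms by simp
  obtain N where N: "finite N" "N \<subseteq> dominating_equicont" "\<And>f. f \<in> dominating_equicont \<Longrightarrow> \<exists>g\<in>N. \<forall>x\<in>S. \<bar>f x - g x\<bar> \<le> \<epsilon>/3"
  proof (rule equicontinuous_finite_net[OF S_compact _ _ e3, of dominating_equicont])
    show "0 \<le> f x \<and> f x \<le> 1" if "f \<in> dominating_equicont" "x \<in> S" for f x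
      using that by (auto simp: dominating_equicont_def dominating_def)
    show "\<exists>\<delta>>0. \<forall>f\<in>dominating_equicont. \<forall>x\<in>S. \<forall>y\<in>S. dist x y < \<delta> \<longrightarrow> \<bar>f x - f y\<bar> < e" if "e > 0" for e
    proof -
      have e2: "e/2 > 0" using that by simp
      have "\<bar>f x - f y\<bar> < e" if "f \<in> dominating_equicont" "x \<in> S" "y \<in> S" "dist x y < modulus (e/2)" for f x y
      proof -
        have "\<bar>f x - f y\<bar> \<le> e/2" using that e2 unfolding dominating_equicont_def by blast
        then show ?thesis using e2 by linarith
      qed
      then show ?thesis using modulus(1)[OF e2] by blast
    qed
  qed auto
  have "\<forall>g\<in>N. \<exists>\<alpha>. \<alpha> > 0 \<and> (\<forall>\<theta> x \<sigma>. evaluation \<theta> \<longrightarrow> impatience \<theta> \<le> \<alpha> \<longrightarrow> x \<in> S \<longrightarrow> is_play F x \<sigma> \<longrightarrow>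
    gamma r \<theta> \<sigma> \<le> g x + \<epsilon>/3)"
    using payoff_upper_bound[OF _ e3] N(2) by (auto simp: dominating_equicont_def)
  from bchoice[OF this] obtain A where A: "\<And>g. g \<in> N \<Longrightarrow> A g > 0"
    "\<And>g \<theta> x \<sigma>. g \<in> N \<Longrightarrow> evaluation \<theta> \<Longrightarrow> impatience \<theta> \<le> A g \<Longrightarrow> x \<in> S \<Longrightarrow> is_play F x \<sigma> \<Longrightarrow>
       gamma r \<theta> \<sigma> \<le> g x + \<epsilon>/3"
    by blast
  \<comment> \<open>The inserted 1 keeps \<open>Min\<close> off the empty set.\<close>
  define \<alpha> where "\<alpha> = Min (insert 1 (A ` N))"
  have "\<alpha> > 0" unfolding \<alpha>_def using N(1) A(1) by simp
  have \<alpha>le: "\<alpha> \<le> A g" if "g \<in> N" for g unfolding \<alpha>_def using N(1) that by simp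
  have "gamma r \<theta> \<sigma> \<le> vstar S F r x + \<epsilon>"
    if \<theta>: "evaluation \<theta>" "impatience \<theta> \<le> \<alpha>" and x: "x \<in> S" and \<sigma>: "is_play F x \<sigma>" for \<theta> x \<sigma>
  proof -
    obtain f where f: "f \<in> dominating_equicont" "f x < vstar S F r x + \<epsilon>/3" using dominating_equicont_near_vstar[OF x e3] by blast
    obtain g where g: "g \<in> N" "\<forall>x\<in>S. \<bar>f x - g x\<bar> \<le> \<epsilon>/3" using N(3)[OF f(1)] by blast
    have "gamma r \<theta> \<sigma> \<le> g x + \<epsilon>/3"
      using A(2)[OF g(1) \<theta>(1) _ x \<sigma>] \<alpha>le[OF g(1)] \<theta>(2) by simp
    moreover have "\<bar>f x - g x\<bar> \<le> \<epsilon>/3" using g(2) x by blast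
    ultimately show ?thesis using f(2) by linarith
  qed
  then show ?thesis using \<open>\<alpha> > 0\<close> by blast
qed

lemma general_uniform_value: "has_general_uniform_value S F r (vstar S F r)"
  unfolding has_general_uniform_value_def
proof
  show "\<forall>\<epsilon>>0. \<exists>\<alpha>>0. \<exists>\<sigma>. (\<forall>x\<in>S. is_play F x (\<sigma> x)) \<and>
        (\<forall>\<theta>. evaluation \<theta> \<and> impatience \<theta> \<le> \<alpha> \<longrightarrow>
           (\<forall>x\<in>S. gamma r \<theta> (\<sigma> x) \<ge> vstar S F r x - \<epsilon>))"
    by (intro allI impI uniform_plays)
  show "has_general_limit_value S F r (vstar S F r)"
    unfolding has_general_limit_value_def
  proof (intro allI impI)
    fix \<epsilon> :: real assume \<epsilon>: "\<epsilon> > 0"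
    obtain \<alpha>1 \<sigma> where \<alpha>1: "\<alpha>1 > 0" and \<sigma>: "\<And>x. x \<in> S \<Longrightarrow> is_play F x (\<sigma> x)"
      and lower: "\<And>\<theta> x. evaluation \<theta> \<Longrightarrow> impatience \<theta> \<le> \<alpha>1 \<Longrightarrow> x \<in> S \<Longrightarrow>
        gamma r \<theta> (\<sigma> x) \<ge> vstar S F r x - \<epsilon>"
      using uniform_plays[OF \<epsilon>] by blast
    obtain \<alpha>2 where \<alpha>2: "\<alpha>2 > 0"
      and upper: "\<And>\<theta> x \<sigma>. evaluation \<theta> \<Longrightarrow> impatience \<theta> \<le> \<alpha>2 \<Longrightarrow> x \<in> S \<Longrightarrow> is_play F x \<sigma> \<Longrightarrow>
        gamma r \<theta> \<sigma> \<le> vstar S F r x + \<epsilon>"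
      using uniform_upper_bound[OF \<epsilon>] by blast
    have "\<bar>val F r \<theta> x - vstar S F r x\<bar> \<le> \<epsilon>"
      if \<theta>: "evaluation \<theta>" "impatience \<theta> \<le> min \<alpha>1 \<alpha>2" and x: "x \<in> S" for \<theta> x
    proof -
      have I: "impatience \<theta> \<le> \<alpha>1" "impatience \<theta> \<le> \<alpha>2" using \<theta>(2) by auto
      have up: "gamma r \<theta> \<tau> \<le> vstar S F r x + \<epsilon>" if "is_play F x \<tau>" for \<tau>
        by (rule upper[OF \<theta>(1) I(2) x that])
      have "val F r \<theta> x \<le> vstar S F r x + \<epsilon>"
        unfolding val_def using \<sigma>[OF x] up by (intro cSUP_least) auto
      \<comment> \<open>The uniform upper bound also supplies the boundedness that the real
        \<open>SUP\<close> in \<open>val\<close> requires.\<close>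
      moreover have "gamma r \<theta> (\<sigma> x) \<le> val F r \<theta> x"
        unfolding val_def using \<sigma>[OF x] up
        by (intro cSUP_upper bdd_aboveI[of _ "vstar S F r x + \<epsilon>"]) auto
      ultimately show ?thesis
        using lower[OF \<theta>(1) I(1) x] by linarith
    qed
    then show "\<exists>\<alpha>>0. \<forall>\<theta>. evaluation \<theta> \<and> impatience \<theta> \<le> \<alpha> \<longrightarrow>
        (\<forall>x\<in>S. \<bar>val F r \<theta> x - vstar S F r x\<bar> \<le> \<epsilon>)"
      using \<alpha>1 \<alpha>2 by (intro exI[of _ "min \<alpha>1 \<alpha>2"]) auto
  qed
qed

end

theorem theorem3:
  fixes S :: "'a::metric_space set"
    and F :: "'a \<Rightarrow> 'a pmf set"
    and r :: "'a \<Rightarrow> real"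
  assumes "S \<noteq> {}" and "compact S"
    and "\<forall>x\<in>S. F x \<noteq> {} \<and> F x \<subseteq> Zf S"
    and "\<forall>x\<in>S. 0 \<le> r x \<and> r x \<le> 1"
    and "continuous_on S r"
    and "\<forall>x\<in>S. \<forall>x'\<in>S. \<forall>u\<in>F x. \<exists>u'\<in>F x'. dKR S (to_meas u) (to_meas u') \<le> dist x x'"
  shows "has_general_uniform_value S F r (vstar S F r)"
proof -
  interpret gambling_house S F r
    using assms by unfold_locales auto
  show ?thesis by (rule general_uniform_value)
qed

end
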